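(* Let $d\ge1$. Let $D_0,D$ be open convex bounded domains in $\mathbb{R}^d$ with $D_0\cap\mathbb{Z}^d\neq\emptyset$, $D\cap\mathbb{Z}^d\ne\emptyset$ and $\operatorname{dist}(D,D_0)>\operatorname{diam}D$. Let $f_0,f:\mathbb{Z}^d\to\mathbb{C}$ satisfy $\operatorname{supp}f_0\subset D_0$, $\operatorname{supp}f\subset D$, $f_0\not\equiv0$, and let $a_1^-$ be the far-field amplitude $a^-$ of the source $f+f_0$. Let $\mathcal{N}\subseteq\mathbb{S}^{d-1}\times\Lambda$ be an open nonempty neighbourhood of some fixed pair $(\omega,\lambda)\in\mathbb{S}^{d-1}\times\Lambda$. Then the intensity $|a_1^-|^2=|a_1^-(\omega,\lambda)|^2$ given on $\mathcal{N}$ uniquely determines $f$, assuming that $f_0$ is known a priori. That is, with $D_0,D,f_0$ fixed, if $f,g:\mathbb{Z}^d\to\mathbb{C}$ are both supported in $D$ and the squared moduli of the far-field amplitudes $a^-$ of $f+f_0$ and of $g+f_0$ coincide on $\mathcal{N}$, then $f=g$.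
   Context: Discrete Laplacian: $\Delta\psi(x)=\sum_{x'\in\mathbb{Z}^d,\,|x'-x|=1}\psi(x')$, $x\in\mathbb{Z}^d$. The discrete Helmholtz equation with source $f$ is $\Delta\psi-\lambda\psi=f$ on $\mathbb{Z}^d$. Let $\Lambda=\{\zeta\in\mathbb{R}:\ 2d-4<|\zeta|<2d\}$, $T^d=\mathbb{R}^d/2\pi\mathbb{Z}^d$, $\phi(k)=2\sum_{i=1}^d\cos k_i$, and $\Gamma(\lambda)=\{k\in T^d:\phi(k)=\lambda\}$. For bounded sets in $\mathbb{R}^d$: $\operatorname{diam}D=\sup_{x,y\in D}|x-y|$, $\operatorname{dist}(D,D_0)=\inf_{x\in D,\,y\in D_0}|x-y|$. For $\lambda\in\Lambda$ and $\omega\in\mathbb{S}^{d-1}$, $\kappa(\omega,\lambda)$ denotes the unique point of $\Gamma(\lambda)$ with $\nabla\phi(\kappa)/|\nabla\phi(\kappa)|=\omega$, and $\mu(\omega,\lambda)=\kappa(\omega,\lambda)\cdot\omega$ (for $x\in\mathbb{Z}^d\setminus\{0\}$ and $\omega=x/|x|$ one has $e^{-i\mu(\omega,\lambda)|x|}=e^{-i\kappa(\omega,\lambda)\cdot x}$, which is well defined for $\kappa\in T^d$). For a compactly supported source $f$ and $\lambda\in\Lambda$ let $\psi^-(x)=\lim_{\nu\to\lambda-i0}\big((\Delta-\nu)^{-1}f\big)(x)$, $x\in\mathbb{Z}^d$, where $(\Delta-\nu)^{-1}:\ell^2(\mathbb{Z}^d)\to\ell^2(\mathbb{Z}^d)$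 for $\operatorname{Im}\nu\ne0$. The far-field amplitude $a^-(\omega,\lambda)$ of $f$ is the function, continuous (indeed smooth) in $\omega\in\mathbb{S}^{d-1}$, determined by the asymptotic formula $$\psi^-(x)=\frac{e^{-i\mu(\omega,\lambda)|x|}}{|x|^{(d-1)/2}}\,a^-(\omega,\lambda)+O\big(|x|^{-(d+1)/2}\big),\qquad \omega=x/|x|,\ |x|\to\infty,\ x\in\mathbb{Z}^d,$$ with remainder uniform in $\omega$. (The directions $x/|x|$, $x\in\mathbb{Z}^d\setminus\{0\}$, are dense in $\mathbb{S}^{d-1}$, and $a^-$ is extended to all of $\mathbb{S}^{d-1}$ by continuity.) *)

theory Defs
  imports "HOL-Analysis.Analysis"
begin

text \<open>The lattice $\mathbb{Z}^d$ is the type \<^typ>\<open>int ^ 'n\<close> with $d = $ \<^term>\<open>CARD('n)\<close>, so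
  $d \geq 1$; Euclidean notions are applied to lattice points through the following inclusion
  into $\mathbb{R}^d$.\<close>

definition lattice_point :: "int ^ 'n \<Rightarrow> real ^ 'n" where
  "lattice_point x = (\<chi> i. real_of_int (x $ i))"

definition discrete_laplacian :: "(int ^ 'n \<Rightarrow> complex) \<Rightarrow> int ^ 'n \<Rightarrow> complex" where
  "discrete_laplacian \<psi> x = (\<Sum>y | norm (lattice_point y - lattice_point x) = 1. \<psi> y)"

definition ell2 :: "(int ^ 'n \<Rightarrow> complex) set" where
  "ell2 = {u. (\<lambda>x. (cmod (u x))\<^sup>2) summable_on UNIV}"

text \<open>The function $(\Delta - \nu)^{-1} f$; meaningful for $f \in \ell^2$ and
  $\mathrm{Im}\, \nu \neq 0$.\<close>

definition laplacian_resolvent :: "complex \<Rightarrow> (int ^ 'n \<Rightarrow> complex) \<Rightarrow> int ^ 'n \<Rightarrow> complex" where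
  "laplacian_resolvent \<nu> f =
     (THE u. u \<in> ell2 \<and> (\<forall>x. discrete_laplacian u x - \<nu> * u x = f x))"

text \<open>\<open>\<psi>\<close> is $\psi^-$: here $\nu \to \lambda - i0$ is convergence to $\lambda$ from within the
  open lower half-plane.\<close>

definition is_psi_minus :: "(int ^ 'n \<Rightarrow> complex) \<Rightarrow> real \<Rightarrow> (int ^ 'n \<Rightarrow> complex) \<Rightarrow> bool" where
  "is_psi_minus f lam \<psi> \<longleftrightarrow>
     (\<forall>x. ((\<lambda>\<nu>. laplacian_resolvent \<nu> f x) \<longlongrightarrow> \<psi> x)
            (at (complex_of_real lam) within {\<nu>. Im \<nu> < 0}))"

definition Lambda :: "nat \<Rightarrow> real set" where
  "Lambda d = {\<zeta>. 2 * real d - 4 < \<bar>\<zeta>\<bar> \<and> \<bar>\<zeta>\<bar> < 2 * real d}"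

definition phi :: "real ^ 'n \<Rightarrow> real" where
  "phi k = 2 * (\<Sum>i\<in>UNIV. cos (k $ i))"

text \<open>Points of $T^d = \mathbb{R}^d / 2\pi\mathbb{Z}^d$ are given by their unique representatives
  in $(-\pi, \pi]^d$. The quantity $e^{-i\mu(\omega,\lambda)|x|} = e^{-i\kappa(\omega,\lambda)\cdot x}$
  for $\omega = x/|x|$ and $x \in \mathbb{Z}^d$ does not depend on this choice.\<close>

definition torus :: "(real ^ 'n) set" where
  "torus = {k. \<forall>i. - pi < k $ i \<and> k $ i \<le> pi}"

definition Gamma_surface :: "real \<Rightarrow> (real ^ 'n) set" where
  "Gamma_surface lam = {k \<in> torus. phi k = lam}"

definition kappa :: "real ^ 'n \<Rightarrow> real \<Rightarrow> real ^ 'n" where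
  "kappa \<omega> lam =
     (THE k. k \<in> Gamma_surface lam \<and> (\<exists>g. GDERIV phi k :> g \<and> g /\<^sub>R norm g = \<omega>))"

definition mu :: "real ^ 'n \<Rightarrow> real \<Rightarrow> real" where
  "mu \<omega> lam = kappa \<omega> lam \<bullet> \<omega>"

text \<open>\<open>a\<close> is the far-field amplitude $a^-$ of the source \<open>f\<close> (only its values on
  $\mathbb{S}^{d-1} \times \Lambda$ matter). The remainder bound is uniform in the direction
  but its constants may depend on $\lambda$.\<close>

definition is_far_field_amplitude ::
  "(int ^ 'n \<Rightarrow> complex) \<Rightarrow> (real ^ 'n \<Rightarrow> real \<Rightarrow> complex) \<Rightarrow> bool" where
  "is_far_field_amplitude f a \<longleftrightarrow>
     (\<forall>lam\<in>Lambda CARD('n).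
        continuous_on (sphere 0 1) (\<lambda>\<omega>. a \<omega> lam) \<and>
        (\<exists>\<psi>. is_psi_minus f lam \<psi> \<and>
          (\<exists>C R. \<forall>x. x \<noteq> 0 \<longrightarrow> R \<le> norm (lattice_point x) \<longrightarrow>
            (let r = norm (lattice_point x); \<omega> = lattice_point x /\<^sub>R r in
              cmod (\<psi> x - exp (- \<i> * of_real (mu \<omega> lam * r))
                            / of_real (r powr ((real CARD('n) - 1) / 2)) * a \<omega> lam)
                \<le> C * r powr (- (real CARD('n) + 1) / 2)))))"

end

theory Submission
  imports Defs
begin

text \<open>
Write \<open>F\<^sub>1 = f + f\<^sub>0\<close>, \<open>F\<^sub>2 = g + f\<^sub>0\<close>, and let \<open>ft F k\<close> be the trigonometric polynomial
\<open>\<Sum>x. F x * exp (i k \<bullet> x)\<close>. An explicit far field (stationary phase) would give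
\<open>a \<omega> lam = c \<omega> lam * ft F (kappa \<omega> lam)\<close> with a factor \<open>c\<close> that does not depend on \<open>F\<close> and never
vanishes. Both properties of \<open>c\<close> can be had without computing it, from the bare asymptotic
formula.

\<^emph>\<open>Independence of the source\<close> (\<open>amplitude_ratio\<close>). Convolving an outgoing solution with a finitely
supported \<open>h\<close> gives the outgoing solution for the convolved source, and it multiplies the amplitude
by \<open>ft h (kappa \<omega> lam)\<close>, because translating by \<open>y\<close> multiplies the leading term by
\<open>exp (i kappa \<bullet> y)\<close>. As \<open>F\<^sub>2 * \<psi>\<^sub>1\<close> and \<open>F\<^sub>1 * \<psi>\<^sub>2\<close> are both the outgoing solution with source
\<open>F\<^sub>1 * F\<^sub>2\<close>, comparing their amplitudes yields \<open>ft F\<^sub>2 * a\<^sub>1 = ft F\<^sub>1 * a\<^sub>2\<close> at \<open>kappa \<omega> lam\<close>. The effect of a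
translation on the phase rests on the geometry of the level sets of \<open>phi\<close>: for \<open>lam\<close> in \<open>Lambda\<close> they
bound strictly convex bodies modulo periods. Hence \<open>kappa\<close> exists, is unique and, modulo periods,
continuous, and the phase \<open>r \<mapsto> kappa (r / |r|) \<bullet> r\<close> is up to sign the support function of such a body,
whose gradient is \<open>kappa\<close>.

\<^emph>\<open>Nonvanishing\<close> (\<open>amplitude_vanishing_local\<close>). If \<open>a\<close> vanishes at all directions whose point
\<open>kappa \<omega> lam\<close> lies near \<open>k\<^sub>0\<close>, then \<open>ft F k\<^sub>0 = 0\<close>. The flux \<open>Im (\<Sum>x. cnj (\<psi> x) * F x)\<close> can be estimated
twice: by Green's identity on large balls it is at most a constant times the squared supremum of
the amplitude, and by the Fourier representation of the resolvent it is at least a constant times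
\<open>|ft F|\<^sup>2\<close> near \<open>k\<^sub>0\<close>. Convolving with a power of a trigonometric bump centred at \<open>k\<^sub>0\<close> makes the upper
bound decay at a faster exponential rate than the lower one, unless \<open>ft F k\<^sub>0 = 0\<close>.

Together: at a point \<open>k\<close> with \<open>|ft F\<^sub>1 k| \<noteq> |ft F\<^sub>2 k|\<close> seen by \<open>N\<close>, equality of the intensities and the
ratio formula force both amplitudes to vanish in all directions whose \<open>kappa\<close> is near \<open>k\<close>, hence \<open>ft F\<^sub>1 k = ft F\<^sub>2 k = 0\<close>, which is
absurd. So \<open>|ft F\<^sub>1| = |ft F\<^sub>2|\<close> on a nonempty open set. These are trigonometric polynomials, so \<open>F\<^sub>1\<close> and
\<open>F\<^sub>2\<close> have the same autocorrelation. The displacements from \<open>D\<^sub>0\<close> to \<open>D\<close> do not occur within \<open>D\<close>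
(which is too small) nor from \<open>D\<close> to \<open>D\<^sub>0\<close> (by convexity), so the autocorrelation contains the
cross-correlation of \<open>f\<close> with \<open>f\<^sub>0\<close> undisturbed, and dividing by \<open>ft f\<^sub>0\<close> recovers \<open>f\<close>
(\<open>source_from_autocorrelation\<close>).
\<close>

section \<open>A convexity inequality for sums of squared sines\<close>

lemma tan_chord:
  fixes a b :: real
  assumes "0 \<le> a" "a \<le> b" "0 < b" "b < pi/2"
  shows "b * tan a \<le> a * tan b"
proof -
  have cos_pos: "cos x > 0" if "x \<in> {0..<pi/2}" for x :: real
    using that by (intro cos_gt_zero_pi) auto
  have "convex_on {0..<pi/2} tan"
  proof (rule convex_on_realI[where f' = "\<lambda>x. inverse ((cos x)\<^sup>2)"])
    show "(tan has_real_derivative inverse ((cos x)\<^sup>2)) (at x)" if "x \<in> {0..<pi/2}" for x :: real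
      using cos_pos[OF that] by (intro DERIV_tan) auto
    show "inverse ((cos x)\<^sup>2) \<le> inverse ((cos y)\<^sup>2)"
      if "x \<in> {0..<pi/2}" "y \<in> {0..<pi/2}" "x \<le> y" for x y :: real
    proof (rule le_imp_inverse_le)
      show "0 < (cos y)\<^sup>2" using cos_pos[OF that(2)] by simp
      show "(cos y)\<^sup>2 \<le> (cos x)\<^sup>2"
        using that cos_pos[OF that(2)] by (intro power_mono cos_monotone_0_pi_le) auto
    qed
  qed auto
  from convex_onD[OF this, of "a/b" 0 b] assms have "tan a \<le> (a/b) * tan b"
    by simp
  then show ?thesis using assms by (simp add: field_simps)
qed

lemma sin_chord:
  fixes a b :: real
  assumes "0 \<le> a" "a \<le> b" "0 < b" "b < pi/2"
  shows "a * sin b \<le> b * sin a"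
proof -
  have "convex_on {0..pi} (\<lambda>x. - sin x :: real)"
  proof (rule convex_on_realI[where f' = "\<lambda>x. - cos x"])
    show "((\<lambda>x. - sin x :: real) has_real_derivative - cos x) (at x)" for x
      by (auto intro!: derivative_eq_intros)
    show "- cos x \<le> - cos y"
      if "x \<in> {0..pi}" "y \<in> {0..pi}" "x \<le> y" for x y :: real
      using that cos_monotone_0_pi_le[of x y] by simp
  qed auto
  from convex_onD[OF this, of "a/b" 0 b] assms have "- sin a \<le> (a/b) * (- sin b)"
    by simp
  then show ?thesis using assms by (simp add: field_simps)
qed

text \<open>For \<open>sin a = p\<close> and a great circle through \<open>p\<close> that reaches \<open>sin b\<close> at time \<open>t\<close>, this says that the arc
\<open>arcsin\<close> along the circle lies below its tangent line at time \<open>0\<close>. Sines of \<open>b\<close> are expanded around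
\<open>a\<close>; what remains is monotonicity of \<open>sin t / t\<close> when \<open>b\<close> exceeds \<open>a\<close> and of \<open>tan t / t\<close>
otherwise.\<close>

lemma arc_tangent_bound:
  fixes a b t :: real
  assumes a: "0 \<le> a" "a < pi/2" and b: "0 \<le> b" "b < pi/2"
    and t: "0 < t" "t < pi/2" "\<bar>b - a\<bar> \<le> t"
  shows "cos a * (b - a) * sin t \<le> t * (sin b - sin a * cos t)"
proof (cases "a \<le> b")
  case True
  have "sin b = sin a * cos (b - a) + cos a * sin (b - a)"
    using sin_add[of a "b - a"] by simp
  moreover have "(b - a) * sin t \<le> t * sin (b - a)"
    using sin_chord[of "b - a" t] True t by simp
  then have "cos a * ((b - a) * sin t) \<le> cos a * (t * sin (b - a))"
    using a by (intro mult_left_mono cos_ge_zero) auto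
  moreover have "cos t \<le> cos (b - a)"
    using True t by (intro cos_monotone_0_pi_le) auto
  then have "0 \<le> t * (sin a * (cos (b - a) - cos t))"
    using a t by (intro mult_nonneg_nonneg sin_ge_zero) auto
  ultimately show ?thesis by (simp add: algebra_simps)
next
  case False
  define e where "e = a - b"
  have e: "0 < e" "e \<le> a" "e \<le> t" using False b t by (auto simp: e_def)
  have ca: "cos a > 0" using a by (intro cos_gt_zero_pi) auto
  have ce: "cos e > 0" using e a by (intro cos_gt_zero_pi) auto
  have ct: "cos t > 0" using t by (intro cos_gt_zero_pi) auto
  have sb: "sin b = sin a * cos e - cos a * sin e"
    using sin_diff[of a e] by (simp add: e_def)
  have "tan e \<le> tan a" using e a by (intro tan_mono_le) auto
  then have "cos a * tan e \<le> sin a" using ca by (simp add: tan_def field_simps)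
  moreover have "cos t \<le> cos e" using e t by (intro cos_monotone_0_pi_le) auto
  ultimately have "cos a * tan e * (cos e - cos t) \<le> sin a * (cos e - cos t)"
    by (intro mult_right_mono) auto
  then have 1: "t * (cos a * tan e * (cos e - cos t)) \<le> t * (sin a * (cos e - cos t))"
    using t by (intro mult_left_mono) auto
  have "t * tan e \<le> e * tan t" using tan_chord[of e t] e t by simp
  then have "cos t * (t * tan e) \<le> cos t * (e * tan t)" using ct by (intro mult_left_mono) auto
  also have "\<dots> = e * sin t" using ct by (simp add: tan_def)
  finally have "cos a * (cos t * (t * tan e)) \<le> cos a * (e * sin t)"
    using ca by (intro mult_left_mono) auto
  moreover have "tan e * cos e = sin e" using ce by (simp add: tan_def)
  then have "t * (cos a * tan e * (cos e - cos t))
      = t * (cos a * sin e) - cos a * (cos t * (t * tan e))"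
    by (simp add: algebra_simps)
  ultimately have "t * (cos a * sin e) - cos a * (e * sin t) \<le> t * (sin a * (cos e - cos t))"
    using 1 by linarith
  then show ?thesis unfolding sb by (simp add: e_def algebra_simps)
qed

text \<open>Complete \<open>sin \<circ> a\<close> and \<open>sin \<circ> b\<close> by heights \<open>p\<close> and \<open>q\<close> to points of the upper unit hemisphere, at spherical
distance \<open>t\<close>. Each coordinate \<open>arcsin\<close> moves at most by \<open>t\<close>, so that \<open>arc_tangent_bound\<close> applies coordinatewise, and
the tangent bounds add up to \<open>(t / sin t) * p * (p * cos t - q)\<close>, which is negative because the height
\<open>q\<close> is at least \<open>p\<close>.\<close>

lemma half_angle_convexity:
  fixes a b :: "'n::finite \<Rightarrow> real"
  assumes a: "\<And>i. 0 \<le> a i" "\<And>i. a i < pi/2" and b: "\<And>i. 0 \<le> b i" "\<And>i. b i < pi/2"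
    and le: "(\<Sum>i\<in>UNIV. (sin (b i))\<^sup>2) \<le> (\<Sum>i\<in>UNIV. (sin (a i))\<^sup>2)"
    and lt1: "(\<Sum>i\<in>UNIV. (sin (a i))\<^sup>2) < 1"
    and ne: "a \<noteq> b"
  shows "(\<Sum>i\<in>UNIV. sin (a i) * cos (a i) * (b i - a i)) < 0"
proof -
  define A where "A = (\<Sum>i\<in>UNIV. (sin (a i))\<^sup>2)"
  define B where "B = (\<Sum>i\<in>UNIV. (sin (b i))\<^sup>2)"
  define p where "p = sqrt (1 - A)"
  define q where "q = sqrt (1 - B)"
  define c where "c = (\<Sum>i\<in>UNIV. sin (a i) * sin (b i)) + p * q"
  have A0: "A \<ge> 0" and B0: "B \<ge> 0" by (auto simp: A_def B_def intro: sum_nonneg)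
  have AB: "B \<le> A" "A < 1" using le lt1 by (auto simp: A_def B_def)
  have p: "0 < p" "p\<^sup>2 = 1 - A" and q: "q\<^sup>2 = 1 - B" and pq: "p \<le> q"
    using AB A0 B0 by (auto simp: p_def q_def)
  have s: "0 \<le> sin (a i)" "0 \<le> sin (b i)" "0 < cos (a i)" "0 < cos (b i)" for i
    using a[of i] b[of i] by (auto intro!: sin_ge_zero cos_gt_zero_pi)
  have cpos: "c > 0" unfolding c_def using p pq s
    by (intro add_nonneg_pos sum_nonneg mult_nonneg_nonneg mult_pos_pos) auto
  have c_le: "c \<le> cos (b j - a j)" for j
  proof -
    have rest: "(\<Sum>i\<in>UNIV-{j}. sin (a i) * sin (b i)) + p * q \<le> cos (a j) * cos (b j)"
    proof -
      \<comment> \<open>Cauchy-Schwarz for all coordinates but \<open>j\<close>; the index \<open>None\<close> stands for the height.\<close>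
      let ?u = "\<lambda>o'. case o' of None \<Rightarrow> p | Some i \<Rightarrow> sin (a i)"
      let ?v = "\<lambda>o'. case o' of None \<Rightarrow> q | Some i \<Rightarrow> sin (b i)"
      let ?S = "insert None (Some ` (UNIV - {j}))"
      have [simp]: "sum h ?S = h None + (\<Sum>i\<in>UNIV-{j}. h (Some i))" for h :: "'n option \<Rightarrow> real"
        by (subst sum.insert) (auto simp: sum.reindex)
      have "(\<Sum>o'\<in>?S. ?u o' * ?v o')\<^sup>2 \<le> (\<Sum>o'\<in>?S. (?u o')\<^sup>2) * (\<Sum>o'\<in>?S. (?v o')\<^sup>2)"
        by (rule Cauchy_Schwarz_ineq_sum)
      also have "(\<Sum>o'\<in>?S. (?u o')\<^sup>2) = (cos (a j))\<^sup>2"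
        using sum.remove[of UNIV j "\<lambda>i. (sin (a i))\<^sup>2"] p
        by (simp add: A_def cos_squared_eq)
      also have "(\<Sum>o'\<in>?S. (?v o')\<^sup>2) = (cos (b j))\<^sup>2"
        using sum.remove[of UNIV j "\<lambda>i. (sin (b i))\<^sup>2"] q
        by (simp add: B_def cos_squared_eq)
      finally have "((\<Sum>i\<in>UNIV-{j}. sin (a i) * sin (b i)) + p * q)\<^sup>2 \<le> (cos (a j) * cos (b j))\<^sup>2"
        by (simp add: power_mult_distrib add.commute)
      then show ?thesis
        by (rule power2_le_imp_le) (use s[of j] in auto)
    qed
    have "c = sin (a j) * sin (b j) + ((\<Sum>i\<in>UNIV-{j}. sin (a i) * sin (b i)) + p * q)"
      unfolding c_def by (subst sum.remove[of UNIV j]) auto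
    then show ?thesis using rest by (simp add: cos_diff algebra_simps)
  qed
  have ex: "\<exists>j. a j \<noteq> b j" using ne by auto
  then obtain j where j: "a j \<noteq> b j" by blast
  have "cos \<bar>b j - a j\<bar> < cos 0"
    using j a[of j] b[of j] by (intro cos_monotone_0_pi) auto
  then have "cos (b j - a j) < 1" by simp
  then have c1: "c < 1" using c_le[of j] by simp
  define t where "t = arccos c"
  have ct: "cos t = c" unfolding t_def using cpos c1 by (intro cos_arccos) auto
  have t: "0 < t" "t < pi/2"
    using arccos_lt_bounded[of c] cpos c1 arccos_less_mono[of c 0] by (auto simp: t_def)
  have dist: "\<bar>b i - a i\<bar> \<le> t" for i
  proof (rule ccontr)
    assume "\<not> ?thesis"
    then have "cos \<bar>b i - a i\<bar> < cos t"
      using t a[of i] b[of i] by (intro cos_monotone_0_pi) auto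
    then show False using c_le[of i] ct by simp
  qed
  have st: "sin t > 0" using t by (intro sin_gt_zero) auto
  have "(\<Sum>i\<in>UNIV. sin (a i) * cos (a i) * (b i - a i)) * sin t
      = (\<Sum>i\<in>UNIV. sin (a i) * (cos (a i) * (b i - a i) * sin t))"
    by (simp add: sum_distrib_right mult.assoc)
  also have "\<dots> \<le> (\<Sum>i\<in>UNIV. sin (a i) * (t * (sin (b i) - sin (a i) * cos t)))"
    using a b t dist s by (intro sum_mono mult_left_mono arc_tangent_bound) auto
  also have "\<dots> = t * ((\<Sum>i\<in>UNIV. sin (a i) * sin (b i)) - A * cos t)"
    unfolding A_def by (simp add: sum_distrib_left sum_distrib_right sum_subtractf algebra_simps power2_eq_square)
  also have "\<dots> = t * (p * (p * c - q))"
  proof -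
    have "A = 1 - p * p" using p(2) by (simp add: power2_eq_square)
    moreover have "(\<Sum>i\<in>UNIV. sin (a i) * sin (b i)) = c - p * q" by (simp add: c_def)
    ultimately show ?thesis unfolding ct by (simp only:) (simp add: algebra_simps)
  qed
  also have "\<dots> < 0"
  proof -
    have "p * c < p" using p c1 by simp
    then have "p * c - q < 0" using pq by linarith
    then show ?thesis using t p by (intro mult_pos_neg)
  qed
  finally show ?thesis using st by (simp add: mult_less_0_iff)
qed

section \<open>The level sets of the symbol\<close>

definition gradphi :: "real ^ 'n \<Rightarrow> real ^ 'n" where
  "gradphi k = (\<chi> i. - 2 * sin (k $ i))"

lemma GDERIV_phi: "GDERIV phi k :> gradphi k"
proof -
  have "(phi has_derivative (\<lambda>h. 2 * (\<Sum>i\<in>UNIV. - sin (k $ i) * (h $ i)))) (at k)"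
    unfolding phi_def
    by (auto intro!: derivative_eq_intros bounded_linear_imp_has_derivative
        bounded_linear_vec_nth simp: algebra_simps)
  then show ?thesis
    by (simp add: gderiv_def gradphi_def inner_vec_def sum_distrib_left mult_ac)
qed

lemma GDERIV_phi_iff: "GDERIV phi k :> g \<longleftrightarrow> g = gradphi k"
proof
  assume "GDERIV phi k :> g"
  then have "(\<lambda>h. h \<bullet> g) = (\<lambda>h. h \<bullet> gradphi k)"
    using GDERIV_phi[of k] unfolding gderiv_def by (rule has_derivative_unique)
  then show "g = gradphi k"
    by (metis inner_commute vector_eq_ldot)
qed (simp add: GDERIV_phi)

lemma continuous_on_phi [continuous_intros]:
  fixes f :: "'a::t2_space \<Rightarrow> real ^ 'n"
  shows "continuous_on S f \<Longrightarrow> continuous_on S (\<lambda>x. phi (f x))"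
  unfolding phi_def by (intro continuous_intros continuous_on_cos continuous_on_component)

lemma continuous_on_gradphi [continuous_intros]:
  fixes f :: "'a::t2_space \<Rightarrow> real ^ 'n"
  shows "continuous_on S f \<Longrightarrow> continuous_on S (\<lambda>x. gradphi (f x))"
  unfolding gradphi_def by (intro continuous_intros continuous_on_sin continuous_on_component)

text \<open>With \<open>p\<^sub>i = sin (k\<^sub>i / 2)\<close> the superlevel sets of \<open>phi\<close> become balls, and levels above \<open>2 d - 4\<close>
correspond to radius below \<open>1\<close>.\<close>

lemma phi_half_angle:
  fixes k :: "real ^ 'n"
  shows "phi k = 2 * real CARD('n) - 4 * (\<Sum>i\<in>UNIV. (sin (\<bar>k $ i\<bar> / 2))\<^sup>2)"
proof -
  have "cos (k $ i) = 1 - 2 * (sin (\<bar>k $ i\<bar> / 2))\<^sup>2" for i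
    using cos_double_sin[of "\<bar>k $ i\<bar> / 2"] by simp
  then show ?thesis
    by (simp add: phi_def sum_subtractf sum_distrib_left)
qed

lemma abs_less_pi_of_phi:
  fixes k :: "real ^ 'n"
  assumes "phi k > 2 * real CARD('n) - 4" "\<bar>k $ i\<bar> \<le> pi"
  shows "\<bar>k $ i\<bar> < pi"
proof (rule ccontr)
  assume "\<not> ?thesis"
  then have "\<bar>k $ i\<bar> = pi" using assms by simp
  then have "(sin (\<bar>k $ i\<bar> / 2))\<^sup>2 = 1" by simp
  moreover have "(sin (\<bar>k $ i\<bar> / 2))\<^sup>2 \<le> (\<Sum>i\<in>UNIV. (sin (\<bar>k $ i\<bar> / 2))\<^sup>2)"
    by (rule member_le_sum) auto
  ultimately show False using assms(1) by (simp add: phi_half_angle)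
qed

text \<open>Strict quasi-concavity of \<open>phi\<close> above the level \<open>2 d - 4\<close>, in first-order form. Passing to absolute
values of the coordinates reduces it to the inequality for half angles.\<close>

lemma gradphi_inner_pos:
  fixes k k' :: "real ^ 'n"
  assumes k: "\<And>i. \<bar>k $ i\<bar> < pi" and k': "\<And>i. \<bar>k' $ i\<bar> < pi"
    and phi: "phi k > 2 * real CARD('n) - 4" "phi k' \<ge> phi k" and ne: "k' \<noteq> k"
  shows "gradphi k \<bullet> (k' - k) > 0"
proof -
  define a where "a i = \<bar>k $ i\<bar> / 2" for i
  define b where "b i = \<bar>k' $ i\<bar> / 2" for i
  have range: "0 \<le> a i" "a i < pi/2" "0 \<le> b i" "b i < pi/2" for i
    using k[of i] k'[of i] by (auto simp: a_def b_def)
  have split: "sin (k $ i) * (k' $ i - k $ i) \<le> 4 * (sin (a i) * cos (a i) * (b i - a i))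
     \<and> (k' $ i = - k $ i \<longrightarrow> k $ i \<noteq> 0 \<longrightarrow> sin (k $ i) * (k' $ i - k $ i) < 0)" for i
  proof -
    have sin_abs: "sin (k $ i) * k $ i = sin \<bar>k $ i\<bar> * \<bar>k $ i\<bar>" by (simp add: abs_if)
    have pos: "0 \<le> sin \<bar>k $ i\<bar>" using k[of i] by (intro sin_ge_zero) auto
    have "\<bar>sin (k $ i)\<bar> = sin \<bar>k $ i\<bar>" using pos by (auto simp: abs_if split: if_splits)
    then have "sin (k $ i) * k' $ i \<le> sin \<bar>k $ i\<bar> * \<bar>k' $ i\<bar>"
      by (metis abs_ge_self abs_mult)
    moreover have "sin \<bar>k $ i\<bar> = 2 * sin (a i) * cos (a i)"
      using sin_double[of "a i"] by (simp add: a_def)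
    moreover have "\<bar>k' $ i\<bar> - \<bar>k $ i\<bar> = 2 * (b i - a i)" by (simp add: a_def b_def)
    moreover have "sin (k $ i) * (k' $ i - k $ i) < 0" if "k' $ i = - k $ i" "k $ i \<noteq> 0"
    proof -
      have "0 < sin \<bar>k $ i\<bar> * \<bar>k $ i\<bar>"
        using that k[of i] by (intro mult_pos_pos sin_gt_zero) auto
      then show ?thesis using that sin_abs by (simp add: algebra_simps)
    qed
    moreover have "sin (k $ i) * (k' $ i - k $ i) = sin (k $ i) * k' $ i - sin \<bar>k $ i\<bar> * \<bar>k $ i\<bar>"
      unfolding sin_abs[symmetric] by (simp add: right_diff_distrib)
    moreover have "sin \<bar>k $ i\<bar> * \<bar>k' $ i\<bar> - sin \<bar>k $ i\<bar> * \<bar>k $ i\<bar> = 4 * (sin (a i) * cos (a i) * (b i - a i))"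
      unfolding right_diff_distrib[symmetric] \<open>sin \<bar>k $ i\<bar> = _\<close> \<open>\<bar>k' $ i\<bar> - \<bar>k $ i\<bar> = _\<close> by simp
    ultimately show ?thesis by linarith
  qed
  have "(\<Sum>i\<in>UNIV. sin (k $ i) * (k' $ i - k $ i)) < 0"
  proof (cases "a = b")
    case False
    have "(\<Sum>i\<in>UNIV. sin (a i) * cos (a i) * (b i - a i)) < 0"
      using range phi False
      by (intro half_angle_convexity) (simp_all add: phi_half_angle a_def[symmetric] b_def[symmetric])
    moreover have "(\<Sum>i\<in>UNIV. sin (k $ i) * (k' $ i - k $ i))
        \<le> (\<Sum>i\<in>UNIV. 4 * (sin (a i) * cos (a i) * (b i - a i)))"
      using split by (intro sum_mono) auto
    ultimately show ?thesis by (simp add: sum_distrib_left[symmetric])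
  next
    case True
    obtain j where j: "k' $ j \<noteq> k $ j" using ne by (auto simp: vec_eq_iff)
    have "\<bar>k' $ i\<bar> = \<bar>k $ i\<bar>" for i using fun_cong[OF True, of i] by (simp add: a_def b_def)
    then have "k' $ j = - k $ j" "k $ j \<noteq> 0" using j by (smt (verit))+
    then have "sin (k $ j) * (k' $ j - k $ j) < 0" using split by blast
    moreover have "(\<Sum>i\<in>UNIV - {j}. sin (k $ i) * (k' $ i - k $ i)) \<le> 0"
      using split True by (intro sum_nonpos) auto
    ultimately show ?thesis by (subst sum.remove[of UNIV j]) auto
  qed
  then show ?thesis
    by (simp add: gradphi_def inner_vec_def sum_distrib_left[symmetric] mult.assoc sum_negf)
qed

text \<open>The closed fundamental cell of the torus; compactness is worth the duplicated boundary points.\<close>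

definition brillouin :: "(real ^ 'n) set" where
  "brillouin = cbox (\<chi> i. - pi) (\<chi> i. pi)"

lemma mem_brillouin: "k \<in> brillouin \<longleftrightarrow> (\<forall>i. \<bar>k $ i\<bar> \<le> pi)"
  by (simp add: brillouin_def mem_box_cart abs_le_iff minus_le_iff conj_commute)

definition unit_normal :: "real ^ 'n \<Rightarrow> real ^ 'n" where
  "unit_normal k = gradphi k /\<^sub>R norm (gradphi k)"

lemma kappa_eq:
  "kappa \<omega> lam = (THE k. k \<in> torus \<and> phi k = lam \<and> unit_normal k = \<omega>)"
  by (simp add: kappa_def Gamma_surface_def GDERIV_phi_iff unit_normal_def)

lemma normal_separates:
  fixes k k' :: "real ^ 'n"
  assumes "k \<in> brillouin" "k' \<in> brillouin" "phi k > 2 * real CARD('n) - 4" "phi k' \<ge> phi k" "k' \<noteq> k"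
  shows "unit_normal k \<bullet> (k' - k) > 0"
proof -
  have "gradphi k \<bullet> (k' - k) > 0"
    using assms abs_less_pi_of_phi[of k] abs_less_pi_of_phi[of k']
    by (intro gradphi_inner_pos) (auto simp: mem_brillouin)
  moreover from this have "gradphi k \<noteq> 0" by auto
  ultimately show ?thesis by (simp add: unit_normal_def)
qed

lemma unit_normal_inj:
  fixes k k' :: "real ^ 'n"
  assumes "k \<in> brillouin" "k' \<in> brillouin" "phi k > 2 * real CARD('n) - 4" "phi k' = phi k"
    and "unit_normal k = unit_normal k'"
  shows "k = k'"
proof (rule ccontr)
  assume "k \<noteq> k'"
  then have "unit_normal k \<bullet> (k' - k) > 0" "unit_normal k \<bullet> (k - k') > 0"
    using normal_separates[of k k'] normal_separates[of k' k] assms by auto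
  then show False by (simp add: inner_diff_right)
qed

lemma gradphi_nonzero:
  fixes k :: "real ^ 'n"
  assumes "k \<in> brillouin" "2 * real CARD('n) - 4 < phi k" "phi k < 2 * real CARD('n)"
  shows "gradphi k \<noteq> 0"
proof
  assume "gradphi k = 0"
  then have s0: "sin (k $ i) = 0" for i
    by (metis gradphi_def mult_eq_0_iff neg_equal_0_iff_equal vec_lambda_beta zero_index zero_neq_numeral)
  have "k $ i = 0" for i
  proof (rule ccontr)
    assume "k $ i \<noteq> 0"
    moreover have "\<bar>k $ i\<bar> < pi"
      using assms abs_less_pi_of_phi[of k i] by (auto simp: mem_brillouin)
    ultimately have "0 < sin \<bar>k $ i\<bar>" by (intro sin_gt_zero) auto
    then show False using s0[of i] by (auto simp: abs_if split: if_splits)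
  qed
  then have "phi k = 2 * real CARD('n)" by (simp add: phi_def)
  then show False using assms by simp
qed

lemma norm_unit_normal: "gradphi k \<noteq> 0 \<Longrightarrow> norm (unit_normal k) = 1"
  by (simp add: unit_normal_def)

text \<open>The point with normal \<open>\<omega>\<close> is the minimiser of \<open>k \<bullet> \<omega>\<close> over the superlevel set. At a minimiser, \<open>\<omega>\<close> makes
no obtuse angle with any direction along which \<open>phi\<close> increases, which forces \<open>\<omega>\<close> to be the normal.\<close>

lemma unit_normal_surj:
  fixes \<omega> :: "real ^ 'n"
  assumes lam: "2 * real CARD('n) - 4 < lam" "lam < 2 * real CARD('n)" and \<omega>: "norm \<omega> = 1"
  obtains k where "k \<in> brillouin" "phi k = lam" "unit_normal k = \<omega>"
proof -
  define K :: "(real ^ 'n) set" where "K = brillouin \<inter> {k. lam \<le> phi k}"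
  have "closed {k :: real ^ 'n. lam \<le> phi k}"
    by (intro closed_Collect_le continuous_intros)
  then have "compact K" unfolding K_def brillouin_def by (intro compact_Int_closed) auto
  moreover have "0 \<in> K" using lam by (simp add: K_def mem_brillouin phi_def)
  ultimately obtain k where k: "k \<in> K" "\<And>k'. k' \<in> K \<Longrightarrow> k \<bullet> \<omega> \<le> k' \<bullet> \<omega>"
    using continuous_attains_inf[of K "\<lambda>k. k \<bullet> \<omega>"] by (force intro: continuous_intros)
  have kb: "k \<in> brillouin" and kl: "lam \<le> phi k" using k by (auto simp: K_def)
  have lt_pi: "\<bar>k $ i\<bar> < pi" for i
    using kb kl lam abs_less_pi_of_phi[of k i] by (auto simp: mem_brillouin)
  \<comment> \<open>Moving from the minimiser in an admissible direction cannot decrease \<open>k \<bullet> \<omega>\<close>.\<close>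
  have feasible: "0 \<le> v \<bullet> \<omega>" if v: "lam < phi k \<or> 0 < gradphi k \<bullet> v" for v
  proof -
    have cont: "((\<lambda>s. k + s *\<^sub>R v) \<longlongrightarrow> k + 0 *\<^sub>R v) (at_right 0)"
      by (intro tendsto_intros)
    have "eventually (\<lambda>s. \<forall>i. \<bar>(k + s *\<^sub>R v) $ i\<bar> < pi) (at_right 0)"
    proof (rule eventually_all_finite)
      fix i
      have "((\<lambda>s. \<bar>(k + s *\<^sub>R v) $ i\<bar>) \<longlongrightarrow> \<bar>(k + 0 *\<^sub>R v) $ i\<bar>) (at_right 0)"
        by (intro tendsto_rabs tendsto_vec_nth cont)
      then show "eventually (\<lambda>s. \<bar>(k + s *\<^sub>R v) $ i\<bar> < pi) (at_right 0)"
        using lt_pi[of i] by (intro order_tendstoD) auto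
    qed
    moreover have "eventually (\<lambda>s. lam \<le> phi (k + s *\<^sub>R v)) (at_right 0)"
    proof (cases "lam < phi k")
      case True
      have "((\<lambda>s. phi (k + s *\<^sub>R v)) \<longlongrightarrow> phi (k + 0 *\<^sub>R v)) (at_right 0)"
        using continuous_on_phi[of UNIV "\<lambda>x. x"] cont
        by (intro isCont_tendsto_compose[of _ phi]) (auto simp: continuous_on_eq_continuous_at)
      then have "eventually (\<lambda>s. lam < phi (k + s *\<^sub>R v)) (at_right 0)"
        using True by (intro order_tendstoD) auto
      then show ?thesis by eventually_elim simp
    next
      case False
      have "((\<lambda>s. phi (k + s *\<^sub>R v)) has_derivative (\<lambda>h. (h *\<^sub>R v) \<bullet> gradphi (k + 0 *\<^sub>R v))) (at 0)"
        by (rule has_derivative_compose[where f = "\<lambda>s. k + s *\<^sub>R v", OF _ GDERIV_phi[unfolded gderiv_def]])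
           (auto intro!: derivative_eq_intros)
      then have "((\<lambda>s. phi (k + s *\<^sub>R v)) has_real_derivative (v \<bullet> gradphi k)) (at 0)"
        by (simp add: has_field_derivative_def mult_commute_abs)
      from DERIV_pos_inc_right[OF this] v False obtain d where d: "0 < d"
        "\<And>h. 0 < h \<Longrightarrow> h < d \<Longrightarrow> phi k < phi (k + h *\<^sub>R v)"
        by (auto simp: inner_commute)
      have "eventually (\<lambda>h. h \<in> {0<..<d}) (at_right (0::real))"
        using d(1) by (rule eventually_at_right_real)
      then show ?thesis by eventually_elim (use d(2) kl in force)
    qed
    moreover have "eventually (\<lambda>s::real. s > 0) (at_right 0)"
      by (simp add: eventually_at_right_less)
    ultimately have "eventually (\<lambda>s. k + s *\<^sub>R v \<in> K \<and> s > 0) (at_right 0)"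
      by eventually_elim (auto simp: K_def mem_brillouin intro: less_imp_le)
    then obtain s where "k + s *\<^sub>R v \<in> K" "s > 0"
      using eventually_happens[of _ "at_right (0::real)"] by auto
    then show ?thesis using k(2)[of "k + s *\<^sub>R v"] by (simp add: inner_add_left zero_le_mult_iff)
  qed
  have "phi k = lam"
  proof (rule ccontr)
    assume "phi k \<noteq> lam"
    then have "0 \<le> (- \<omega>) \<bullet> \<omega>" using kl by (intro feasible) auto
    then show False using \<omega> by (simp add: dot_square_norm)
  qed
  have g0: "gradphi k \<noteq> 0" using \<open>phi k = lam\<close> lam kb by (intro gradphi_nonzero) auto
  define n where "n = unit_normal k"
  have n: "n \<bullet> n = 1" "gradphi k = norm (gradphi k) *\<^sub>R n"
    using norm_unit_normal[OF g0] g0 by (auto simp: n_def dot_square_norm unit_normal_def)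
  have w: "\<omega> \<bullet> \<omega> = 1" using \<omega> by (simp add: dot_square_norm)
  have "n = \<omega>"
  proof (rule ccontr)
    assume "n \<noteq> \<omega>"
    then have "0 < (n - \<omega>) \<bullet> (n - \<omega>)" by simp
    then have lt: "n \<bullet> \<omega> < 1" using n w by (simp add: inner_diff inner_commute)
    have "0 \<le> (n - \<omega>) \<bullet> \<omega>"
    proof (rule feasible, rule disjI2)
      have "gradphi k \<bullet> (n - \<omega>) = norm (gradphi k) * (1 - n \<bullet> \<omega>)"
        by (subst n(2)) (simp add: inner_diff_right n(1) right_diff_distrib)
      then show "0 < gradphi k \<bullet> (n - \<omega>)" using g0 lt by simp
    qed
    then show False using lt w by (simp add: inner_diff_left)
  qed
  then show ?thesis using that kb \<open>phi k = lam\<close> by (simp add: n_def)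
qed

section \<open>Plane waves and the map kappa\<close>

definition wave :: "real ^ 'n \<Rightarrow> int ^ 'n \<Rightarrow> complex" where
  "wave k x = cis (k \<bullet> lattice_point x)"

lemma cis_sum: "cis (sum f A) = (\<Prod>i\<in>A. cis (f i))"
proof (induction A rule: infinite_finite_induct)
  case (insert x F)
  have "cis (f x + sum f F) = cis (f x) * cis (sum f F)" by (rule cis_mult[symmetric])
  with insert show ?case by simp
qed auto

lemma wave_prod: "wave k x = (\<Prod>i\<in>UNIV. cis (k $ i * real_of_int (x $ i)))"
  by (simp add: wave_def inner_vec_def lattice_point_def cis_sum)

lemma lattice_point_diff: "lattice_point (x - y) = lattice_point x - lattice_point y"
  and lattice_point_add: "lattice_point (x + y) = lattice_point x + lattice_point y"
  and lattice_point_minus: "lattice_point (- x) = - lattice_point x"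
  and lattice_point_0 [simp]: "lattice_point 0 = 0"
  by (simp_all add: lattice_point_def vec_eq_iff)

lemma inj_lattice_point: "lattice_point x = lattice_point y \<longleftrightarrow> x = y"
  by (simp add: lattice_point_def vec_eq_iff)

lemma lattice_point_eq_0 [simp]: "lattice_point x = 0 \<longleftrightarrow> x = 0"
  using inj_lattice_point[of x 0] by simp

lemma norm_wave [simp]: "norm (wave k x) = 1"
  by (simp add: wave_def)

lemma wave_nonzero [simp]: "wave k x \<noteq> 0"
  by (simp add: wave_def)

lemma wave_0 [simp]: "wave k 0 = 1"
  by (simp add: wave_def)

lemma wave_add: "wave k (x + y) = wave k x * wave k y"
  by (simp add: wave_def lattice_point_add inner_add_right cis_mult)

lemma wave_minus: "wave k (- x) = cnj (wave k x)"
  by (simp add: wave_def lattice_point_minus cis_cnj)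

lemma wave_mult_cnj: "wave k x * cnj (wave k x) = 1"
  using wave_add[of k x "- x"] by (simp add: wave_minus)

lemma wave_diff: "wave k (x - y) = wave k x * wave k (- y)"
  using wave_add[of k x "- y"] by simp

lemma wave_add_left: "wave (k + l) x = wave k x * wave l x"
  by (simp add: wave_def inner_add_left cis_mult)

text \<open>Plane waves on the lattice only see \<open>k\<close> modulo the period \<open>2 \<pi>\<close> in each coordinate.\<close>

lemma wave_period:
  assumes "\<And>i. \<exists>m::int. k $ i = l $ i + 2 * pi * real_of_int m"
  shows "wave k x = wave l x"
  unfolding wave_prod
proof (rule prod.cong[OF refl])
  fix i
  obtain m :: int where m: "k $ i = l $ i + 2 * pi * real_of_int m" using assms by blast
  have "cis (k $ i * real_of_int (x $ i))
      = cis (l $ i * real_of_int (x $ i)) * cis (2 * pi * real_of_int (m * x $ i))"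
    unfolding m cis_mult by (simp add: algebra_simps)
  also have "cis (2 * pi * real_of_int (m * x $ i)) = 1"
    by (rule cis_multiple_2pi) simp
  finally show "cis (k $ i * real_of_int (x $ i)) = cis (l $ i * real_of_int (x $ i))" by simp
qed

lemma torus_subset_brillouin: "k \<in> torus \<Longrightarrow> k \<in> brillouin"
  unfolding mem_brillouin
proof
  fix i
  assume "k \<in> torus"
  then have "- pi < k $ i" "k $ i \<le> pi" by (auto simp: torus_def)
  then show "\<bar>k $ i\<bar> \<le> pi" by linarith
qed

lemma kappa_upper:
  fixes \<omega> :: "real ^ 'n"
  assumes lam: "2 * real CARD('n) - 4 < lam" "lam < 2 * real CARD('n)" and \<omega>: "norm \<omega> = 1"
  shows "kappa \<omega> lam \<in> brillouin" "phi (kappa \<omega> lam) = lam" "unit_normal (kappa \<omega> lam) = \<omega>"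
    and "kappa \<omega> lam \<in> torus"
proof -
  obtain k :: "real ^ 'n" where k: "k \<in> brillouin" "phi k = lam" "unit_normal k = \<omega>"
    using unit_normal_surj[OF assms] .
  have "k \<in> torus"
    unfolding torus_def
  proof safe
    fix i
    have "\<bar>k $ i\<bar> < pi"
      using k lam abs_less_pi_of_phi[of k i] by (simp add: mem_brillouin)
    then show "- pi < k $ i" "k $ i \<le> pi" by linarith+
  qed
  then have kap: "kappa \<omega> lam = k" unfolding kappa_eq
  proof (intro the_equality conjI k)
    fix l :: "real ^ 'n" assume l: "l \<in> torus \<and> phi l = lam \<and> unit_normal l = \<omega>"
    then have "l \<in> brillouin" by (simp add: torus_subset_brillouin)
    moreover have "2 * real CARD('n) - 4 < phi l" "phi k = phi l" using l k(2) lam by auto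
    moreover have "unit_normal l = unit_normal k" unfolding k(3) using l by (elim conjE)
    ultimately show "l = k" using unit_normal_inj[OF _ k(1)] by blast
  qed
  show "kappa \<omega> lam \<in> brillouin" "phi (kappa \<omega> lam) = lam" "unit_normal (kappa \<omega> lam) = \<omega>"
    "kappa \<omega> lam \<in> torus" unfolding kap by (fact k \<open>k \<in> torus\<close>)+
qed

text \<open>\<open>kappa\<close> inverts the Gauss map, a continuous bijection from the compact level set to the sphere.\<close>

lemma continuous_on_kappa_upper:
  assumes lam: "2 * real CARD('n) - 4 < lam" "lam < 2 * real CARD('n)"
  shows "continuous_on (sphere 0 1) (\<lambda>\<omega> :: real ^ 'n. kappa \<omega> lam)"
proof -
  define G :: "(real ^ 'n) set" where "G = brillouin \<inter> {k. phi k = lam}"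
  have "closed {k :: real ^ 'n. phi k = lam}"
    by (intro closed_Collect_eq continuous_intros)
  then have "compact G" unfolding G_def brillouin_def by (intro compact_Int_closed) auto
  moreover have g0: "gradphi k \<noteq> 0" if "k \<in> G" for k
    using that lam by (intro gradphi_nonzero) (auto simp: G_def)
  then have "continuous_on G unit_normal"
    unfolding unit_normal_def by (intro continuous_intros) auto
  moreover have "kappa (unit_normal k) lam = k" if "k \<in> G" for k
  proof -
    have k: "k \<in> brillouin" "phi k = lam" using that by (auto simp: G_def)
    note upper = kappa_upper[OF lam norm_unit_normal[OF g0[OF that]]]
    show ?thesis
    proof (rule unit_normal_inj[OF upper(1) k(1)])
      show "2 * real CARD('n) - 4 < phi (kappa (unit_normal k) lam)" unfolding upper(2) by (fact lam)
      show "phi k = phi (kappa (unit_normal k) lam)" unfolding upper(2) by (fact k(2))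
    qed (fact upper(3))
  qed
  ultimately have "continuous_on (unit_normal ` G) (\<lambda>\<omega>. kappa \<omega> lam)"
    by (intro continuous_on_inv ballI)
  moreover have "sphere 0 1 \<subseteq> unit_normal ` G"
  proof
    fix \<omega> :: "real ^ 'n" assume "\<omega> \<in> sphere 0 1"
    then have "norm \<omega> = 1" by simp
    note upper = kappa_upper[OF lam this]
    have "kappa \<omega> lam \<in> G" using upper(1,2) by (simp add: G_def)
    with upper(3)[symmetric] show "\<omega> \<in> unit_normal ` G" by (rule image_eqI)
  qed
  ultimately show ?thesis by (rule continuous_on_subset)
qed

lemma kappa_upper_supports:
  fixes \<omega> \<omega>' :: "real ^ 'n"
  assumes lam: "2 * real CARD('n) - 4 < lam" "lam < 2 * real CARD('n)"
    and \<omega>: "norm \<omega> = 1" "norm \<omega>' = 1"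
  shows "0 \<le> (kappa \<omega>' lam - kappa \<omega> lam) \<bullet> \<omega>"
proof (cases "kappa \<omega>' lam = kappa \<omega> lam")
  case False
  note u = kappa_upper[OF lam \<omega>(1)] and u' = kappa_upper[OF lam \<omega>(2)]
  have "0 < unit_normal (kappa \<omega> lam) \<bullet> (kappa \<omega>' lam - kappa \<omega> lam)"
    by (rule normal_separates[OF u(1) u'(1) _ _ False]) (simp_all only: u(2) u'(2) lam order.refl)
  then show ?thesis unfolding u(3) by (simp add: inner_commute)
qed simp

text \<open>Translation by this vector changes the sign of \<open>phi\<close> and so exchanges the two halves of the
spectrum.\<close>

definition half_period :: "real ^ 'n" where "half_period = (\<chi> i. pi)"

text \<open>Since \<open>phi\<close> is odd under translation by half a period and \<open>gradphi\<close> is invariant under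
\<open>k \<mapsto> half_period - k\<close>, this reflection carries the level set of \<open>- lam\<close> to that of \<open>lam\<close> with the same
normals. The result has to be brought back to the cell coordinate by coordinate, which plane waves do
not notice.\<close>

lemma kappa_lower:
  fixes \<omega> :: "real ^ 'n"
  assumes lam: "- 2 * real CARD('n) < lam" "lam < - (2 * real CARD('n) - 4)" and \<omega>: "norm \<omega> = 1"
  shows "kappa \<omega> lam \<in> brillouin" "phi (kappa \<omega> lam) = lam" "unit_normal (kappa \<omega> lam) = \<omega>"
    and "wave (kappa \<omega> lam) x = wave (half_period - kappa \<omega> (- lam)) x"
proof -
  define m :: "real ^ 'n" where "m = kappa \<omega> (- lam)"
  have l: "2 * real CARD('n) - 4 < - lam" "- lam < 2 * real CARD('n)" using lam by linarith+
  have m: "m \<in> brillouin" "phi m = - lam" "unit_normal m = \<omega>" "m \<in> torus"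
    unfolding m_def by (fact kappa_upper[OF l \<omega>])+
  have phi_flip: "phi k = - phi l" and grad_flip: "gradphi k = gradphi l"
    if "\<And>i. k $ i = pi - l $ i \<or> k $ i = - pi - l $ i" for k l :: "real ^ 'n"
  proof -
    have c: "cos (k $ i) = - cos (l $ i)" "sin (k $ i) = sin (l $ i)" for i
      using that[of i] by (auto simp: cos_diff sin_diff)
    show "phi k = - phi l" by (simp add: phi_def c sum_negf)
    show "gradphi k = gradphi l" by (simp add: gradphi_def c)
  qed
  define k :: "real ^ 'n" where "k = (\<chi> i. if m $ i \<ge> 0 then pi - m $ i else - pi - m $ i)"
  have km: "k $ i = pi - m $ i \<or> k $ i = - pi - m $ i" for i by (simp add: k_def)
  have m_lt: "\<bar>m $ i\<bar> < pi" for i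
    using abs_less_pi_of_phi[of m i] m l by (simp add: mem_brillouin)
  have kt: "k \<in> torus"
    unfolding torus_def
  proof safe
    fix i
    show "- pi < k $ i" "k $ i \<le> pi" using m_lt[of i] by (auto simp: k_def abs_if split: if_splits)
  qed
  have k: "phi k = lam" "unit_normal k = \<omega>"
    using phi_flip[OF km] grad_flip[OF km] m by (auto simp: unit_normal_def)
  have kap: "kappa \<omega> lam = k" unfolding kappa_eq
  proof (intro the_equality conjI k kt)
    fix l' :: "real ^ 'n" assume l': "l' \<in> torus \<and> phi l' = lam \<and> unit_normal l' = \<omega>"
    define n :: "real ^ 'n" where "n = (\<chi> i. if l' $ i \<ge> 0 then pi - l' $ i else - pi - l' $ i)"
    have ln: "l' $ i = pi - n $ i \<or> l' $ i = - pi - n $ i" for i by (simp add: n_def)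
    have li: "- pi < l' $ i" "l' $ i \<le> pi" for i using l' by (auto simp: torus_def)
    have "\<bar>n $ i\<bar> \<le> pi" for i using li[of i] by (simp add: n_def abs_if)
    then have "n \<in> brillouin" by (simp add: mem_brillouin)
    have "phi n = phi m"
      using phi_flip[OF ln] l' unfolding m(2) by linarith
    have "unit_normal n = unit_normal l'"
      unfolding unit_normal_def grad_flip[OF ln] ..
    moreover have "unit_normal l' = \<omega>" using l' by (elim conjE)
    ultimately have "unit_normal m = unit_normal n" by (simp only: m(3))
    have "2 * real CARD('n) - 4 < phi m" unfolding m(2) by (fact l(1))
    then have "m = n"
      using unit_normal_inj[OF m(1) \<open>n \<in> brillouin\<close>] \<open>phi n = phi m\<close> \<open>unit_normal m = unit_normal n\<close> by blast
    have "l' $ i = k $ i" for i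
      using li[of i] unfolding k_def \<open>m = n\<close> by (simp add: n_def)
    then show "l' = k" by (simp add: vec_eq_iff)
  qed
  show "wave (kappa \<omega> lam) x = wave (half_period - kappa \<omega> (- lam)) x"
  proof (rule wave_period)
    fix i
    show "\<exists>j::int. kappa \<omega> lam $ i = (half_period - kappa \<omega> (- lam)) $ i + 2 * pi * real_of_int j"
    proof (cases "m $ i \<ge> 0")
      case True
      then show ?thesis unfolding kap m_def[symmetric]
        by (intro exI[of _ 0]) (simp add: k_def half_period_def)
    next
      case False
      then show ?thesis unfolding kap m_def[symmetric]
        by (intro exI[of _ "-1"]) (simp add: k_def half_period_def)
    qed
  qed
  show "kappa \<omega> lam \<in> brillouin" "phi (kappa \<omega> lam) = lam" "unit_normal (kappa \<omega> lam) = \<omega>"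
    unfolding kap by (fact torus_subset_brillouin[OF kt] k)+
qed

text \<open>For negative \<open>lam\<close> the representative of \<open>kappa\<close> in the torus may jump as \<open>\<omega>\<close> varies; \<open>K\<close> is a continuous
lift, equal to \<open>kappa\<close> modulo periods. The sign \<open>\<sigma>\<close> tells whether \<open>K \<omega> \<bullet> \<omega>\<close> is a minimum or a maximum of
\<open>k \<bullet> \<omega>\<close> over the level set.\<close>

lemma kappa_properties:
  assumes lam: "lam \<in> Lambda CARD('n)"
  obtains K :: "real ^ 'n \<Rightarrow> real ^ 'n" and \<sigma> :: real where
    "continuous_on (sphere 0 1) K" "\<bar>\<sigma>\<bar> = 1"
    "\<And>\<omega> \<omega>'. norm \<omega> = 1 \<Longrightarrow> norm \<omega>' = 1 \<Longrightarrow> 0 \<le> \<sigma> * ((K \<omega>' - K \<omega>) \<bullet> \<omega>)"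
    "\<And>\<omega> x. norm \<omega> = 1 \<Longrightarrow> wave (kappa \<omega> lam) x = wave (K \<omega>) x"
    "\<And>\<omega> :: real ^ 'n. norm \<omega> = 1 \<Longrightarrow> kappa \<omega> lam \<in> brillouin"
    "\<And>\<omega> :: real ^ 'n. norm \<omega> = 1 \<Longrightarrow> phi (kappa \<omega> lam) = lam"
    "\<And>\<omega> :: real ^ 'n. norm \<omega> = 1 \<Longrightarrow> unit_normal (kappa \<omega> lam) = \<omega>"
proof (cases "2 * real CARD('n) - 4 < lam")
  case True
  then have l: "2 * real CARD('n) - 4 < lam" "lam < 2 * real CARD('n)"
    using lam by (simp_all add: Lambda_def abs_less_iff)
  show ?thesis
  proof (rule that[of "\<lambda>\<omega>. kappa \<omega> lam" 1])
    show "0 \<le> 1 * ((kappa \<omega>' lam - kappa \<omega> lam) \<bullet> \<omega>)"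
      if "norm \<omega> = 1" "norm \<omega>' = 1" for \<omega> \<omega>' :: "real ^ 'n"
      using kappa_upper_supports[OF l that] by simp
    show "kappa \<omega> lam \<in> brillouin" "phi (kappa \<omega> lam) = lam" "unit_normal (kappa \<omega> lam) = \<omega>"
      if "norm \<omega> = 1" for \<omega> :: "real ^ 'n"
      by (fact kappa_upper[OF l that])+
  qed (simp_all add: continuous_on_kappa_upper[OF l])
next
  case False
  then have l: "- 2 * real CARD('n) < lam" "lam < - (2 * real CARD('n) - 4)"
    using lam by (simp_all add: Lambda_def abs_if split: if_splits)
  then have l': "2 * real CARD('n) - 4 < - lam" "- lam < 2 * real CARD('n)" by auto
  show ?thesis
  proof (rule that[of "\<lambda>\<omega>. half_period - kappa \<omega> (- lam)" "- 1"])
    show "continuous_on (sphere 0 1) (\<lambda>\<omega> :: real ^ 'n. half_period - kappa \<omega> (- lam))"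
      by (intro continuous_intros continuous_on_kappa_upper l')
    show "0 \<le> - 1 * ((half_period - kappa \<omega>' (- lam) - (half_period - kappa \<omega> (- lam))) \<bullet> \<omega>)"
      if "norm \<omega> = 1" "norm \<omega>' = 1" for \<omega> \<omega>' :: "real ^ 'n"
      using kappa_upper_supports[OF l' that] by (simp add: inner_diff_left)
    show "kappa \<omega> lam \<in> brillouin" "phi (kappa \<omega> lam) = lam" "unit_normal (kappa \<omega> lam) = \<omega>"
      "wave (kappa \<omega> lam) x = wave (half_period - kappa \<omega> (- lam)) x"
      if "norm \<omega> = 1" for \<omega> :: "real ^ 'n" and x
      by (fact kappa_lower[OF l that])+
  qed simp
qed

section \<open>Flux through large balls\<close>

abbreviation lattice_norm :: "int ^ 'n \<Rightarrow> real" where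
  "lattice_norm x \<equiv> norm (lattice_point x)"

definition steps :: "(int ^ 'n) set" where
  "steps = {s. lattice_norm s = 1}"

lemma lattice_ball_bounds:
  fixes R :: real
  assumes "0 \<le> R"
  shows finite_lattice_ball: "finite {x :: int ^ 'n. lattice_norm x \<le> R}" (is "finite ?B")
    and card_lattice_ball: "real (card {x :: int ^ 'n. lattice_norm x \<le> R}) \<le> (2 * R + 1) ^ CARD('n)"
proof -
  let ?m = "\<lfloor>R\<rfloor>"
  let ?P = "PiE (UNIV :: 'n set) (\<lambda>_. {- ?m .. ?m})"
  have inj: "inj_on (\<lambda>(x :: int ^ 'n) i. x $ i) ?B"
    by (auto simp: inj_on_def vec_eq_iff fun_eq_iff)
  have sub: "(\<lambda>(x :: int ^ 'n) i. x $ i) ` ?B \<subseteq> ?P"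
  proof safe
    fix x :: "int ^ 'n" and i :: 'n
    assume "lattice_norm x \<le> R"
    then have "\<bar>lattice_point x $ i\<bar> \<le> R"
      using component_le_norm_cart[of "lattice_point x" i] by linarith
    then have "real_of_int \<bar>x $ i\<bar> \<le> R" by (simp add: lattice_point_def)
    then have "\<bar>x $ i\<bar> \<le> ?m" by (simp add: le_floor_iff)
    then show "x $ i \<in> {- ?m .. ?m}" by (simp add: abs_le_iff)
  qed auto
  have fin: "finite ?P" by (intro finite_PiE) auto
  show "finite ?B" by (rule inj_on_finite[OF inj sub fin])
  have "card ?B \<le> card ?P" by (rule card_inj_on_le[OF inj sub fin])
  also have "card ?P = nat (2 * ?m + 1) ^ CARD('n)"
    by (simp add: card_PiE)
  finally have "real (card ?B) \<le> real (nat (2 * ?m + 1)) ^ CARD('n)"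
    by (metis of_nat_le_iff of_nat_power)
  also have "\<dots> \<le> (2 * R + 1) ^ CARD('n)"
    using assms by (intro power_mono) (auto simp: le_floor_iff)
  finally show "real (card ?B) \<le> (2 * R + 1) ^ CARD('n)" .
qed

lemma finite_steps [simp]: "finite (steps :: (int ^ 'n) set)"
  by (rule finite_subset[OF _ finite_lattice_ball[of 1]]) (auto simp: steps_def)

lemma uminus_steps: "uminus ` steps = (steps :: (int ^ 'n) set)"
proof -
  have "- s \<in> steps \<longleftrightarrow> s \<in> steps" for s :: "int ^ 'n"
    by (simp add: steps_def lattice_point_minus)
  then show ?thesis by (auto intro: image_eqI[of _ _ "- x" for x])
qed

lemma sum_steps_uminus: "(\<Sum>s\<in>steps. h (- s)) = (\<Sum>s\<in>(steps :: (int ^ 'n) set). h s)"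
  using sum.reindex[of uminus "steps :: (int ^ 'n) set" h] by (simp add: uminus_steps)

lemma discrete_laplacian_steps: "discrete_laplacian u x = (\<Sum>s\<in>steps. u (x + s))"
proof -
  have "{y. norm (lattice_point y - lattice_point x) = 1} = (+) x ` steps"
  proof (intro set_eqI iffI)
    fix y assume "y \<in> {y. norm (lattice_point y - lattice_point x) = 1}"
    then show "y \<in> (+) x ` steps"
      by (intro image_eqI[of _ _ "y - x"]) (auto simp: steps_def lattice_point_diff)
  qed (auto simp: steps_def lattice_point_add)
  then show ?thesis by (simp add: discrete_laplacian_def sum.reindex)
qed

lemma sum_shift:
  fixes h :: "int ^ 'n \<Rightarrow> 'b :: comm_monoid_add"
  assumes "finite A" "\<And>x. h x \<noteq> 0 \<Longrightarrow> x \<in> A" "\<And>x. h (x + s) \<noteq> 0 \<Longrightarrow> x \<in> A"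
  shows "(\<Sum>x\<in>A. h (x + s)) = (\<Sum>x\<in>A. h x)"
proof -
  have "(\<Sum>x\<in>A. h (x + s)) = (\<Sum>x | h (x + s) \<noteq> 0. h (x + s))"
    using assms by (intro sum.mono_neutral_right) auto
  also have "\<dots> = (\<Sum>x | h x \<noteq> 0. h x)"
    by (rule sum.reindex_bij_witness[of _ "\<lambda>x. x - s" "\<lambda>x. x + s"]) auto
  also have "\<dots> = (\<Sum>x\<in>A. h x)"
    using assms by (intro sum.mono_neutral_left) auto
  finally show ?thesis .
qed

text \<open>Green's identity: the Laplacian is symmetric, so a weight \<open>\<eta>\<close> contributes only through its increments.\<close>

lemma flux_identity:
  fixes u :: "int ^ 'n \<Rightarrow> complex" and \<eta> :: "int ^ 'n \<Rightarrow> real"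
  assumes A: "finite A" "\<And>x. \<eta> x \<noteq> 0 \<Longrightarrow> x \<in> A" "\<And>x s. s \<in> steps \<Longrightarrow> \<eta> (x + s) \<noteq> 0 \<Longrightarrow> x \<in> A"
  shows "2 * Im (\<Sum>x\<in>A. of_real (\<eta> x) * cnj (u x) * discrete_laplacian u x)
       = Im (\<Sum>x\<in>A. \<Sum>s\<in>steps. of_real (\<eta> x - \<eta> (x + s)) * cnj (u x) * u (x + s))"
proof -
  define S where "S = (\<Sum>s\<in>steps. \<Sum>x\<in>A. of_real (\<eta> x) * cnj (u x) * u (x + s))"
  define T where "T = (\<Sum>s\<in>steps. \<Sum>x\<in>A. of_real (\<eta> (x + s)) * cnj (u x) * u (x + s))"
  have "T = (\<Sum>s\<in>steps. \<Sum>x\<in>A. of_real (\<eta> x) * cnj (u (x - s)) * u x)"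
    unfolding T_def
  proof (rule sum.cong[OF refl])
    fix s :: "int ^ 'n" assume "s \<in> steps"
    then show "(\<Sum>x\<in>A. of_real (\<eta> (x + s)) * cnj (u x) * u (x + s))
        = (\<Sum>x\<in>A. of_real (\<eta> x) * cnj (u (x - s)) * u x)"
      using sum_shift[of A "\<lambda>x. of_real (\<eta> x) * cnj (u (x - s)) * u x" s] A by auto
  qed
  also have "\<dots> = (\<Sum>s\<in>steps. \<Sum>x\<in>A. of_real (\<eta> x) * cnj (u (x + s)) * u x)"
    using sum_steps_uminus[of "\<lambda>s. \<Sum>x\<in>A. of_real (\<eta> x) * cnj (u (x + s)) * u x"] by simp
  also have "\<dots> = cnj S" by (simp add: S_def mult_ac)
  finally have flip: "2 * Im S = Im (S - T)" by simp
  have S: "S = (\<Sum>x\<in>A. of_real (\<eta> x) * cnj (u x) * discrete_laplacian u x)"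
    unfolding S_def discrete_laplacian_steps sum_distrib_left by (rule sum.swap)
  have ST: "S - T = (\<Sum>x\<in>A. \<Sum>s\<in>steps. of_real (\<eta> x - \<eta> (x + s)) * cnj (u x) * u (x + s))"
    unfolding S_def T_def
    by (subst (3) sum.swap) (simp add: sum_subtractf[symmetric] left_diff_distrib)
  show ?thesis using flip unfolding ST unfolding S .
qed

text \<open>Equal to \<open>1\<close> on the ball of radius \<open>R\<close>, \<open>0\<close> outside the ball of radius \<open>2 R\<close>, with slope \<open>1 / R\<close> between.
Averaging the flux over the shell avoids spheres, which have no natural discrete counterpart.\<close>

definition cutoff :: "real \<Rightarrow> int ^ 'n \<Rightarrow> real" where
  "cutoff R x = max 0 (min 1 (2 - lattice_norm x / R))"

lemma cutoff_flux:
  fixes u :: "int ^ 'n \<Rightarrow> complex"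
  assumes R: "R \<ge> 1"
  shows "2 * R * \<bar>Im (\<Sum>x | lattice_norm x \<le> 2 * R + 1. of_real (cutoff R x) * cnj (u x) * discrete_laplacian u x)\<bar>
    \<le> (\<Sum>x | R - 1 \<le> lattice_norm x \<and> lattice_norm x \<le> 2 * R + 1. \<Sum>s\<in>steps. norm (u x) * norm (u (x + s)))"
proof -
  let ?A = "{x :: int ^ 'n. lattice_norm x \<le> 2 * R + 1}"
  let ?S = "{x :: int ^ 'n. R - 1 \<le> lattice_norm x \<and> lattice_norm x \<le> 2 * R + 1}"
  have fin: "finite ?A" using R by (intro finite_lattice_ball) auto
  have step: "\<bar>lattice_norm (x + s) - lattice_norm x\<bar> \<le> 1" if "s \<in> steps" for x s :: "int ^ 'n"
    using that norm_triangle_ineq3[of "lattice_point (x + s)" "lattice_point x"]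
    by (simp add: steps_def lattice_point_add)
  have lip: "\<bar>cutoff R x - cutoff R (x + s)\<bar> \<le> 1 / R" if "s \<in> steps" for x s :: "int ^ 'n"
  proof -
    have "\<bar>cutoff R x - cutoff R (x + s)\<bar> \<le> \<bar>lattice_norm (x + s) / R - lattice_norm x / R\<bar>"
      unfolding cutoff_def by (auto simp: max_def min_def)
    also have "\<dots> \<le> 1 / R"
      using step[OF that, of x] R by (simp add: diff_divide_distrib[symmetric] abs_divide divide_right_mono)
    finally show ?thesis .
  qed
  have flat: "cutoff R x = cutoff R (x + s)" if "s \<in> steps" "x \<notin> ?S" for x s :: "int ^ 'n"
  proof (cases "lattice_norm x < R - 1")
    case True
    then have "lattice_norm x / R \<le> 1" "lattice_norm (x + s) / R \<le> 1"
      using step[OF that(1), of x] R by (auto simp: divide_le_eq)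
    then show ?thesis by (simp add: cutoff_def)
  next
    case False
    then have "lattice_norm x > 2 * R + 1" using that(2) by auto
    then have "lattice_norm x / R \<ge> 2" "lattice_norm (x + s) / R \<ge> 2"
      using step[OF that(1), of x] R by (auto simp: le_divide_eq)
    then show ?thesis by (simp add: cutoff_def)
  qed
  have supp: "lattice_norm x < 2 * R" if "cutoff R x \<noteq> 0" for x :: "int ^ 'n"
  proof (rule ccontr)
    assume "\<not> ?thesis"
    then have "lattice_norm x / R \<ge> 2" using R by (simp add: le_divide_eq)
    then show False using that by (simp add: cutoff_def)
  qed
  let ?J = "Im (\<Sum>x\<in>?A. of_real (cutoff R x) * cnj (u x) * discrete_laplacian u x)"
  let ?c = "\<lambda>x s. of_real (cutoff R x - cutoff R (x + s)) * cnj (u x) * u (x + s)"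
  have "2 * ?J
      = Im (\<Sum>x\<in>?A. \<Sum>s\<in>steps. ?c x s)"
  proof (rule flux_identity[OF fin])
    fix x s :: "int ^ 'n"
    show "x \<in> ?A" if "cutoff R x \<noteq> 0" using supp[OF that] by simp
    show "x \<in> ?A" if "s \<in> steps" "cutoff R (x + s) \<noteq> 0" using supp[OF that(2)] step[OF that(1), of x] by simp
  qed
  also have "(\<Sum>x\<in>?A. \<Sum>s\<in>steps. ?c x s)
      = (\<Sum>x\<in>?S. \<Sum>s\<in>steps. ?c x s)"
  proof (intro sum.mono_neutral_right fin ballI sum.neutral)
    fix x s :: "int ^ 'n" assume "x \<in> ?A - ?S" and s: "s \<in> steps"
    then have "x \<notin> ?S" by blast
    from flat[OF s this] show "?c x s = 0" by simp
  qed auto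
  finally have "2 * \<bar>?J\<bar>
     \<le> norm (\<Sum>x\<in>?S. \<Sum>s\<in>steps. ?c x s)"
    using abs_Im_le_cmod[of "\<Sum>x\<in>?S. \<Sum>s\<in>steps. ?c x s"]
    by linarith
  also have "\<dots> \<le> (\<Sum>x\<in>?S. \<Sum>s\<in>steps. (1 / R) * (norm (u x) * norm (u (x + s))))"
  proof (intro sum_norm_le)
    fix x s :: "int ^ 'n" assume "s \<in> steps"
    then show "norm (?c x s) \<le> (1 / R) * (norm (u x) * norm (u (x + s)))"
      unfolding norm_mult norm_of_real complex_mod_cnj mult.assoc by (intro mult_right_mono lip) auto
  qed
  also have "\<dots> = (1 / R) * (\<Sum>x\<in>?S. \<Sum>s\<in>steps. norm (u x) * norm (u (x + s)))"
    by (simp only: sum_distrib_left)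
  finally show ?thesis using R by (simp add: field_simps)
qed

text \<open>The flux of a square-summable function through the shell is at most \<open>O(1 / R)\<close>, while for an
eigenfunction it bounds \<open>|Im \<nu>|\<close> times the mass in the ball of radius \<open>R\<close>.\<close>

lemma ell2_eigenvalue_zero:
  fixes u :: "int ^ 'n \<Rightarrow> complex"
  assumes u: "u \<in> ell2" and eq: "\<And>x. discrete_laplacian u x = \<nu> * u x" and \<nu>: "Im \<nu> \<noteq> 0"
  shows "u x0 = 0"
proof -
  define M where "M = (\<Sum>\<^sub>\<infinity>x. (cmod (u x))\<^sup>2)"
  have summ: "(\<lambda>x. (cmod (u x))\<^sup>2) summable_on UNIV" using u by (simp add: ell2_def)
  have M: "(\<Sum>x\<in>A. (cmod (u x))\<^sup>2) \<le> M" if "finite A" for A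
    unfolding M_def using that by (intro finite_sum_le_infsum summ) auto
  have key: "\<bar>Im \<nu>\<bar> * (cmod (u x0))\<^sup>2 \<le> real (card (steps :: (int ^ 'n) set)) * M / (2 * R)"
    if R: "R \<ge> 1" "R \<ge> lattice_norm x0" for R
  proof -
    let ?A = "{x :: int ^ 'n. lattice_norm x \<le> 2 * R + 1}"
    let ?S = "{x :: int ^ 'n. R - 1 \<le> lattice_norm x \<and> lattice_norm x \<le> 2 * R + 1}"
    have fin: "finite ?A" using R by (intro finite_lattice_ball) auto
    have finS: "finite ?S" by (rule finite_subset[OF _ fin]) auto
    have "(\<Sum>x\<in>?A. of_real (cutoff R x) * cnj (u x) * discrete_laplacian u x)
       = \<nu> * of_real (\<Sum>x\<in>?A. cutoff R x * (cmod (u x))\<^sup>2)"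
      unfolding eq of_real_sum sum_distrib_left
      by (intro sum.cong refl) (simp only: of_real_mult complex_norm_square mult_ac)
    then have Im: "Im (\<Sum>x\<in>?A. of_real (cutoff R x) * cnj (u x) * discrete_laplacian u x)
       = Im \<nu> * (\<Sum>x\<in>?A. cutoff R x * (cmod (u x))\<^sup>2)" by simp
    have "(cmod (u x0))\<^sup>2 = cutoff R x0 * (cmod (u x0))\<^sup>2"
      using R by (auto simp: cutoff_def min_def max_def divide_le_eq)
    also have "\<dots> \<le> (\<Sum>x\<in>?A. cutoff R x * (cmod (u x))\<^sup>2)"
      using fin R by (intro member_le_sum) (auto simp: cutoff_def)
    finally have "\<bar>Im \<nu>\<bar> * (cmod (u x0))\<^sup>2 \<le> \<bar>Im \<nu>\<bar> * (\<Sum>x\<in>?A. cutoff R x * (cmod (u x))\<^sup>2)"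
      by (intro mult_left_mono) auto
    also have "\<dots> = \<bar>Im (\<Sum>x\<in>?A. of_real (cutoff R x) * cnj (u x) * discrete_laplacian u x)\<bar>"
      unfolding Im abs_mult by (auto intro!: sum_nonneg abs_of_nonneg[symmetric] simp: cutoff_def)
    finally have "2 * R * (\<bar>Im \<nu>\<bar> * (cmod (u x0))\<^sup>2)
      \<le> 2 * R * \<bar>Im (\<Sum>x\<in>?A. of_real (cutoff R x) * cnj (u x) * discrete_laplacian u x)\<bar>"
      using R by (intro mult_left_mono) auto
    also have "\<dots> \<le> (\<Sum>x\<in>?S. \<Sum>s\<in>steps. norm (u x) * norm (u (x + s)))"
      by (rule cutoff_flux[OF R(1)])
    also have "\<dots> \<le> (\<Sum>x\<in>?S. \<Sum>s\<in>steps. ((norm (u x))\<^sup>2 + (norm (u (x + s)))\<^sup>2) / 2)"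
    proof (intro sum_mono)
      fix x s :: "int ^ 'n"
      show "norm (u x) * norm (u (x + s)) \<le> ((norm (u x))\<^sup>2 + (norm (u (x + s)))\<^sup>2) / 2"
        using sum_squares_bound[of "norm (u x)" "norm (u (x + s))"] by simp
    qed
    also have "\<dots> = (\<Sum>s\<in>steps. ((\<Sum>x\<in>?S. (norm (u x))\<^sup>2) + (\<Sum>x\<in>?S. (norm (u (x + s)))\<^sup>2)) / 2)"
      by (subst sum.swap) (simp add: sum.distrib sum_divide_distrib[symmetric])
    also have "\<dots> \<le> (\<Sum>s\<in>(steps :: (int ^ 'n) set). M)"
    proof (rule sum_mono)
      fix s :: "int ^ 'n"
      have "(\<Sum>x\<in>?S. (norm (u (x + s)))\<^sup>2) = (\<Sum>x\<in>(\<lambda>x. x + s) ` ?S. (norm (u x))\<^sup>2)"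
        by (subst sum.reindex) (auto simp: inj_on_def)
      also have "\<dots> \<le> M" using finS by (intro M) auto
      finally show "((\<Sum>x\<in>?S. (norm (u x))\<^sup>2) + (\<Sum>x\<in>?S. (norm (u (x + s)))\<^sup>2)) / 2 \<le> M"
        using M[OF finS] by simp
    qed
    finally show ?thesis using R by (simp add: field_simps)
  qed
  have "\<bar>Im \<nu>\<bar> * (cmod (u x0))\<^sup>2 \<le> 0"
  proof (rule tendsto_lowerbound)
    show "((\<lambda>R. real (card (steps :: (int ^ 'n) set)) * M / (2 * R)) \<longlongrightarrow> 0) at_top"
      by (intro tendsto_divide_0[OF tendsto_const] filterlim_at_top_imp_at_infinity
          filterlim_tendsto_pos_mult_at_top[OF tendsto_const] filterlim_ident) auto
    show "eventually (\<lambda>R. \<bar>Im \<nu>\<bar> * (cmod (u x0))\<^sup>2 \<le> real (card (steps :: (int ^ 'n) set)) * M / (2 * R)) at_top"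
      using eventually_ge_at_top[of 1] eventually_ge_at_top[of "lattice_norm x0"]
      by eventually_elim (rule key)
  qed simp
  then have "\<bar>Im \<nu>\<bar> * (cmod (u x0))\<^sup>2 = 0"
    by (intro antisym mult_nonneg_nonneg) auto
  then show ?thesis using \<nu> by simp
qed

text \<open>Each shell of radius \<open>R \<ge> 4\<close> has at most \<open>(7 R)^d\<close> points; the remaining \<open>2^d\<close> comes from evaluating the
decay of the solution at \<open>R / 2\<close>.\<close>

abbreviation flux_constant :: "'n::finite itself \<Rightarrow> real" where
  "flux_constant _ \<equiv> real (card (steps :: (int ^ 'n) set)) * 14 ^ CARD('n)"

text \<open>The shell contains \<open>O(R^d)\<close> points, the increments of the cutoff are \<open>O(1 / R)\<close>, and products of two
values of \<open>\<psi>\<close> are at most \<open>b\<^sup>2 / R^(d-1)\<close> up to a constant: the powers of \<open>R\<close> cancel.\<close>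

lemma flux_upper_bound:
  fixes \<psi> F :: "int ^ 'n \<Rightarrow> complex" and lam b R0 :: real
  assumes F: "finite {x. F x \<noteq> 0}" and eq: "\<And>x. discrete_laplacian \<psi> x - of_real lam * \<psi> x = F x"
    and b: "\<And>x. R0 \<le> lattice_norm x \<Longrightarrow> cmod (\<psi> x) * lattice_norm x powr ((real CARD('n) - 1) / 2) \<le> b"
  shows "\<bar>Im (\<Sum>x | F x \<noteq> 0. cnj (\<psi> x) * F x)\<bar> \<le> flux_constant TYPE('n) * b\<^sup>2"
proof -
  define X where "X = {4, R0 + 2} \<union> (\<lambda>x. lattice_norm x) ` {x. F x \<noteq> 0}"
  define R where "R = Max X"
  have "finite X" using F by (simp add: X_def)
  have R: "R \<ge> 4" "R \<ge> R0 + 2" "\<And>x. F x \<noteq> 0 \<Longrightarrow> lattice_norm x \<le> R"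
    unfolding R_def by (intro Max_ge \<open>finite X\<close>; simp add: X_def)+
  let ?d = "(real CARD('n) - 1) / 2"
  let ?A = "{x :: int ^ 'n. lattice_norm x \<le> 2 * R + 1}"
  let ?S = "{x :: int ^ 'n. R - 1 \<le> lattice_norm x \<and> lattice_norm x \<le> 2 * R + 1}"
  have fin: "finite ?A" using R by (intro finite_lattice_ball) auto
  have finS: "finite ?S" by (rule finite_subset[OF _ fin]) auto
  have cut1: "cutoff R x = 1" if "F x \<noteq> 0" for x
    using R(1) R(3)[OF that] by (auto simp: cutoff_def min_def max_def divide_le_eq)
  have "(\<Sum>x | F x \<noteq> 0. cnj (\<psi> x) * F x) = (\<Sum>x | F x \<noteq> 0. of_real (cutoff R x) * cnj (\<psi> x) * F x)"
    using cut1 by (intro sum.cong) auto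
  also have "\<dots> = (\<Sum>x\<in>?A. of_real (cutoff R x) * cnj (\<psi> x) * F x)"
  proof (intro sum.mono_neutral_left fin)
    show "{x. F x \<noteq> 0} \<subseteq> ?A"
    proof safe
      fix x assume "F x \<noteq> 0"
      from R(3)[OF this] R(1) show "lattice_norm x \<le> 2 * R + 1" by linarith
    qed
  qed auto
  also have "\<dots> = (\<Sum>x\<in>?A. of_real (cutoff R x) * cnj (\<psi> x) * discrete_laplacian \<psi> x)
     - of_real (\<Sum>x\<in>?A. cutoff R x * lam * (cmod (\<psi> x))\<^sup>2)"
    unfolding of_real_sum sum_subtractf[symmetric] eq[symmetric]
    by (intro sum.cong refl) (simp only: of_real_mult complex_norm_square right_diff_distrib mult_ac)
  finally have "Im (\<Sum>x | F x \<noteq> 0. cnj (\<psi> x) * F x)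
      = Im (\<Sum>x\<in>?A. of_real (cutoff R x) * cnj (\<psi> x) * discrete_laplacian \<psi> x)" by simp
  then have "2 * R * \<bar>Im (\<Sum>x | F x \<noteq> 0. cnj (\<psi> x) * F x)\<bar>
      \<le> (\<Sum>x\<in>?S. \<Sum>s\<in>steps. norm (\<psi> x) * norm (\<psi> (x + s)))"
    using cutoff_flux[of R \<psi>] R by simp
  also have "\<dots> \<le> (\<Sum>x\<in>?S. \<Sum>s\<in>(steps :: (int ^ 'n) set). (b / (R/2) powr ?d)\<^sup>2)"
  proof (intro sum_mono)
    have small: "norm (\<psi> x) \<le> b / (R/2) powr ?d" if "R - 2 \<le> lattice_norm x" for x
    proof -
      have "cmod (\<psi> x) * (R/2) powr ?d \<le> cmod (\<psi> x) * lattice_norm x powr ?d"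
        using that R(1) by (intro mult_left_mono powr_mono2) auto
      also have "\<dots> \<le> b" using that R by (intro b) auto
      finally show ?thesis using R(1) by (simp add: pos_le_divide_eq)
    qed
    fix x s :: "int ^ 'n" assume "x \<in> ?S" "s \<in> steps"
    moreover have "lattice_norm x \<le> lattice_norm (x + s) + lattice_norm s"
      using norm_triangle_ineq4[of "lattice_point (x + s)" "lattice_point s"] by (simp add: lattice_point_add)
    ultimately show "norm (\<psi> x) * norm (\<psi> (x + s)) \<le> (b / (R/2) powr ?d)\<^sup>2"
      unfolding power2_eq_square by (intro mult_mono small order_trans[OF norm_ge_zero small[of x]]) (auto simp: steps_def)
  qed
  also have "\<dots> = real (card ?S) * (real (card (steps :: (int ^ 'n) set)) * (b / (R/2) powr ?d)\<^sup>2)"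
    by simp
  also have "\<dots> \<le> (7 * R) ^ CARD('n) * (real (card (steps :: (int ^ 'n) set)) * (b / (R/2) powr ?d)\<^sup>2)"
  proof (intro mult_right_mono)
    have "real (card ?S) \<le> real (card ?A)" using fin by (intro of_nat_mono card_mono) auto
    also have "\<dots> \<le> (2 * (2 * R + 1) + 1) ^ CARD('n)" using R by (intro card_lattice_ball) auto
    also have "\<dots> \<le> (7 * R) ^ CARD('n)" using R by (intro power_mono) auto
    finally show "real (card ?S) \<le> (7 * R) ^ CARD('n)" .
  qed auto
  also have "(b / (R/2) powr ?d)\<^sup>2 = b\<^sup>2 * (R/2) / (R/2) ^ CARD('n)"
  proof -
    have "((R/2) powr ?d)\<^sup>2 = (R/2) powr (real CARD('n) - 1)"
      using R(1) by (simp add: power2_eq_square powr_add[symmetric])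
    also have "\<dots> = (R/2) ^ CARD('n) / (R/2)"
      using R(1) by (simp add: powr_diff powr_realpow)
    finally show ?thesis unfolding power_divide[of b] by (simp only: divide_divide_eq_right)
  qed
  also have "(7 * R) ^ CARD('n) * (real (card (steps :: (int ^ 'n) set)) * (b\<^sup>2 * (R/2) / (R/2) ^ CARD('n)))
      = flux_constant TYPE('n) * b\<^sup>2 * (R/2)"
  proof -
    have "(7 * R) ^ CARD('n) = 14 ^ CARD('n) * (R/2) ^ CARD('n)"
      unfolding power_mult_distrib[symmetric] by simp
    then show ?thesis using R(1) by simp
  qed
  also have "\<dots> \<le> (flux_constant TYPE('n) * b\<^sup>2) * (2 * R)"
    using R(1) by (intro mult_left_mono) auto
  finally show ?thesis using R(1) by (simp add: mult.commute[of "2 * R"])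
qed

section \<open>Orthogonality of plane waves\<close>

lemma integral_cis_period:
  "integral {- pi..pi} (\<lambda>t. cis (t * real_of_int m)) = (if m = 0 then of_real (2 * pi) else 0)"
proof (cases "m = 0")
  case True
  then show ?thesis by (simp add: scaleR_conv_of_real)
next
  case False
  have "((\<lambda>t. cis (t * real_of_int m)) has_integral
      (cis (pi * real_of_int m) / (\<i> * of_int m) - cis ((- pi) * real_of_int m) / (\<i> * of_int m))) {- pi..pi}"
  proof (rule fundamental_theorem_of_calculus)
    show "((\<lambda>t. cis (t * real_of_int m) / (\<i> * of_int m)) has_vector_derivative cis (t * real_of_int m)) (at t within {- pi..pi})" for t
    proof -
      have "((\<lambda>t. exp (\<i> * of_int m * of_real t) / (\<i> * of_int m)) has_vector_derivative
          exp (\<i> * of_int m * of_real t)) (at t within {- pi..pi})"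
        by (rule has_vector_derivative_real_field[where f = "\<lambda>z. exp (\<i> * of_int m * z) / (\<i> * of_int m)"])
          (use False in \<open>auto intro!: derivative_eq_intros\<close>)
      moreover have "cis (s * real_of_int m) = exp (\<i> * of_int m * of_real s)" for s
        by (simp add: cis_conv_exp mult_ac)
      ultimately show ?thesis by simp
    qed
  qed simp
  moreover have "cis (pi * real_of_int m) = cis ((- pi) * real_of_int m)"
  proof -
    have "cis (pi * real_of_int m) = cis ((- pi) * real_of_int m) * cis (2 * pi * real_of_int m)"
      by (simp only: cis_mult) (simp add: algebra_simps)
    then show ?thesis by (simp add: cis_multiple_2pi)
  qed
  ultimately show ?thesis using False by (simp add: integral_unique)
qed

lemma integral_prod_components:
  fixes f :: "'a::euclidean_space \<Rightarrow> real \<Rightarrow> complex"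
  assumes int: "\<And>b. b \<in> Basis \<Longrightarrow> integrable lborel (f b)"
  shows "(LINT k|lborel. (\<Prod>b\<in>Basis. f b (k \<bullet> b))) = (\<Prod>b\<in>(Basis :: 'a set). LINT t|lborel. f b t)"
proof -
  interpret product_sigma_finite "\<lambda>_::'a. lborel :: real measure"
    by standard
  have [measurable]: "f b \<in> borel_measurable borel" if "b \<in> Basis" for b
    using borel_measurable_integrable[OF int[OF that]] by simp
  have "(LINT k|lborel. (\<Prod>b\<in>Basis. f b (k \<bullet> b)))
      = (LINT g|(\<Pi>\<^sub>M b\<in>(Basis :: 'a set). lborel). (\<Prod>b\<in>Basis. f b ((\<Sum>b\<in>Basis. g b *\<^sub>R b) \<bullet> b)))"
    by (subst lborel_eq, subst integral_distr) measurable
  also have "\<dots> = (LINT g|(\<Pi>\<^sub>M b\<in>(Basis :: 'a set). lborel). (\<Prod>b\<in>Basis. f b (g b)))"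
    by (intro Bochner_Integration.integral_cong prod.cong) auto
  also have "\<dots> = (\<Prod>b\<in>(Basis :: 'a set). LINT t|lborel. f b t)"
    using int by (intro product_integral_prod) auto
  finally show ?thesis .
qed

lemma continuous_on_wave [continuous_intros]:
  "continuous_on S f \<Longrightarrow> continuous_on S (\<lambda>k. wave (f k) x)"
  unfolding wave_def cis_conv_exp by (intro continuous_intros)

lemma integral_wave:
  fixes x :: "int ^ 'n"
  shows "integral brillouin (\<lambda>k. wave k x) = (if x = 0 then of_real ((2 * pi) ^ CARD('n)) else 0)"
proof -
  define f :: "real ^ 'n \<Rightarrow> real \<Rightarrow> complex" where
    "f b t = indicator {- pi..pi} t *\<^sub>R cis (t * (lattice_point x \<bullet> b))" for b t
  have fint: "integrable lborel (f b)" and fval: "(LINT t|lborel. f b t) = integral {- pi..pi} (\<lambda>t. cis (t * (lattice_point x \<bullet> b)))" for b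
  proof -
    have "continuous_on {- pi..pi} (\<lambda>t. cis (t * (lattice_point x \<bullet> b)))"
      unfolding cis_conv_exp by (intro continuous_intros)
    then have "set_integrable lborel {- pi..pi} (\<lambda>t. cis (t * (lattice_point x \<bullet> b)))"
      by (rule borel_integrable_atLeastAtMost')
    then show "integrable lborel (f b)" "(LINT t|lborel. f b t) = integral {- pi..pi} (\<lambda>t. cis (t * (lattice_point x \<bullet> b)))"
      using set_borel_integral_eq_integral(2)[of "{- pi..pi}" "\<lambda>t. cis (t * (lattice_point x \<bullet> b))"]
      by (simp_all add: set_integrable_def set_lebesgue_integral_def f_def[abs_def])
  qed
  have "set_integrable lborel (brillouin :: (real ^ 'n) set) (\<lambda>k. wave k x)"
    unfolding set_integrable_def brillouin_def
    by (intro borel_integrable_compact continuous_intros) auto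
  then have "integral brillouin (\<lambda>k. wave k x) = (LINT k|lborel. indicator brillouin k *\<^sub>R wave k x)"
    by (simp add: set_borel_integral_eq_integral(2)[symmetric] set_lebesgue_integral_def)
  also have "\<dots> = (LINT k|lborel. (\<Prod>b\<in>Basis. f b (k \<bullet> b)))"
  proof (intro Bochner_Integration.integral_cong refl)
    fix k :: "real ^ 'n"
    have "wave k x = (\<Prod>b\<in>Basis. cis ((k \<bullet> b) * (lattice_point x \<bullet> b)))"
      unfolding wave_def by (subst euclidean_inner) (simp add: cis_sum)
    moreover have "indicator brillouin k = (\<Prod>b\<in>Basis. indicator {- pi..pi} (k \<bullet> b) :: real)"
    proof (cases "k \<in> brillouin")
      case True
      have "indicator {- pi..pi} (k \<bullet> b) = (1 :: real)" if "b \<in> Basis" for b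
      proof -
        obtain i where "b = axis i 1" using \<open>b \<in> Basis\<close> by (auto simp: Basis_vec_def)
        moreover have "\<bar>k $ i\<bar> \<le> pi" using True by (simp add: mem_brillouin)
        then have "- pi \<le> k $ i" "k $ i \<le> pi" by linarith+
        ultimately show ?thesis by (simp add: inner_axis)
      qed
      then show ?thesis using True by simp
    next
      case False
      then obtain i where "\<not> \<bar>k $ i\<bar> \<le> pi" by (auto simp: mem_brillouin)
      then have "indicator {- pi..pi} (k \<bullet> axis i 1) = (0 :: real)" "axis i 1 \<in> (Basis :: (real ^ 'n) set)"
        by (auto simp: inner_axis Basis_vec_def abs_le_iff)
      then have "(\<Prod>b\<in>Basis. indicator {- pi..pi} (k \<bullet> b) :: real) = 0"
        by (intro prod_zero) auto
      then show ?thesis using False by simp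
    qed
    ultimately show "indicator brillouin k *\<^sub>R wave k x = (\<Prod>b\<in>Basis. f b (k \<bullet> b))"
      by (simp add: f_def scaleR_conv_of_real prod.distrib)
  qed
  also have "\<dots> = (\<Prod>b\<in>(Basis :: (real ^ 'n) set). integral {- pi..pi} (\<lambda>t. cis (t * (lattice_point x \<bullet> b))))"
    using integral_prod_components[of f, OF fint] by (simp add: fval)
  also have "\<dots> = (\<Prod>i\<in>UNIV. integral {- pi..pi} (\<lambda>t. cis (t * real_of_int (x $ i))))"
  proof -
    have B: "(Basis :: (real ^ 'n) set) = (\<lambda>i. axis i 1) ` UNIV" by (auto simp: Basis_vec_def)
    have inj: "inj (\<lambda>i. axis i 1 :: real ^ 'n)" by (auto simp: inj_def axis_eq_axis)
    show ?thesis unfolding B prod.reindex[OF inj] o_def by (simp add: inner_axis lattice_point_def)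
  qed
  also have "\<dots> = (if x = 0 then of_real ((2 * pi) ^ CARD('n)) else 0)"
    unfolding integral_cis_period by (auto simp: vec_eq_iff intro!: prod_zero)
  finally show ?thesis .
qed

definition zone_volume :: "'n::finite itself \<Rightarrow> real" where
  "zone_volume _ = (2 * pi) ^ CARD('n)"

lemma wave_orthogonal:
  fixes x y :: "int ^ 'n"
  shows "((\<lambda>k. wave k x * cnj (wave k y)) has_integral (if x = y then of_real (zone_volume TYPE('n)) else 0)) brillouin"
proof -
  have "(\<lambda>k. wave k (x - y)) integrable_on brillouin"
    unfolding brillouin_def by (intro integrable_continuous continuous_intros)
  note has = integrable_integral[OF this, unfolded integral_wave]
  have eq: "wave k x * cnj (wave k y) = wave k (x - y)" for k
    by (simp only: wave_diff[of _ x y] wave_minus)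
  show ?thesis using has unfolding eq zone_volume_def by (simp only: right_minus_eq)
qed

text \<open>This is what puts the Fourier solution of the resolvent equation into \<open>ell2\<close>.\<close>

lemma bessel:
  fixes g :: "real ^ 'n \<Rightarrow> complex"
  assumes cont: "continuous_on brillouin g" and A: "finite A"
  defines "u \<equiv> \<lambda>x. integral brillouin (\<lambda>k. g k * cnj (wave k x))"
  shows "(\<Sum>x\<in>A. (cmod (u x))\<^sup>2) \<le> zone_volume TYPE('n) * Re (integral brillouin (\<lambda>k. g k * cnj (g k)))"
proof -
  define c where "c = zone_volume TYPE('n)"
  define G where "G = integral brillouin (\<lambda>k. g k * cnj (g k))"
  have c: "c > 0" by (simp add: c_def zone_volume_def)
  have 1: "((\<lambda>k. g k * cnj (wave k x)) has_integral u x) brillouin" for x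
    using cont unfolding u_def brillouin_def
    by (intro integrable_integral integrable_continuous continuous_intros) auto
  have 2: "((\<lambda>k. wave k x * cnj (g k)) has_integral cnj (u x)) brillouin" for x
    using has_integral_cnj[THEN iffD2, OF 1[of x]] by (simp add: mult.commute o_def)
  have 3: "((\<lambda>k. g k * cnj (g k)) has_integral G) brillouin"
    using cont unfolding G_def brillouin_def
    by (intro integrable_integral integrable_continuous continuous_intros) auto
  \<comment> \<open>The residual of the projection of \<open>g\<close> to the plane waves in \<open>A\<close>.\<close>
  define h where "h k = g k - (\<Sum>x\<in>A. u x / of_real c * wave k x)" for k
  let ?I = "\<lambda>k. g k * cnj (g k)
        - (\<Sum>x\<in>A. cnj (u x) / of_real c * (g k * cnj (wave k x)))
        - (\<Sum>x\<in>A. u x / of_real c * (wave k x * cnj (g k)))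
        + (\<Sum>x\<in>A. \<Sum>y\<in>A. u x / of_real c * (cnj (u y) / of_real c) * (wave k x * cnj (wave k y)))"
  have "(?I has_integral
       (G - (\<Sum>x\<in>A. cnj (u x) / of_real c * u x) - (\<Sum>x\<in>A. u x / of_real c * cnj (u x))
        + (\<Sum>x\<in>A. \<Sum>y\<in>A. u x / of_real c * (cnj (u y) / of_real c) * (if x = y then of_real c else 0)))) brillouin"
    unfolding c_def
    by (intro has_integral_add has_integral_diff has_integral_sum A has_integral_mult_right 1 2 3 wave_orthogonal)
  also have "?I = (\<lambda>k. h k * cnj (h k))"
  proof
    fix k
    define S where "S = (\<Sum>x\<in>A. u x / of_real c * wave k x)"
    have "(\<Sum>x\<in>A. cnj (u x) / of_real c * (g k * cnj (wave k x))) = g k * cnj S"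
      by (simp add: S_def sum_distrib_left mult_ac)
    moreover have "(\<Sum>x\<in>A. u x / of_real c * (wave k x * cnj (g k))) = S * cnj (g k)"
      by (simp add: S_def sum_distrib_left sum_distrib_right mult_ac)
    moreover have "(\<Sum>x\<in>A. \<Sum>y\<in>A. u x / of_real c * (cnj (u y) / of_real c) * (wave k x * cnj (wave k y))) = S * cnj S"
      by (simp add: S_def sum_product mult_ac)
    ultimately show "?I k = h k * cnj (h k)"
      unfolding h_def S_def[symmetric] by (simp add: algebra_simps)
  qed
  also have "(\<Sum>x\<in>A. \<Sum>y\<in>A. u x / of_real c * (cnj (u y) / of_real c) * (if x = y then of_real c else 0))
      = (\<Sum>x\<in>A. u x / of_real c * cnj (u x))"
    using A c by (intro sum.cong refl) (simp add: if_distrib[of "\<lambda>z. _ * z"] cong: if_cong)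
  finally have "((\<lambda>k. h k * cnj (h k)) has_integral (G - (\<Sum>x\<in>A. u x / of_real c * cnj (u x)))) brillouin"
    by (simp add: mult.commute)
  from has_integral_Re[OF this] have "0 \<le> Re (G - (\<Sum>x\<in>A. u x / of_real c * cnj (u x)))"
    by (rule has_integral_nonneg) (simp add: complex_mult_cnj)
  also have "(\<Sum>x\<in>A. u x / of_real c * cnj (u x)) = of_real ((\<Sum>x\<in>A. (cmod (u x))\<^sup>2) / c)"
    by (simp only: of_real_divide of_real_sum complex_norm_square sum_divide_distrib times_divide_eq_left)
  finally show ?thesis using c by (simp add: G_def c_def field_simps)
qed

section \<open>Fourier representation of the resolvent\<close>

definition ft :: "(int ^ 'n \<Rightarrow> complex) \<Rightarrow> real ^ 'n \<Rightarrow> complex" where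
  "ft F k = (\<Sum>x | F x \<noteq> 0. F x * wave k x)"

definition conv :: "(int ^ 'n \<Rightarrow> complex) \<Rightarrow> (int ^ 'n \<Rightarrow> complex) \<Rightarrow> int ^ 'n \<Rightarrow> complex" where
  "conv h G x = (\<Sum>y | h y \<noteq> 0. h y * G (x - y))"

lemma ft_superset:
  assumes "finite A" "\<And>x. F x \<noteq> 0 \<Longrightarrow> x \<in> A"
  shows "ft F k = (\<Sum>x\<in>A. F x * wave k x)"
  unfolding ft_def using assms by (intro sum.mono_neutral_left) auto

lemma continuous_on_ft [continuous_intros]:
  "continuous_on S f \<Longrightarrow> continuous_on S (\<lambda>k. ft F (f k))"
  unfolding ft_def by (intro continuous_intros)

lemma conv_support:
  assumes "finite {x. h x \<noteq> 0}" "finite {x. G x \<noteq> 0}"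
  shows "{x. conv h G x \<noteq> 0} \<subseteq> (\<lambda>(y, z). y + z) ` ({x. h x \<noteq> 0} \<times> {x. G x \<noteq> 0})"
    and finite_conv: "finite {x. conv h G x \<noteq> 0}"
proof -
  show sub: "{x. conv h G x \<noteq> 0} \<subseteq> (\<lambda>(y, z). y + z) ` ({x. h x \<noteq> 0} \<times> {x. G x \<noteq> 0})"
  proof safe
    fix x assume "conv h G x \<noteq> 0"
    then obtain y where "h y \<noteq> 0" "G (x - y) \<noteq> 0"
      unfolding conv_def by (force elim: sum.not_neutral_contains_not_neutral)
    then show "x \<in> (\<lambda>(y, z). y + z) ` ({x. h x \<noteq> 0} \<times> {x. G x \<noteq> 0})"
      by (intro image_eqI[of _ _ "(y, x - y)"]) auto
  qed
  show "finite {x. conv h G x \<noteq> 0}"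
    by (rule finite_subset[OF sub]) (use assms in auto)
qed

lemma ft_conv:
  fixes h G :: "int ^ 'n \<Rightarrow> complex"
  assumes "finite {x. h x \<noteq> 0}" "finite {x. G x \<noteq> 0}"
  shows "ft (conv h G) k = ft h k * ft G k"
proof -
  let ?H = "{x. h x \<noteq> 0}" and ?G = "{x. G x \<noteq> 0}"
  let ?A = "(\<lambda>(y, z). y + z) ` (?H \<times> ?G)"
  have "ft (conv h G) k = (\<Sum>x\<in>?A. \<Sum>y\<in>?H. h y * G (x - y) * wave k x)"
    using assms conv_support[OF assms]
    by (subst ft_superset[of ?A]) (auto simp: conv_def sum_distrib_right)
  also have "\<dots> = (\<Sum>y\<in>?H. \<Sum>x\<in>?A. h y * G (x - y) * wave k x)"
    by (rule sum.swap)
  also have "\<dots> = (\<Sum>y\<in>?H. h y * wave k y * ft G k)"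
  proof (rule sum.cong[OF refl])
    fix y assume y: "y \<in> ?H"
    have "(\<Sum>x\<in>?A. h y * G (x - y) * wave k x) = (\<Sum>x\<in>(\<lambda>z. y + z) ` ?G. h y * G (x - y) * wave k x)"
    proof (rule sum.mono_neutral_right)
      show "(+) y ` {x. G x \<noteq> 0} \<subseteq> ?A" using y by force
      show "\<forall>x\<in>?A - (+) y ` {x. G x \<noteq> 0}. h y * G (x - y) * wave k x = 0"
      proof
        fix x assume "x \<in> ?A - (+) y ` {x. G x \<noteq> 0}"
        then have "x \<notin> (+) y ` {x. G x \<noteq> 0}" by blast
        then have "G (x - y) = 0" by (metis (mono_tags) add_diff_cancel_left' diff_add_cancel image_eqI mem_Collect_eq add.commute)
        then show "h y * G (x - y) * wave k x = 0" by simp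
      qed
    qed (use assms in auto)
    also have "\<dots> = h y * wave k y * ft G k"
      by (simp add: sum.reindex ft_def sum_distrib_left wave_add mult_ac)
    finally show "(\<Sum>x\<in>?A. h y * G (x - y) * wave k x) = h y * wave k y * ft G k" .
  qed
  also have "\<dots> = ft h k * ft G k"
    by (simp add: ft_def sum_distrib_right)
  finally show ?thesis .
qed

text \<open>\<open>phi\<close> is the symbol of the Laplacian.\<close>

lemma sum_steps_wave:
  fixes k :: "real ^ 'n"
  shows "(\<Sum>s\<in>steps. wave k s) = of_real (phi k)"
proof -
  let ?P = "(\<lambda>i. axis i 1 :: int ^ 'n) ` UNIV" and ?M = "(\<lambda>i. - axis i 1 :: int ^ 'n) ` UNIV"
  have lp: "lattice_point (axis i 1 :: int ^ 'n) = axis i 1" for i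
    by (simp add: lattice_point_def axis_def vec_eq_iff)
  have steps_eq: "(steps :: (int ^ 'n) set) = ?P \<union> ?M"
  proof (intro set_eqI iffI)
    fix s :: "int ^ 'n" assume "s \<in> steps"
    then have "(lattice_norm s)\<^sup>2 = 1" by (simp add: steps_def)
    moreover have "(lattice_norm s)\<^sup>2 = (\<Sum>i\<in>UNIV. real_of_int ((s $ i)\<^sup>2))"
      unfolding power2_norm_eq_inner inner_vec_def by (simp add: lattice_point_def power2_eq_square)
    ultimately have "(\<Sum>i\<in>UNIV. real_of_int ((s $ i)\<^sup>2)) = 1" by simp
    then have sum1: "(\<Sum>i\<in>UNIV. (s $ i)\<^sup>2) = 1" by (metis of_int_eq_1_iff of_int_sum)
    then obtain i where i: "s $ i \<noteq> 0"
      by (metis (no_types, lifting) sum.neutral zero_neq_one power_zero_numeral)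
    have le: "(s $ i)\<^sup>2 + (\<Sum>j\<in>UNIV - {i}. (s $ j)\<^sup>2) = 1"
      using sum1 by (subst (asm) sum.remove[of UNIV i]) auto
    have "(s $ i)\<^sup>2 \<ge> 1" using i by (smt (verit) zero_less_power2)
    moreover have ge: "(\<Sum>j\<in>UNIV - {i}. (s $ j)\<^sup>2) \<ge> 0" by (intro sum_nonneg) auto
    ultimately have sq: "(s $ i)\<^sup>2 = 1" and "(\<Sum>j\<in>UNIV - {i}. (s $ j)\<^sup>2) = 0" using le by linarith+
    then have z: "s $ j = 0" if "j \<noteq> i" for j
      using that by (subst (asm) sum_nonneg_eq_0_iff) auto
    from sq have "s $ i = 1 \<or> s $ i = - 1" by (simp add: power2_eq_1_iff)
    then have "s = axis i 1 \<or> s = - axis i 1"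
      using z by (auto simp: vec_eq_iff axis_def)
    then show "s \<in> ?P \<union> ?M" by auto
  qed (auto simp: steps_def lattice_point_minus lp norm_axis_1)
  have disj: "?P \<inter> ?M = {}"
  proof -
    have "(axis i 1 :: int ^ 'n) \<noteq> - axis j 1" for i j
    proof
      assume "(axis i 1 :: int ^ 'n) = - axis j 1"
      then have "(axis i 1 :: int ^ 'n) $ i = - (axis j 1 :: int ^ 'n) $ i" by (simp only: uminus_vec_def vec_lambda_beta) 
      then show False by (simp add: axis_def split: if_splits)
    qed
    then show ?thesis by auto
  qed
  have inj: "inj (\<lambda>i. axis i 1 :: int ^ 'n)" "inj (\<lambda>i. - axis i 1 :: int ^ 'n)"
    by (auto simp: inj_def axis_eq_axis)
  have "(\<Sum>s\<in>steps. wave k s) = (\<Sum>s\<in>?P. wave k s) + (\<Sum>s\<in>?M. wave k s)"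
    unfolding steps_eq by (rule sum.union_disjoint) (simp_all add: disj)
  also have "\<dots> = (\<Sum>i\<in>UNIV. wave k (axis i 1)) + (\<Sum>i\<in>UNIV. wave k (- axis i 1))"
    unfolding sum.reindex[OF inj(1)] sum.reindex[OF inj(2)] o_def ..
  also have "\<dots> = (\<Sum>i\<in>UNIV. of_real (2 * cos (k $ i)))"
    unfolding sum.distrib[symmetric] wave_minus
    by (intro sum.cong refl) (simp add: wave_def lp inner_axis complex_eq_iff)
  also have "\<dots> = of_real (phi k)" by (simp add: phi_def sum_distrib_left)
  finally show ?thesis .
qed

text \<open>The inverse Fourier transform of \<open>ft F / (phi - \<nu>)\<close>.\<close>

definition fourier_resolvent :: "complex \<Rightarrow> (int ^ 'n \<Rightarrow> complex) \<Rightarrow> int ^ 'n \<Rightarrow> complex" where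
  "fourier_resolvent \<nu> F x =
     integral brillouin (\<lambda>k. ft F k / (of_real (phi k) - \<nu>) * cnj (wave k x)) / of_real (zone_volume TYPE('n))"

lemma phi_minus_nonzero: "Im \<nu> \<noteq> 0 \<Longrightarrow> of_real (phi k) - \<nu> \<noteq> 0"
  by (auto simp: complex_eq_iff)

lemma resolvent_has_integral:
  fixes F :: "int ^ 'n \<Rightarrow> complex"
  assumes \<nu>: "Im \<nu> \<noteq> 0"
  shows "((\<lambda>k. ft F k / (of_real (phi k) - \<nu>) * cnj (wave k x)) has_integral
    of_real (zone_volume TYPE('n)) * fourier_resolvent \<nu> F x) brillouin"
proof -
  have "(\<lambda>k. ft F k / (of_real (phi k) - \<nu>) * cnj (wave k x)) integrable_on brillouin"
    unfolding brillouin_def using phi_minus_nonzero[OF \<nu>]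
    by (intro integrable_continuous continuous_intros) auto
  from integrable_integral[OF this] show ?thesis
    by (simp add: fourier_resolvent_def zone_volume_def)
qed

lemma ft_has_integral:
  fixes F :: "int ^ 'n \<Rightarrow> complex"
  assumes F: "finite {x. F x \<noteq> 0}"
  shows "((\<lambda>k. ft F k * cnj (wave k x)) has_integral of_real (zone_volume TYPE('n)) * F x) brillouin"
proof -
  have "((\<lambda>k. \<Sum>y\<in>{x. F x \<noteq> 0}. F y * (wave k y * cnj (wave k x))) has_integral
     (\<Sum>y\<in>{x. F x \<noteq> 0}. F y * (if y = x then of_real (zone_volume TYPE('n)) else 0))) brillouin"
    using F by (intro has_integral_sum has_integral_mult_right wave_orthogonal)
  also have "(\<Sum>y\<in>{x. F x \<noteq> 0}. F y * (if y = x then of_real (zone_volume TYPE('n)) else 0))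
     = of_real (zone_volume TYPE('n)) * F x"
    using F by (simp add: if_distrib[of "\<lambda>z. _ * z"] cong: if_cong) 
  finally show ?thesis by (simp add: ft_def sum_distrib_right mult.assoc)
qed

lemma fourier_resolvent_solves:
  fixes F :: "int ^ 'n \<Rightarrow> complex"
  assumes \<nu>: "Im \<nu> \<noteq> 0" and F: "finite {x. F x \<noteq> 0}"
  shows "discrete_laplacian (fourier_resolvent \<nu> F) x - \<nu> * fourier_resolvent \<nu> F x = F x"
proof -
  let ?c = "of_real (zone_volume TYPE('n)) :: complex"
  let ?g = "\<lambda>k. ft F k / (of_real (phi k) - \<nu>)"
  have "((\<lambda>k. (\<Sum>s\<in>steps. ?g k * cnj (wave k (x + s))) - \<nu> * (?g k * cnj (wave k x))) has_integral
     (\<Sum>s\<in>steps. ?c * fourier_resolvent \<nu> F (x + s)) - \<nu> * (?c * fourier_resolvent \<nu> F x)) brillouin"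
    by (intro has_integral_diff has_integral_sum has_integral_mult_right resolvent_has_integral \<nu>) auto
  also have "(\<lambda>k. (\<Sum>s\<in>steps. ?g k * cnj (wave k (x + s))) - \<nu> * (?g k * cnj (wave k x)))
     = (\<lambda>k. ft F k * cnj (wave k x))"
  proof
    fix k :: "real ^ 'n"
    have "(\<Sum>s\<in>steps. ?g k * cnj (wave k (x + s))) = ?g k * cnj (wave k x) * cnj (\<Sum>s\<in>steps. wave k s)"
      unfolding cnj_sum sum_distrib_left
      by (intro sum.cong refl) (simp only: wave_add complex_cnj_mult mult.assoc)
    also have "\<dots> = ?g k * cnj (wave k x) * of_real (phi k)" by (simp add: sum_steps_wave)
    finally show "(\<Sum>s\<in>steps. ?g k * cnj (wave k (x + s))) - \<nu> * (?g k * cnj (wave k x)) = ft F k * cnj (wave k x)"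
      using phi_minus_nonzero[OF \<nu>, of k] by (simp add: field_simps)
  qed
  finally have "?c * (discrete_laplacian (fourier_resolvent \<nu> F) x - \<nu> * fourier_resolvent \<nu> F x) = ?c * F x"
    using has_integral_unique[OF _ ft_has_integral[OF F, of x]]
    by (simp add: discrete_laplacian_steps right_diff_distrib sum_distrib_left mult.left_commute)
  then show ?thesis by (simp add: zone_volume_def)
qed

lemma fourier_resolvent_ell2:
  fixes F :: "int ^ 'n \<Rightarrow> complex"
  assumes \<nu>: "Im \<nu> \<noteq> 0"
  shows "fourier_resolvent \<nu> F \<in> ell2"
proof -
  let ?g = "\<lambda>k. ft F k / (of_real (phi k) - \<nu>)"
  let ?c = "zone_volume TYPE('n)"
  have cont: "continuous_on brillouin ?g"
    using phi_minus_nonzero[OF \<nu>] by (intro continuous_intros) auto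
  have c: "?c > 0" by (simp add: zone_volume_def)
  have "(\<lambda>x. (cmod (fourier_resolvent \<nu> F x))\<^sup>2) summable_on UNIV"
  proof (rule nonneg_bounded_partial_sums_imp_summable_on)
    show "eventually (\<lambda>A. (\<Sum>x\<in>A. (cmod (fourier_resolvent \<nu> F x))\<^sup>2)
        \<le> Re (integral brillouin (\<lambda>k. ?g k * cnj (?g k))) / ?c) (finite_subsets_at_top UNIV)"
    proof (rule eventually_finite_subsets_at_top_weakI)
      fix A :: "(int ^ 'n) set" assume A: "finite A"
      have "(\<Sum>x\<in>A. (cmod (fourier_resolvent \<nu> F x))\<^sup>2)
          = (\<Sum>x\<in>A. (cmod (integral brillouin (\<lambda>k. ?g k * cnj (wave k x))))\<^sup>2) / ?c\<^sup>2"
        using c by (simp add: fourier_resolvent_def norm_divide power_divide sum_divide_distrib)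
      also have "\<dots> \<le> ?c * Re (integral brillouin (\<lambda>k. ?g k * cnj (?g k))) / ?c\<^sup>2"
        by (intro divide_right_mono bessel cont A) auto
      finally show "(\<Sum>x\<in>A. (cmod (fourier_resolvent \<nu> F x))\<^sup>2)
          \<le> Re (integral brillouin (\<lambda>k. ?g k * cnj (?g k))) / ?c"
        using c by (simp add: power2_eq_square)
    qed
  qed auto
  then show ?thesis by (simp add: ell2_def)
qed

lemma ell2_diff:
  assumes "u \<in> ell2" "v \<in> ell2"
  shows "(\<lambda>x. u x - v x) \<in> ell2"
proof -
  have "(\<lambda>x. 2 * (cmod (u x))\<^sup>2 + 2 * (cmod (v x))\<^sup>2) summable_on UNIV"
    using assms by (intro summable_on_add summable_on_cmult_right) (auto simp: ell2_def)
  then have "(\<lambda>x. (cmod (u x - v x))\<^sup>2) summable_on UNIV"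
  proof (rule summable_on_comparison_test)
    fix x
    have "(cmod (u x - v x))\<^sup>2 \<le> (cmod (u x) + cmod (v x))\<^sup>2"
      by (intro power_mono norm_triangle_ineq4) auto
    also have "\<dots> \<le> 2 * (cmod (u x))\<^sup>2 + 2 * (cmod (v x))\<^sup>2"
      using sum_squares_bound[of "cmod (u x)" "cmod (v x)"] by (simp add: power2_sum)
    finally show "(cmod (u x - v x))\<^sup>2 \<le> 2 * (cmod (u x))\<^sup>2 + 2 * (cmod (v x))\<^sup>2" .
  qed auto
  then show ?thesis by (simp add: ell2_def)
qed

lemma laplacian_resolvent_eq:
  fixes F :: "int ^ 'n \<Rightarrow> complex"
  assumes \<nu>: "Im \<nu> \<noteq> 0" and F: "finite {x. F x \<noteq> 0}"
  shows "laplacian_resolvent \<nu> F = fourier_resolvent \<nu> F"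
  unfolding laplacian_resolvent_def
proof (rule the_equality)
  let ?r = "fourier_resolvent \<nu> F"
  show r: "?r \<in> ell2 \<and> (\<forall>x. discrete_laplacian ?r x - \<nu> * ?r x = F x)"
    using fourier_resolvent_ell2[OF \<nu>] fourier_resolvent_solves[OF \<nu> F] by blast
  fix u assume u: "u \<in> ell2 \<and> (\<forall>x. discrete_laplacian u x - \<nu> * u x = F x)"
  have "u x - ?r x = 0" for x
  proof (rule ell2_eigenvalue_zero[where u = "\<lambda>x. u x - ?r x", OF _ _ \<nu>])
    show "(\<lambda>x. u x - ?r x) \<in> ell2" using u r by (intro ell2_diff) auto
    fix x
    have "discrete_laplacian (\<lambda>x. u x - ?r x) x = discrete_laplacian u x - discrete_laplacian ?r x"
      by (simp add: discrete_laplacian_steps sum_subtractf)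
    moreover have "discrete_laplacian u x = \<nu> * u x + F x" "discrete_laplacian ?r x = \<nu> * ?r x + F x"
      using u r by (metis add.commute diff_eq_eq)+
    ultimately show "discrete_laplacian (\<lambda>x. u x - ?r x) x = \<nu> * (u x - ?r x)"
      by (simp add: right_diff_distrib)
  qed
  then show "u = ?r" by (simp add: fun_eq_iff)
qed

lemma fourier_resolvent_conv:
  fixes h F :: "int ^ 'n \<Rightarrow> complex"
  assumes \<nu>: "Im \<nu> \<noteq> 0" and h: "finite {x. h x \<noteq> 0}" and F: "finite {x. F x \<noteq> 0}"
  shows "fourier_resolvent \<nu> (conv h F) x = conv h (fourier_resolvent \<nu> F) x"
proof -
  let ?c = "of_real (zone_volume TYPE('n)) :: complex"
  let ?g = "\<lambda>k. ft F k / (of_real (phi k) - \<nu>)"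
  have "((\<lambda>k. \<Sum>y\<in>{y. h y \<noteq> 0}. h y * (?g k * cnj (wave k (x - y)))) has_integral
      (\<Sum>y\<in>{y. h y \<noteq> 0}. h y * (?c * fourier_resolvent \<nu> F (x - y)))) brillouin"
    by (intro has_integral_sum has_integral_mult_right resolvent_has_integral \<nu> h)
  also have "(\<lambda>k. \<Sum>y\<in>{y. h y \<noteq> 0}. h y * (?g k * cnj (wave k (x - y))))
      = (\<lambda>k. ft (conv h F) k / (of_real (phi k) - \<nu>) * cnj (wave k x))"
  proof
    fix k :: "real ^ 'n"
    have "h y * (?g k * cnj (wave k (x - y))) = h y * wave k y * (?g k * cnj (wave k x))" for y
      unfolding wave_diff[of _ x] wave_minus by simp
    then have "(\<Sum>y\<in>{y. h y \<noteq> 0}. h y * (?g k * cnj (wave k (x - y))))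
        = ft h k * (?g k * cnj (wave k x))"
      unfolding ft_def[of h] sum_distrib_right by (intro sum.cong refl)
    then show "(\<Sum>y\<in>{y. h y \<noteq> 0}. h y * (?g k * cnj (wave k (x - y))))
        = ft (conv h F) k / (of_real (phi k) - \<nu>) * cnj (wave k x)"
      by (simp add: ft_conv[OF h F])
  qed
  finally have "(\<Sum>y\<in>{y. h y \<noteq> 0}. h y * (?c * fourier_resolvent \<nu> F (x - y)))
      = ?c * fourier_resolvent \<nu> (conv h F) x"
    by (rule has_integral_unique) (rule resolvent_has_integral[OF \<nu>])
  then have "?c * conv h (fourier_resolvent \<nu> F) x = ?c * fourier_resolvent \<nu> (conv h F) x"
    by (simp add: conv_def sum_distrib_left mult.left_commute)
  then show ?thesis by (simp add: zone_volume_def)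
qed

section \<open>Outgoing solutions and their flux\<close>

text \<open>The limit that defines \<open>\<psi>\<^sup>-\<close>, restricted to the vertical approach \<open>\<nu> = lam - i \<epsilon>\<close> and with the resolvent
replaced by its Fourier form.\<close>

definition outgoing :: "(int ^ 'n \<Rightarrow> complex) \<Rightarrow> real \<Rightarrow> (int ^ 'n \<Rightarrow> complex) \<Rightarrow> bool" where
  "outgoing F lam \<psi> \<longleftrightarrow>
     (\<forall>x. ((\<lambda>\<epsilon>. fourier_resolvent (Complex lam (- \<epsilon>)) F x) \<longlongrightarrow> \<psi> x) (at_right 0))"

lemma is_psi_minus_outgoing:
  assumes F: "finite {x. F x \<noteq> 0}" and psi: "is_psi_minus F lam \<psi>"
  shows "outgoing F lam \<psi>"
  unfolding outgoing_def
proof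
  fix x
  have "((\<lambda>\<epsilon>. Complex lam (- \<epsilon>)) \<longlongrightarrow> Complex lam (- 0)) (at_right 0)"
    by (intro tendsto_intros)
  moreover have "eventually (\<lambda>\<epsilon>. Complex lam (- \<epsilon>) \<in> {\<nu>. Im \<nu> < 0} \<and> Complex lam (- \<epsilon>) \<noteq> of_real lam) (at_right 0)"
    using eventually_at_right_less[of 0] by eventually_elim (auto simp: complex_eq_iff)
  ultimately have "filterlim (\<lambda>\<epsilon>. Complex lam (- \<epsilon>)) (at (of_real lam) within {\<nu>. Im \<nu> < 0}) (at_right 0)"
    by (simp add: filterlim_at complex_of_real_def)
  from filterlim_compose[OF psi[unfolded is_psi_minus_def, rule_format] this]
  have "((\<lambda>\<epsilon>. laplacian_resolvent (Complex lam (- \<epsilon>)) F x) \<longlongrightarrow> \<psi> x) (at_right 0)" .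
  moreover have "eventually (\<lambda>\<epsilon>. laplacian_resolvent (Complex lam (- \<epsilon>)) F x = fourier_resolvent (Complex lam (- \<epsilon>)) F x) (at_right 0)"
    using eventually_at_right_less[of 0] by eventually_elim (simp add: laplacian_resolvent_eq F)
  ultimately show "((\<lambda>\<epsilon>. fourier_resolvent (Complex lam (- \<epsilon>)) F x) \<longlongrightarrow> \<psi> x) (at_right 0)"
    by (rule Lim_transform_eventually)
qed

lemma outgoing_unique:
  assumes "outgoing F lam \<psi>" "outgoing F lam \<psi>'"
  shows "\<psi> = \<psi>'"
proof
  fix x
  show "\<psi> x = \<psi>' x"
    by (rule tendsto_unique[OF _ assms(1)[unfolded outgoing_def, rule_format] assms(2)[unfolded outgoing_def, rule_format]]) simp
qed

lemma outgoing_conv: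
  assumes h: "finite {x. h x \<noteq> 0}" and F: "finite {x. F x \<noteq> 0}" and out: "outgoing F lam \<psi>"
  shows "outgoing (conv h F) lam (conv h \<psi>)"
  unfolding outgoing_def
proof
  fix x
  have "((\<lambda>\<epsilon>. conv h (fourier_resolvent (Complex lam (- \<epsilon>)) F) x) \<longlongrightarrow> conv h \<psi> x) (at_right 0)"
    using out unfolding conv_def outgoing_def by (intro tendsto_intros) auto
  moreover have "eventually (\<lambda>\<epsilon>. conv h (fourier_resolvent (Complex lam (- \<epsilon>)) F) x
      = fourier_resolvent (Complex lam (- \<epsilon>)) (conv h F) x) (at_right 0)"
    using eventually_at_right_less[of 0] by eventually_elim (simp add: fourier_resolvent_conv h F)
  ultimately show "((\<lambda>\<epsilon>. fourier_resolvent (Complex lam (- \<epsilon>)) (conv h F) x) \<longlongrightarrow> conv h \<psi> x) (at_right 0)"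
    by (rule Lim_transform_eventually)
qed

lemma conv_commute:
  assumes "finite {x. h x \<noteq> 0}" "finite {x. G x \<noteq> 0}"
  shows "conv h G = conv G h"
proof
  fix x
  have "conv h G x = (\<Sum>y | h y \<noteq> 0 \<and> G (x - y) \<noteq> 0. h y * G (x - y))"
    unfolding conv_def using assms by (intro sum.mono_neutral_right) auto
  also have "\<dots> = (\<Sum>y | G y \<noteq> 0 \<and> h (x - y) \<noteq> 0. G y * h (x - y))"
    by (rule sum.reindex_bij_witness[of _ "\<lambda>y. x - y" "\<lambda>y. x - y"]) (auto simp: mult.commute)
  also have "\<dots> = conv G h x"
    unfolding conv_def using assms by (intro sum.mono_neutral_left) auto
  finally show "conv h G x = conv G h x" .
qed

lemma outgoing_equation:
  assumes F: "finite {x. F x \<noteq> 0}" and out: "outgoing F lam \<psi>"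
  shows "discrete_laplacian \<psi> x - of_real lam * \<psi> x = F x"
proof (rule tendsto_unique[of "at_right (0::real)"])
  let ?r = "\<lambda>\<epsilon>. fourier_resolvent (Complex lam (- \<epsilon>)) F"
  have lim: "((\<lambda>\<epsilon>. ?r \<epsilon> y) \<longlongrightarrow> \<psi> y) (at_right 0)" for y
    using out by (simp add: outgoing_def)
  have "((\<lambda>\<epsilon>. Complex lam (- \<epsilon>)) \<longlongrightarrow> Complex lam (- 0)) (at_right 0)"
    by (intro tendsto_intros)
  then have "((\<lambda>\<epsilon>. Complex lam (- \<epsilon>)) \<longlongrightarrow> of_real lam) (at_right 0)"
    by (simp add: complex_of_real_def)
  then show "((\<lambda>\<epsilon>. discrete_laplacian (?r \<epsilon>) x - Complex lam (- \<epsilon>) * ?r \<epsilon> x) \<longlongrightarrow>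
      discrete_laplacian \<psi> x - of_real lam * \<psi> x) (at_right 0)"
    unfolding discrete_laplacian_steps by (intro tendsto_intros lim)
  have "eventually (\<lambda>\<epsilon>. F x = discrete_laplacian (?r \<epsilon>) x - Complex lam (- \<epsilon>) * ?r \<epsilon> x) (at_right 0)"
    using eventually_at_right_less[of 0] by eventually_elim (simp add: fourier_resolvent_solves F)
  then show "((\<lambda>\<epsilon>. discrete_laplacian (?r \<epsilon>) x - Complex lam (- \<epsilon>) * ?r \<epsilon> x) \<longlongrightarrow> F x) (at_right 0)"
    by (rule Lim_transform_eventually[OF tendsto_const])
qed simp

lemma cos_lipschitz: "\<bar>cos a - cos b\<bar> \<le> \<bar>a - b\<bar>" for a b :: real
proof -
  have "\<bar>cos a - cos b\<bar> = 2 * \<bar>sin ((a + b) / 2)\<bar> * \<bar>sin ((b - a) / 2)\<bar>"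
    by (simp add: cos_diff_cos abs_mult)
  also have "\<dots> \<le> 2 * 1 * \<bar>(b - a) / 2\<bar>"
    by (intro mult_mono abs_sin_x_le_abs_x) auto
  finally show ?thesis by simp
qed

definition cube :: "real ^ 'n \<Rightarrow> real \<Rightarrow> (real ^ 'n) set" where
  "cube k r = cbox (k - (\<chi> i. r)) (k + (\<chi> i. r))"

lemma mem_cube: "l \<in> cube k r \<longleftrightarrow> (\<forall>i. \<bar>l $ i - k $ i\<bar> \<le> r)"
  by (auto simp: cube_def mem_box_cart abs_le_iff algebra_simps)

lemma compact_shell: "compact {k \<in> cube k0 \<rho>. \<bar>phi k - lam\<bar> \<le> \<epsilon>}"
proof -
  have "closed {k :: real ^ 'n. \<bar>phi k - lam\<bar> \<le> \<epsilon>}"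
    by (intro closed_Collect_le continuous_intros)
  then have "compact (cube k0 \<rho> \<inter> {k. \<bar>phi k - lam\<bar> \<le> \<epsilon>})"
    unfolding cube_def by (intro compact_Int_closed) auto
  then show ?thesis by (simp add: Int_def)
qed

text \<open>The set \<open>|phi - lam| \<le> \<epsilon>\<close> contains a segment of length \<open>\<epsilon>\<close> in direction \<open>i\<close> around a point of the level
set, over every point of a small cube. Hence finitely many translates by multiples of \<open>\<epsilon>\<close> in this
direction cover the cube; as \<open>O(1 / \<epsilon>)\<close> of them suffice, the measure is at least of order \<open>\<epsilon>\<close>.\<close>

lemma measure_shell_lower:
  fixes k0 :: "real ^ 'n"
  assumes phi0: "phi k0 = lam" and i: "sin (k0 $ i) \<noteq> 0" and \<rho>: "\<rho> > 0"
  obtains c where "c > 0"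
    "\<And>\<epsilon>. 0 < \<epsilon> \<Longrightarrow> \<epsilon> \<le> \<rho> \<Longrightarrow> c * \<epsilon> \<le> measure lebesgue {k \<in> cube k0 \<rho>. \<bar>phi k - lam\<bar> \<le> \<epsilon>}"
proof -
  define s where "s = sgn (sin (k0 $ i))"
  have s: "s * sin (k0 $ i) > 0" "\<bar>s\<bar> = 1" "s * s = 1" using i by (auto simp: s_def sgn_if)
  \<comment> \<open>The sign \<open>s\<close> makes \<open>f\<close> increase at \<open>k0 $ i\<close>, so that both signs of the sine are treated at once.\<close>
  define f where "f t = - s * cos t" for t
  have df: "(f has_real_derivative s * sin (k0 $ i)) (at (k0 $ i))"
    unfolding f_def by (auto intro!: derivative_eq_intros)
  obtain d1 where d1: "d1 > 0" "\<And>h. 0 < h \<Longrightarrow> h < d1 \<Longrightarrow> f (k0 $ i) < f (k0 $ i + h)"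
    using DERIV_pos_inc_right[OF df s(1)] by auto
  obtain d2 where d2: "d2 > 0" "\<And>h. 0 < h \<Longrightarrow> h < d2 \<Longrightarrow> f (k0 $ i - h) < f (k0 $ i)"
    using DERIV_pos_inc_left[OF df s(1)] by auto
  define r where "r = min (\<rho> / 2) (min (d1 / 2) (d2 / 2))"
  have r: "0 < r" "r \<le> \<rho> / 2" "r < d1" "r < d2" using \<rho> d1(1) d2(1) by (auto simp: r_def)
  define \<delta> where "\<delta> = min (f (k0 $ i + r) - f (k0 $ i)) (f (k0 $ i) - f (k0 $ i - r))"
  have \<delta>: "\<delta> > 0" using d1(2)[of r] d2(2)[of r] r by (simp add: \<delta>_def)
  define \<sigma> where "\<sigma> = min \<rho> (\<delta> / real CARD('n))"
  have \<sigma>: "\<sigma> > 0" "\<sigma> \<le> \<rho>" "real CARD('n) * \<sigma> \<le> \<delta>"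
    using \<delta> \<rho> by (auto simp: \<sigma>_def min_def field_simps)
  define upd where "upd k t = (\<chi> j. if j = i then t else k $ j)" for k :: "real ^ 'n" and t :: real
  let ?R = "\<lambda>k :: real ^ 'n. \<Sum>j\<in>UNIV - {i}. cos (k $ j)"
  have phi_upd: "phi (upd k t) = 2 * cos t + 2 * ?R k" for k t
    unfolding phi_def by (subst sum.remove[of UNIV i]) (auto simp: upd_def)
  \<comment> \<open>The line in direction \<open>i\<close> through any point near \<open>k0\<close> meets the level set near \<open>k0\<close>.\<close>
  have root: "\<exists>t. \<bar>t - k0 $ i\<bar> \<le> r \<and> phi (upd k t) = lam" if k: "k \<in> cube k0 \<sigma>" for k
  proof -
    have close: "\<bar>?R k - ?R k0\<bar> \<le> \<delta>"
    proof -
      have "\<bar>?R k - ?R k0\<bar>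
          \<le> (\<Sum>j\<in>UNIV - {i}. \<bar>cos (k $ j) - cos (k0 $ j)\<bar>)"
        unfolding sum_subtractf[symmetric] by (rule sum_abs)
      also have "\<dots> \<le> (\<Sum>j\<in>UNIV - {i}. \<sigma>)"
        using k by (intro sum_mono order_trans[OF cos_lipschitz]) (auto simp: mem_cube)
      also have "\<dots> \<le> (\<Sum>j\<in>(UNIV :: 'n set). \<sigma>)" using \<sigma> by (intro sum_mono2) auto
      also have "\<dots> \<le> \<delta>" using \<sigma> by simp
      finally show ?thesis .
    qed
    have lam: "lam = 2 * cos (k0 $ i) + 2 * ?R k0"
      unfolding phi0[symmetric] phi_def by (subst sum.remove[of UNIV i]) auto
    define e where "e = s * (?R k - ?R k0)"
    have e: "\<bar>e\<bar> \<le> \<delta>" using close s(2) by (simp add: e_def abs_mult)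
    have eq: "phi (upd k t) - lam = - 2 * s * (f t - f (k0 $ i) - e)" for t
    proof -
      have "- 2 * s * (f t - f (k0 $ i) - e) = 2 * (s * s) * (cos t - cos (k0 $ i)
          + (?R k - ?R k0))"
        by (simp add: f_def e_def algebra_simps)
      then show ?thesis by (simp add: s(3) phi_upd lam)
    qed
    have "\<exists>t\<ge>k0 $ i - r. t \<le> k0 $ i + r \<and> f t = f (k0 $ i) + e"
    proof (rule IVT')
      show "f (k0 $ i - r) \<le> f (k0 $ i) + e" "f (k0 $ i) + e \<le> f (k0 $ i + r)"
        using e by (auto simp: \<delta>_def)
      show "continuous_on {k0 $ i - r..k0 $ i + r} f" unfolding f_def by (intro continuous_intros)
    qed (use r in simp)
    then obtain t where "k0 $ i - r \<le> t" "t \<le> k0 $ i + r" "f t = f (k0 $ i) + e" by blast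
    then show ?thesis using eq[of t] by (intro exI[of _ t]) auto
  qed
  \<comment> \<open>At most \<open>9 \<rho> / \<epsilon>\<close> translates are needed.\<close>
  define c where "c = measure lebesgue (cube k0 \<sigma>) / (9 * \<rho>)"
  have "measure lebesgue (cube k0 \<sigma>) > 0"
  proof -
    have "cube k0 \<sigma> \<noteq> {}" using \<sigma> mem_cube[of k0 k0 \<sigma>] by auto
    then show ?thesis unfolding cube_def using \<sigma>
      by (subst measure_completion) (auto simp: content_cbox_cart intro!: prod_pos)
  qed
  then have cpos: "c > 0" using \<rho> by (simp add: c_def)
  show ?thesis
  proof (rule that[OF cpos])
    fix \<epsilon> :: real assume \<epsilon>: "0 < \<epsilon>" "\<epsilon> \<le> \<rho>"
    define E where "E = {k \<in> cube k0 \<rho>. \<bar>phi k - lam\<bar> \<le> \<epsilon>}"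
    have compE: "compact E" unfolding E_def by (rule compact_shell)
    define J where "J = \<lceil>2 * \<rho> / \<epsilon>\<rceil> + 1"
    have J: "J \<ge> 0" "real_of_int J \<ge> 2 * \<rho> / \<epsilon> + 1" "real_of_int (2 * J + 1) * \<epsilon> \<le> 9 * \<rho>"
    proof -
      have "real_of_int \<lceil>2 * \<rho> / \<epsilon>\<rceil> \<ge> 2 * \<rho> / \<epsilon>" by (rule le_of_int_ceiling)
      then show "real_of_int J \<ge> 2 * \<rho> / \<epsilon> + 1" by (simp add: J_def)
      moreover have "2 * \<rho> / \<epsilon> > 0" using \<rho> \<epsilon> by simp
      ultimately show "J \<ge> 0" by linarith
      have "real_of_int J \<le> 2 * \<rho> / \<epsilon> + 2" unfolding J_def by linarith
      then have "real_of_int J * \<epsilon> \<le> (2 * \<rho> / \<epsilon> + 2) * \<epsilon>" using \<epsilon> by (intro mult_right_mono) auto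
      also have "(2 * \<rho> / \<epsilon> + 2) * \<epsilon> = 2 * \<rho> + 2 * \<epsilon>" using \<epsilon> by (simp add: distrib_right)
      finally have "real_of_int J * \<epsilon> \<le> 2 * \<rho> + 2 * \<epsilon>" .
      then show "real_of_int (2 * J + 1) * \<epsilon> \<le> 9 * \<rho>" using \<epsilon> by (simp add: algebra_simps)
    qed
    define T where "T j = (+) ((real_of_int j * \<epsilon>) *\<^sub>R axis i 1) ` E" for j
    have compT: "compact (T j)" for j unfolding T_def by (intro compact_translation compE)
    have cover: "cube k0 \<sigma> \<subseteq> (\<Union>j\<in>{- J..J}. T j)"
    proof
      fix k assume k: "k \<in> cube k0 \<sigma>"
      obtain t where t: "\<bar>t - k0 $ i\<bar> \<le> r" "phi (upd k t) = lam" using root[OF k] by blast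
      have ki: "\<bar>k $ j - k0 $ j\<bar> \<le> \<sigma>" for j using k by (simp add: mem_cube)
      define j where "j = round ((k $ i - t) / \<epsilon>)"
      have rj: "\<bar>real_of_int j - (k $ i - t) / \<epsilon>\<bar> \<le> 1/2"
        unfolding j_def by (rule of_int_round_abs_le)
      have "(k $ i - t) - real_of_int j * \<epsilon> = - \<epsilon> * (real_of_int j - (k $ i - t) / \<epsilon>)"
        using \<epsilon> by (simp add: field_simps)
      then have "\<bar>(k $ i - t) - real_of_int j * \<epsilon>\<bar> = \<epsilon> * \<bar>real_of_int j - (k $ i - t) / \<epsilon>\<bar>"
        using \<epsilon> by (simp add: abs_mult)
      also have "\<dots> \<le> \<epsilon> * (1/2)" using rj \<epsilon> by (intro mult_left_mono) auto
      finally have dist: "\<bar>(k $ i - real_of_int j * \<epsilon>) - t\<bar> \<le> \<epsilon> / 2" by (simp add: algebra_simps)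
      have "\<bar>(k $ i - t) / \<epsilon>\<bar> \<le> 2 * \<rho> / \<epsilon>"
        using ki[of i] t(1) r \<sigma> \<epsilon> by (simp add: abs_divide divide_right_mono)
      then have "\<bar>real_of_int j\<bar> \<le> real_of_int J" using rj J(2) by linarith
      then have jJ: "j \<in> {- J..J}" by auto
      define k' where "k' = upd k (k $ i - real_of_int j * \<epsilon>)"
      have kk': "k = (real_of_int j * \<epsilon>) *\<^sub>R axis i 1 + k'"
        by (simp add: k'_def upd_def vec_eq_iff axis_def)
      have "phi k' - phi (upd k t) = 2 * (cos (k $ i - real_of_int j * \<epsilon>) - cos t)"
        unfolding k'_def phi_upd by simp
      then have "\<bar>phi k' - phi (upd k t)\<bar> = 2 * \<bar>cos (k $ i - real_of_int j * \<epsilon>) - cos t\<bar>"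
        by (simp only: abs_mult abs_numeral)
      also have "\<dots> \<le> 2 * (\<epsilon> / 2)" by (intro mult_left_mono order_trans[OF cos_lipschitz dist]) auto
      finally have "\<bar>phi k' - lam\<bar> \<le> \<epsilon>" by (simp add: t(2))
      moreover have "k' \<in> cube k0 \<rho>"
        unfolding mem_cube
      proof
        fix j' show "\<bar>k' $ j' - k0 $ j'\<bar> \<le> \<rho>"
        proof (cases "j' = i")
          case True
          then have "k' $ j' = k $ i - real_of_int j * \<epsilon>" by (simp add: k'_def upd_def)
          moreover have "\<bar>(k $ i - real_of_int j * \<epsilon>) - k0 $ i\<bar> \<le> \<rho>"
            using dist t(1) r(2) \<epsilon>(2) by linarith
          ultimately show ?thesis by (simp only: True)
        next
          case False
          then show ?thesis using ki[of j'] \<sigma>(2) by (simp add: k'_def upd_def)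
        qed
      qed
      ultimately have "k' \<in> E" by (simp add: E_def)
      then have "k \<in> T j" unfolding T_def by (subst kk') (rule imageI)
      then show "k \<in> (\<Union>j\<in>{- J..J}. T j)" using jJ by blast
    qed
    have "measure lebesgue (cube k0 \<sigma>) \<le> measure lebesgue (\<Union>j\<in>{- J..J}. T j)"
      using compT by (intro measure_mono_fmeasurable[OF cover] fmeasurable.finite_UN lmeasurable_compact)
        (auto simp: cube_def)
    also have "\<dots> \<le> (\<Sum>j\<in>{- J..J}. measure lebesgue (T j))"
      using compT by (intro measure_UNION_le fmeasurableD lmeasurable_compact) auto
    also have "\<dots> = real_of_int (2 * J + 1) * measure lebesgue E"
      using J(1) by (simp add: T_def measure_translation)
    finally have "measure lebesgue (cube k0 \<sigma>) * \<epsilon> \<le> (real_of_int (2 * J + 1) * measure lebesgue E) * \<epsilon>"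
      using \<epsilon> by (intro mult_right_mono) auto
    also have "\<dots> = (real_of_int (2 * J + 1) * \<epsilon>) * measure lebesgue E" by simp
    also have "\<dots> \<le> 9 * \<rho> * measure lebesgue E" using J(3) by (intro mult_right_mono) auto
    finally have "c * \<epsilon> \<le> measure lebesgue E" using \<rho> by (simp add: c_def field_simps)
    then show "c * \<epsilon> \<le> measure lebesgue {k \<in> cube k0 \<rho>. \<bar>phi k - lam\<bar> \<le> \<epsilon>}"
      by (simp add: E_def)
  qed
qed

text \<open>By the Fourier representation, the flux is \<open>|ft F|\<^sup>2\<close> integrated against the Poisson kernel
\<open>\<epsilon> / ((phi - lam)\<^sup>2 + \<epsilon>\<^sup>2)\<close>, which is at least \<open>1 / (2 \<epsilon>)\<close> on a set of measure \<open>c \<epsilon>\<close>.\<close>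

lemma outgoing_flux_lower:
  fixes F \<psi> :: "int ^ 'n \<Rightarrow> complex"
  assumes F: "finite {x. F x \<noteq> 0}" and out: "outgoing F lam \<psi>"
    and sub: "cube k0 \<rho> \<subseteq> brillouin" and \<rho>: "\<rho> > 0" and m: "\<And>k. k \<in> cube k0 \<rho> \<Longrightarrow> m \<le> cmod (ft F k)" "m \<ge> 0"
    and c: "\<And>\<epsilon>. 0 < \<epsilon> \<Longrightarrow> \<epsilon> \<le> \<rho> \<Longrightarrow> c * \<epsilon> \<le> measure lebesgue {k \<in> cube k0 \<rho>. \<bar>phi k - lam\<bar> \<le> \<epsilon>}"
  shows "c * m\<^sup>2 / 2 \<le> zone_volume TYPE('n) * Im (\<Sum>x | F x \<noteq> 0. cnj (\<psi> x) * F x)"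
proof (rule tendsto_lowerbound)
  let ?r = "\<lambda>\<epsilon>. fourier_resolvent (Complex lam (- \<epsilon>)) F"
  let ?V = "zone_volume TYPE('n)"
  have Im_real: "Im (of_real a * z) = a * Im z" and Im_cnj: "Im (cnj z) = - Im z" for a :: real and z by simp_all
  have lim: "((\<lambda>\<epsilon>. ?r \<epsilon> y) \<longlongrightarrow> \<psi> y) (at_right 0)" for y
    using out by (simp add: outgoing_def)
  show "((\<lambda>\<epsilon>. ?V * Im (\<Sum>x | F x \<noteq> 0. cnj (?r \<epsilon> x) * F x)) \<longlongrightarrow>
     ?V * Im (\<Sum>x | F x \<noteq> 0. cnj (\<psi> x) * F x)) (at_right 0)"
    by (intro tendsto_intros lim)
  have "eventually (\<lambda>\<epsilon>. \<epsilon> \<in> {0<..<\<rho>}) (at_right (0::real))"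
    using \<rho> by (rule eventually_at_right_real)
  then show "eventually (\<lambda>\<epsilon>. c * m\<^sup>2 / 2 \<le> ?V * Im (\<Sum>x | F x \<noteq> 0. cnj (?r \<epsilon> x) * F x)) (at_right 0)"
  proof eventually_elim
    case (elim \<epsilon>)
    then have \<epsilon>: "0 < \<epsilon>" "\<epsilon> \<le> \<rho>" by auto
    let ?\<nu> = "Complex lam (- \<epsilon>)"
    let ?J = "Im (\<Sum>x | F x \<noteq> 0. cnj (?r \<epsilon> x) * F x)"
    define E where "E = {k \<in> cube k0 \<rho>. \<bar>phi k - lam\<bar> \<le> \<epsilon>}"
    have "compact E" unfolding E_def by (rule compact_shell)
    then have "(indicat_real E has_integral measure lebesgue E) UNIV"
      using lmeasurable_iff_has_integral lmeasurable_compact by blast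
    moreover have "(\<lambda>k. if k \<in> brillouin then indicat_real E k else 0) = indicat_real E"
      using sub by (auto simp: E_def indicator_def fun_eq_iff)
    ultimately have "(indicat_real E has_integral measure lebesgue E) brillouin"
      using has_integral_restrict_UNIV[of brillouin "indicat_real E"] by simp
    then have low: "((\<lambda>k. m\<^sup>2 / (2 * \<epsilon>) * indicat_real E k) has_integral m\<^sup>2 / (2 * \<epsilon>) * measure lebesgue E) brillouin"
      by (rule has_integral_mult_right)
    let ?T = "\<lambda>k. \<Sum>x\<in>{x. F x \<noteq> 0}. cnj (F x) * (ft F k / (of_real (phi k) - ?\<nu>) * cnj (wave k x))"
    have "((\<lambda>k. ?T k) has_integral
        (\<Sum>x\<in>{x. F x \<noteq> 0}. cnj (F x) * (of_real ?V * ?r \<epsilon> x))) brillouin"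
      using \<epsilon> by (intro has_integral_sum has_integral_mult_right resolvent_has_integral F) auto
    from has_integral_neg[OF has_integral_Im[OF this]]
    have up: "((\<lambda>k. (cmod (ft F k))\<^sup>2 * (\<epsilon> / ((phi k - lam)\<^sup>2 + \<epsilon>\<^sup>2))) has_integral
        ?V * ?J) brillouin"
    proof (rule back_subst[where P = "\<lambda>z. z", OF _ arg_cong2[where f = "\<lambda>g I. (g has_integral I) brillouin"]])
      show "(\<lambda>k. - Im (?T k))
          = (\<lambda>k. (cmod (ft F k))\<^sup>2 * (\<epsilon> / ((phi k - lam)\<^sup>2 + \<epsilon>\<^sup>2)))"
      proof
        fix k :: "real ^ 'n"
        have "(?T k)
            = ft F k / (of_real (phi k) - ?\<nu>) * cnj (ft F k)"
        proof -
          have "cnj (ft F k) = (\<Sum>x\<in>{x. F x \<noteq> 0}. cnj (F x) * cnj (wave k x))" by (simp add: ft_def)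
          then show ?thesis by (simp only: sum_distrib_left mult.left_commute)
        qed
        also have "\<dots> = of_real ((cmod (ft F k))\<^sup>2) * (1 / (of_real (phi k) - ?\<nu>))"
          by (simp only: complex_norm_square) simp
        finally have eq: "(?T k)
            = of_real ((cmod (ft F k))\<^sup>2) * (1 / (of_real (phi k) - ?\<nu>))" .
        show "- Im (?T k)
          = (cmod (ft F k))\<^sup>2 * (\<epsilon> / ((phi k - lam)\<^sup>2 + \<epsilon>\<^sup>2))"
          unfolding eq Im_real by (simp add: Im_divide power2_eq_square)
      qed
      have "(\<Sum>x\<in>{x. F x \<noteq> 0}. cnj (F x) * (of_real ?V * ?r \<epsilon> x))
         = of_real ?V * cnj (\<Sum>x | F x \<noteq> 0. cnj (?r \<epsilon> x) * F x)"
        by (simp add: sum_distrib_left mult_ac)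
      then show "- Im (\<Sum>x\<in>{x. F x \<noteq> 0}. cnj (F x) * (of_real ?V * ?r \<epsilon> x))
         = ?V * ?J"
        by (simp only: Im_real Im_cnj mult_minus_right minus_minus)
    qed
    have "m\<^sup>2 / (2 * \<epsilon>) * measure lebesgue E \<le> ?V * ?J"
    proof (rule has_integral_le[OF low up])
      fix k :: "real ^ 'n" assume "k \<in> brillouin"
      show "m\<^sup>2 / (2 * \<epsilon>) * indicat_real E k \<le> (cmod (ft F k))\<^sup>2 * (\<epsilon> / ((phi k - lam)\<^sup>2 + \<epsilon>\<^sup>2))"
      proof (cases "k \<in> E")
        case True
        have "(phi k - lam)\<^sup>2 \<le> \<epsilon>\<^sup>2" using True \<epsilon> by (intro power2_le_iff_abs_le[THEN iffD2]) (auto simp: E_def)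
        then have "\<epsilon> / (2 * \<epsilon>\<^sup>2) \<le> \<epsilon> / ((phi k - lam)\<^sup>2 + \<epsilon>\<^sup>2)"
          using \<epsilon> by (intro divide_left_mono) (auto intro!: mult_pos_pos add_nonneg_pos)
        moreover have "\<epsilon> / (2 * \<epsilon>\<^sup>2) = 1 / (2 * \<epsilon>)" using \<epsilon> by (simp add: power2_eq_square)
        moreover have "m\<^sup>2 \<le> (cmod (ft F k))\<^sup>2" using True m by (intro power_mono) (auto simp: E_def)
        ultimately have "m\<^sup>2 * (1 / (2 * \<epsilon>)) \<le> (cmod (ft F k))\<^sup>2 * (\<epsilon> / ((phi k - lam)\<^sup>2 + \<epsilon>\<^sup>2))"
          using \<epsilon> by (intro mult_mono) auto
        then show ?thesis using True by simp
      qed (use \<epsilon> in \<open>auto intro!: mult_nonneg_nonneg divide_nonneg_nonneg\<close>)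
    qed
    moreover have "m\<^sup>2 / (2 * \<epsilon>) * (c * \<epsilon>) \<le> m\<^sup>2 / (2 * \<epsilon>) * measure lebesgue E"
      using c[OF \<epsilon>] \<epsilon> unfolding E_def by (intro mult_left_mono) auto
    moreover have "m\<^sup>2 / (2 * \<epsilon>) * (c * \<epsilon>) = c * m\<^sup>2 / 2" using \<epsilon> by simp
    ultimately show ?case by linarith
  qed
qed simp

section \<open>Trigonometric polynomials\<close>

text \<open>Induction on the number of frequencies: the difference of a small translate by \<open>s\<close> and of \<open>wave s x\<^sub>0\<close> times
the function itself no longer contains the frequency \<open>x\<^sub>0\<close>, and the other coefficients are multiplied by
\<open>wave s x - wave s x\<^sub>0\<close>, which is nonzero for suitable \<open>s\<close>.\<close>

lemma trig_poly_zero: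
  fixes c :: "int ^ 'n \<Rightarrow> complex" and W :: "(real ^ 'n) set"
  assumes "finite A" "open W" "W \<noteq> {}" "\<And>k. k \<in> W \<Longrightarrow> (\<Sum>x\<in>A. c x * wave k x) = 0"
  shows "\<forall>x\<in>A. c x = 0"
  using assms
proof (induction A arbitrary: c W rule: finite_induct)
  case (insert x0 A)
  obtain k1 where "k1 \<in> W" using insert.prems by blast
  then obtain e where e: "e > 0" "ball k1 e \<subseteq> W"
    using insert.prems(1) by (auto simp: open_contains_ball)
  have zero: "c x = 0" if x: "x \<in> A" for x
  proof -
    have "x \<noteq> x0" using x insert.hyps by auto
    then obtain i where i: "x $ i \<noteq> x0 $ i" by (auto simp: vec_eq_iff)
    \<comment> \<open>The bound \<open>1\<close> on \<open>t * |\<Delta>|\<close> keeps \<open>sin (t * |\<Delta>|)\<close> positive.\<close>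
    define \<Delta> where "\<Delta> = real_of_int (x $ i - x0 $ i)"
    have \<Delta>: "\<bar>\<Delta>\<bar> > 0" using i by (simp add: \<Delta>_def)
    define t where "t = min (e / 4) (1 / \<bar>\<Delta>\<bar>)"
    have t: "t > 0" "t < e / 2" "t * \<bar>\<Delta>\<bar> \<le> 1"
      using e \<Delta> by (auto simp: t_def min_def field_simps)
    define s :: "real ^ 'n" where "s = t *\<^sub>R axis i 1"
    have ns: "norm s < e / 2" using t by (simp add: s_def norm_axis_1)
    have "\<forall>y\<in>A. c y * (wave s y - wave s x0) = 0"
    proof (rule insert.IH)
      show "open (ball k1 (e/2))" "ball k1 (e/2) \<noteq> {}" using e by auto
      fix k assume k: "k \<in> ball k1 (e/2)"
      have "dist k1 (k + s) \<le> dist k1 k + norm s"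
        by (metis dist_norm dist_triangle add_diff_cancel_left' norm_minus_commute)
      then have "k + s \<in> W" "k \<in> W" using k ns e by auto
      then have "(\<Sum>y\<in>insert x0 A. c y * wave (k + s) y) - wave s x0 * (\<Sum>y\<in>insert x0 A. c y * wave k y) = 0"
        using insert.prems(3) by simp
      then show "(\<Sum>y\<in>A. c y * (wave s y - wave s x0) * wave k y) = 0"
      proof -
        assume "(\<Sum>y\<in>insert x0 A. c y * wave (k + s) y) - wave s x0 * (\<Sum>y\<in>insert x0 A. c y * wave k y) = 0"
        moreover have "(\<Sum>y\<in>insert x0 A. c y * wave (k + s) y) - wave s x0 * (\<Sum>y\<in>insert x0 A. c y * wave k y)
           = (\<Sum>y\<in>insert x0 A. c y * (wave s y - wave s x0) * wave k y)"
          unfolding sum_distrib_left sum_subtractf[symmetric]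
          by (intro sum.cong refl) (simp add: wave_add_left left_diff_distrib right_diff_distrib)
        ultimately show ?thesis using insert.hyps by simp
      qed
    qed
    moreover have "wave s x \<noteq> wave s x0"
    proof
      assume "wave s x = wave s x0"
      then have "wave s (x - x0) = 1"
        by (simp only: wave_diff[of s x] wave_minus) (simp add: wave_mult_cnj)
      then have "cis (t * \<Delta>) = 1"
        by (simp add: wave_def s_def inner_axis' lattice_point_def \<Delta>_def)
      then have "sin (t * \<Delta>) = 0" using cis.sel(2)[of "t * \<Delta>"] by simp
      then have "sin (t * \<bar>\<Delta>\<bar>) = 0" by (auto simp: abs_if)
      moreover have "sin (t * \<bar>\<Delta>\<bar>) > 0"
        using t \<Delta> pi_gt3 by (intro sin_gt_zero) auto
      ultimately show False by simp
    qed
    ultimately show ?thesis using x by auto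
  qed
  then have "c x0 * wave k1 x0 = 0"
    using insert.prems(3)[OF \<open>k1 \<in> W\<close>] insert.hyps by simp
  then show ?case using zero by auto
qed simp

lemma ft_zero_imp_zero:
  assumes "finite {x. F x \<noteq> 0}" "open W" "W \<noteq> {}" "\<And>k. k \<in> W \<Longrightarrow> ft F k = 0"
  shows "F x = 0"
proof -
  have "\<forall>x\<in>{x. F x \<noteq> 0}. F x = 0"
    by (rule trig_poly_zero[OF assms(1-3)]) (fact assms(4)[unfolded ft_def])
  then show ?thesis by blast
qed

section \<open>Far-field asymptotics of translates and convolutions\<close>

definition at_lattice_infinity :: "(int ^ 'n) filter" where
  "at_lattice_infinity = filtercomap (\<lambda>x. lattice_norm x) at_top"

definition dir :: "int ^ 'n \<Rightarrow> real ^ 'n" where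
  "dir x = lattice_point x /\<^sub>R lattice_norm x"

lemma norm_at_lattice_infinity: "filterlim (\<lambda>x. lattice_norm x) at_top at_lattice_infinity"
  unfolding at_lattice_infinity_def by (rule filterlim_filtercomap)

lemma eventually_lattice_nonzero: "eventually (\<lambda>x. x \<noteq> 0) at_lattice_infinity"
proof -
  have "eventually (\<lambda>x :: int ^ 'n. lattice_norm x > 0) at_lattice_infinity"
    using norm_at_lattice_infinity unfolding filterlim_at_top_dense by blast
  then show ?thesis by eventually_elim auto
qed

lemma filterlim_lattice_shift: "filterlim (\<lambda>x. x - y) at_lattice_infinity at_lattice_infinity"
proof -
  have "filterlim (\<lambda>x. - lattice_norm y + lattice_norm x) at_top at_lattice_infinity"
    by (intro filterlim_tendsto_add_at_top[OF tendsto_const] norm_at_lattice_infinity)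
  then have "filterlim (\<lambda>x. lattice_norm (x - y)) at_top at_lattice_infinity"
  proof (rule filterlim_at_top_mono)
    show "eventually (\<lambda>x. - lattice_norm y + lattice_norm x \<le> lattice_norm (x - y)) at_lattice_infinity"
      by (intro always_eventually allI) (use norm_triangle_ineq2 in \<open>auto simp: lattice_point_diff\<close>)
  qed
  then have "filterlim (\<lambda>x. x - y) (filtercomap (\<lambda>x. lattice_norm x) at_top) at_lattice_infinity"
    by (simp add: filterlim_filtercomap_iff o_def)
  then show ?thesis by (simp only: at_lattice_infinity_def[symmetric])
qed

lemma norm_dir: "x \<noteq> 0 \<Longrightarrow> norm (dir x) = 1"
  by (simp add: dir_def)

lemma scale_dir: "lattice_norm x *\<^sub>R dir x = lattice_point x"
  by (cases "x = 0") (simp_all add: dir_def)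

lemma inverse_norm_tendsto_0: "((\<lambda>x. c / lattice_norm x) \<longlongrightarrow> 0) at_lattice_infinity"
  by (intro tendsto_divide_0[OF tendsto_const] filterlim_at_top_imp_at_infinity norm_at_lattice_infinity)

lemma dir_shift: "((\<lambda>x. dir (x - y) - dir x) \<longlongrightarrow> 0) at_lattice_infinity"
proof (rule Lim_null_comparison)
  show "((\<lambda>x. 2 * lattice_norm y / lattice_norm x) \<longlongrightarrow> 0) at_lattice_infinity"
    by (rule inverse_norm_tendsto_0)
  have "eventually (\<lambda>x. x - y \<noteq> 0) at_lattice_infinity"
    using eventually_lattice_nonzero filterlim_lattice_shift by (rule eventually_compose_filterlim)
  then show "eventually (\<lambda>x. norm (dir (x - y) - dir x) \<le> 2 * lattice_norm y / lattice_norm x) at_lattice_infinity"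
    using eventually_lattice_nonzero
  proof eventually_elim
    case (elim x)
    let ?u = "lattice_point (x - y)" and ?v = "lattice_point x"
    have pos: "norm ?u > 0" "norm ?v > 0"
      using elim by simp_all
    have uv: "norm (?u - ?v) = lattice_norm y" by (simp add: lattice_point_diff)
    have "dir (x - y) - dir x = (?u - ?v) /\<^sub>R norm ?v + (1 / norm ?u - 1 / norm ?v) *\<^sub>R ?u"
      by (simp add: dir_def algebra_simps inverse_eq_divide)
    then have "norm (dir (x - y) - dir x) \<le> norm ((?u - ?v) /\<^sub>R norm ?v) + norm ((1 / norm ?u - 1 / norm ?v) *\<^sub>R ?u)"
      by (simp only: norm_triangle_ineq)
    also have "norm ((?u - ?v) /\<^sub>R norm ?v) = lattice_norm y / norm ?v"
      using uv by (simp add: divide_inverse mult.commute)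
    also have "norm ((1 / norm ?u - 1 / norm ?v) *\<^sub>R ?u) = \<bar>norm ?v - norm ?u\<bar> / norm ?v"
    proof -
      have "1 / norm ?u - 1 / norm ?v = (norm ?v - norm ?u) / (norm ?u * norm ?v)"
        using pos by (simp add: field_simps)
      then show ?thesis using pos by (simp add: abs_divide)
    qed
    also have "\<dots> \<le> lattice_norm y / norm ?v"
      using norm_triangle_ineq3[of ?u ?v] uv by (intro divide_right_mono) auto
    finally show ?case by simp
  qed
qed

lemma uniformly_continuous_diff_tendsto:
  fixes g :: "'a::metric_space \<Rightarrow> 'b::real_normed_vector"
  assumes uc: "uniformly_continuous_on S g" and "eventually (\<lambda>x. u x \<in> S) F" "eventually (\<lambda>x. v x \<in> S) F"
    and lim: "((\<lambda>x. dist (u x) (v x)) \<longlongrightarrow> 0) F"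
  shows "((\<lambda>x. g (u x) - g (v x)) \<longlongrightarrow> 0) F"
proof (rule tendstoI)
  fix e :: real assume "e > 0"
  then obtain d where d: "d > 0" "\<And>x y. x \<in> S \<Longrightarrow> y \<in> S \<Longrightarrow> dist y x < d \<Longrightarrow> dist (g y) (g x) < e"
    using uc by (force simp: uniformly_continuous_on_def)
  have "eventually (\<lambda>x. dist (u x) (v x) < d) F" using lim d(1) by (rule order_tendstoD)
  with assms(2,3) show "eventually (\<lambda>x. dist (g (u x) - g (v x)) 0 < e) F"
  proof eventually_elim
    case (elim x)
    then show ?case using d(2)[of "v x" "u x"] by (simp add: dist_norm)
  qed
qed

lemma norm_cis_diff: "cmod (cis s - cis t) \<le> \<bar>s - t\<bar>"
proof (rule power2_le_imp_le)
  have "(cmod (cis s - cis t))\<^sup>2 = (cos s - cos t)\<^sup>2 + (sin s - sin t)\<^sup>2"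
    by (simp add: cmod_power2)
  also have "\<dots> = 2 - 2 * cos (s - t)"
    using sin_cos_squared_add[of s] sin_cos_squared_add[of t]
    by (simp add: cos_diff power2_diff algebra_simps)
  also have "\<dots> = 4 * (sin ((s - t) / 2))\<^sup>2"
  proof -
    have "2 * ((s - t) / 2) = s - t" by simp
    from cos_double_sin[of "(s - t) / 2", unfolded this] show ?thesis by simp
  qed
  also have "\<dots> \<le> 4 * ((s - t) / 2)\<^sup>2"
    using abs_sin_x_le_abs_x[of "(s - t) / 2"] unfolding abs_le_square_iff
    by (intro mult_left_mono) simp_all
  finally show "(cmod (cis s - cis t))\<^sup>2 \<le> \<bar>s - t\<bar>\<^sup>2" by (simp add: power_divide)
qed simp

text \<open>Only the phase needs care. With \<open>z = x - y\<close> and \<open>\<Delta> = K (dir z) - K (dir x)\<close>, the phases at \<open>z\<close> computed from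
the two directions differ by \<open>\<Delta> \<bullet> z\<close>, a product of something small with something large. The support
property at \<open>x\<close> and at \<open>z\<close> gives opposite signs for \<open>\<Delta> \<bullet> x\<close> and \<open>\<Delta> \<bullet> z\<close>, and these two differ by \<open>\<Delta> \<bullet> y\<close>, so
\<open>|\<Delta> \<bullet> z| \<le> |\<Delta>| |y|\<close> tends to \<open>0\<close>.\<close>

lemma shifted_asymptotics:
  fixes \<psi> :: "int ^ 'n \<Rightarrow> complex" and K :: "real ^ 'n \<Rightarrow> real ^ 'n" and a :: "real ^ 'n \<Rightarrow> complex"
  assumes K: "continuous_on (sphere 0 1) K" and a: "continuous_on (sphere 0 1) a" and \<sigma>: "\<bar>\<sigma>\<bar> = 1"
    and supp: "\<And>\<omega> \<omega>'. norm \<omega> = 1 \<Longrightarrow> norm \<omega>' = 1 \<Longrightarrow> 0 \<le> \<sigma> * ((K \<omega>' - K \<omega>) \<bullet> \<omega>)"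
    and lim: "((\<lambda>x. of_real (lattice_norm x powr p) * \<psi> x - wave (K (dir x)) (- x) * a (dir x)) \<longlongrightarrow> 0) at_lattice_infinity"
  shows "((\<lambda>x. of_real (lattice_norm x powr p) * \<psi> (x - y)
           - wave (K (dir x)) (- x) * wave (K (dir x)) y * a (dir x)) \<longlongrightarrow> 0) at_lattice_infinity"
proof -
  let ?L = "at_lattice_infinity :: (int ^ 'n) filter"
  let ?N = "\<lambda>x :: int ^ 'n. lattice_norm x"
  let ?W = "\<lambda>x. wave (K (dir x)) (- x) * a (dir x)"
  let ?W' = "\<lambda>x. wave (K (dir x)) (- x) * wave (K (dir x)) y * a (dir x)"
  define \<rho> where "\<rho> x = (?N x / ?N (x - y)) powr p" for x
  have nz: "eventually (\<lambda>x. x \<noteq> 0) ?L" by (rule eventually_lattice_nonzero)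
  have nzy: "eventually (\<lambda>x. x - y \<noteq> 0) ?L"
    using eventually_lattice_nonzero filterlim_lattice_shift by (rule eventually_compose_filterlim)
  have S1: "eventually (\<lambda>x. dir x \<in> sphere 0 1) ?L"
    using nz by eventually_elim (simp add: norm_dir)
  have S2: "eventually (\<lambda>x. dir (x - y) \<in> sphere 0 1) ?L"
    using nzy by eventually_elim (simp add: norm_dir)
  have d: "((\<lambda>x. dist (dir (x - y)) (dir x)) \<longlongrightarrow> 0) ?L"
    using tendsto_norm[OF dir_shift[of y]] by (simp add: dist_norm)
  have dK: "((\<lambda>x. K (dir (x - y)) - K (dir x)) \<longlongrightarrow> 0) ?L"
    by (rule uniformly_continuous_diff_tendsto[OF compact_uniformly_continuous[OF K] S2 S1 d]) simp
  have da: "((\<lambda>x. a (dir (x - y)) - a (dir x)) \<longlongrightarrow> 0) ?L"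
    by (rule uniformly_continuous_diff_tendsto[OF compact_uniformly_continuous[OF a] S2 S1 d]) simp
  obtain M where M: "\<And>\<omega>. norm \<omega> = 1 \<Longrightarrow> cmod (a \<omega>) \<le> M"
  proof -
    have "bounded (a ` sphere 0 1)"
      by (intro compact_imp_bounded compact_continuous_image a compact_sphere)
    then obtain M where "\<And>z. z \<in> a ` sphere 0 1 \<Longrightarrow> cmod z \<le> M" by (auto simp: bounded_iff)
    then have "\<And>\<omega>. norm \<omega> = 1 \<Longrightarrow> cmod (a \<omega>) \<le> M" by simp
    then show ?thesis by (rule that)
  qed
  have "((\<lambda>x. ?N x / ?N (x - y)) \<longlongrightarrow> 1) ?L"
  proof -
    have "((\<lambda>x. (?N x - ?N (x - y)) / ?N (x - y)) \<longlongrightarrow> 0) ?L"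
    proof (rule Lim_null_comparison)
      show "((\<lambda>x. ?N y / ?N (x - y)) \<longlongrightarrow> 0) ?L"
        by (rule filterlim_compose[OF inverse_norm_tendsto_0 filterlim_lattice_shift])
      show "eventually (\<lambda>x. norm ((?N x - ?N (x - y)) / ?N (x - y)) \<le> ?N y / ?N (x - y)) ?L"
      proof (intro always_eventually allI)
        fix x
        have "\<bar>?N x - ?N (x - y)\<bar> \<le> ?N y"
          using norm_triangle_ineq3[of "lattice_point x" "lattice_point (x - y)"] by (simp add: lattice_point_diff)
        then show "norm ((?N x - ?N (x - y)) / ?N (x - y)) \<le> ?N y / ?N (x - y)"
          by (simp add: divide_right_mono)
      qed
    qed
    from tendsto_add[OF this tendsto_const[of 1]]
    have "((\<lambda>x. (?N x - ?N (x - y)) / ?N (x - y) + 1) \<longlongrightarrow> 1) ?L" by simp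
    then show ?thesis
    proof (rule Lim_transform_eventually)
      show "eventually (\<lambda>x. (?N x - ?N (x - y)) / ?N (x - y) + 1 = ?N x / ?N (x - y)) ?L"
        using nzy
      proof eventually_elim
        case (elim x)
        then have "?N (x - y) \<noteq> 0" by simp
        then show ?case by (simp add: field_simps)
      qed
    qed
  qed
  from tendsto_powr[OF this tendsto_const[of p]] have \<rho>: "(\<rho> \<longlongrightarrow> 1) ?L" by (simp add: \<rho>_def[abs_def])
  have "((\<lambda>x. of_real (?N (x - y) powr p) * \<psi> (x - y) - ?W (x - y)) \<longlongrightarrow> 0) ?L"
    by (rule filterlim_compose[OF lim filterlim_lattice_shift])
  from tendsto_mult[OF tendsto_of_real[OF \<rho>] this]
  have 1: "((\<lambda>x. of_real (\<rho> x) * (of_real (?N (x - y) powr p) * \<psi> (x - y) - ?W (x - y))) \<longlongrightarrow> 0) ?L" by simp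
  have 2: "((\<lambda>x. of_real (\<rho> x - 1) * ?W (x - y)) \<longlongrightarrow> 0) ?L"
  proof (rule Lim_null_comparison)
    from tendsto_mult[OF tendsto_norm[OF tendsto_diff[OF \<rho> tendsto_const[of 1]]] tendsto_const[of M]]
    show "((\<lambda>x. norm (\<rho> x - 1) * M) \<longlongrightarrow> 0) ?L" by simp
    show "eventually (\<lambda>x. norm (of_real (\<rho> x - 1) * ?W (x - y)) \<le> norm (\<rho> x - 1) * M) ?L"
      using nzy
    proof eventually_elim
      case (elim x)
      then have "cmod (a (dir (x - y))) \<le> M" by (intro M norm_dir)
      then show ?case unfolding norm_mult norm_of_real norm_wave by (intro mult_mono) auto
    qed
  qed
  have 3: "((\<lambda>x. wave (K (dir (x - y))) (- (x - y)) * (a (dir (x - y)) - a (dir x))) \<longlongrightarrow> 0) ?L"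
    by (rule Lim_null_comparison[OF _ tendsto_norm_zero[OF da]]) (simp add: norm_mult)
  have 4: "((\<lambda>x. (wave (K (dir (x - y))) (- (x - y)) - wave (K (dir x)) (- (x - y))) * a (dir x)) \<longlongrightarrow> 0) ?L"
  proof (rule Lim_null_comparison)
    from tendsto_mult[OF tendsto_norm_zero[OF dK] tendsto_const[of "?N y * M"]]
    show "((\<lambda>x. norm (K (dir (x - y)) - K (dir x)) * (?N y * M)) \<longlongrightarrow> 0) ?L" by simp
    show "eventually (\<lambda>x. norm ((wave (K (dir (x - y))) (- (x - y)) - wave (K (dir x)) (- (x - y))) * a (dir x))
        \<le> norm (K (dir (x - y)) - K (dir x)) * (?N y * M)) ?L"
      using nz nzy
    proof eventually_elim
      case (elim x)
      define D where "D = K (dir (x - y)) - K (dir x)"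
      define z where "z = lattice_point (x - y)"
      have nx: "norm (dir x) = 1" "norm (dir (x - y)) = 1" using elim by (auto intro: norm_dir)
      have "0 \<le> ?N x * (\<sigma> * (D \<bullet> dir x))"
        using supp[OF nx] by (simp add: D_def)
      also have "\<dots> = \<sigma> * (D \<bullet> lattice_point x)"
        by (subst (2) scale_dir[symmetric]) simp
      finally have up: "0 \<le> \<sigma> * (D \<bullet> lattice_point x)" .
      have "0 \<le> ?N (x - y) * (\<sigma> * ((- D) \<bullet> dir (x - y)))"
        using supp[OF nx(2) nx(1)] by (simp add: D_def inner_diff_left)
      also have "\<dots> = - (\<sigma> * (D \<bullet> z))"
        unfolding z_def by (subst (2) scale_dir[symmetric]) simp
      finally have down: "\<sigma> * (D \<bullet> z) \<le> 0" by simp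
      have "D \<bullet> z = D \<bullet> lattice_point x - D \<bullet> lattice_point y"
        by (simp add: z_def lattice_point_diff inner_diff_right)
      then have "\<sigma> * (D \<bullet> z) = \<sigma> * (D \<bullet> lattice_point x) - \<sigma> * (D \<bullet> lattice_point y)"
        by (simp add: right_diff_distrib)
      moreover have "\<bar>\<sigma> * (D \<bullet> lattice_point y)\<bar> \<le> norm D * ?N y"
        using \<sigma> Cauchy_Schwarz_ineq2[of D "lattice_point y"] by (simp add: abs_mult)
      ultimately have "\<bar>\<sigma> * (D \<bullet> z)\<bar> \<le> norm D * ?N y" using up down by linarith
      then have Dz: "\<bar>D \<bullet> z\<bar> \<le> norm D * ?N y" using \<sigma> by (simp add: abs_mult)
      have "cmod (wave (K (dir (x - y))) (- (x - y)) - wave (K (dir x)) (- (x - y)))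
          \<le> \<bar>K (dir (x - y)) \<bullet> lattice_point (- (x - y)) - K (dir x) \<bullet> lattice_point (- (x - y))\<bar>"
        unfolding wave_def by (rule norm_cis_diff)
      also have "\<dots> = \<bar>D \<bullet> z\<bar>"
        unfolding lattice_point_minus z_def[symmetric] D_def by (simp add: inner_diff_left)
      also note Dz
      finally show ?case
        unfolding norm_mult mult.assoc[symmetric] D_def using M[OF nx(1)]
        by (intro mult_mono) auto
    qed
  qed
  let ?S = "\<lambda>x. of_real (\<rho> x) * (of_real (?N (x - y) powr p) * \<psi> (x - y) - ?W (x - y))
      + of_real (\<rho> x - 1) * ?W (x - y)
      + wave (K (dir (x - y))) (- (x - y)) * (a (dir (x - y)) - a (dir x))
      + (wave (K (dir (x - y))) (- (x - y)) - wave (K (dir x)) (- (x - y))) * a (dir x)"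
  have "(?S \<longlongrightarrow> 0) ?L"
    using tendsto_add[OF tendsto_add[OF tendsto_add[OF 1 2] 3] 4] by (simp only: add_0_right)
  then show ?thesis
  proof (rule Lim_transform_eventually)
    show "eventually (\<lambda>x. ?S x = of_real (?N x powr p) * \<psi> (x - y) - ?W' x) ?L"
      using nzy
    proof eventually_elim
      case (elim x)
      then have pos: "?N (x - y) > 0" by simp
      then have "\<rho> x * ?N (x - y) powr p = ?N x powr p"
        by (simp add: \<rho>_def powr_divide)
      then have r: "of_real (?N x powr p) = (of_real (\<rho> x) * of_real (?N (x - y) powr p) :: complex)"
        by (simp only: of_real_mult[symmetric])
      have w: "wave (K (dir x)) (- (x - y)) = wave (K (dir x)) (- x) * wave (K (dir x)) y"
        using wave_add[of "K (dir x)" "- x" y] by simp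
      have alg: "A * (B * P - w1 * a1) + (A - 1) * (w1 * a1) + w1 * (a1 - a2) + (w1 - w2) * a2 = A * B * P - w2 * a2"
        for A B P w1 a1 w2 a2 :: complex by (simp add: algebra_simps)
      show ?case unfolding r w[symmetric] of_real_diff of_real_1 by (rule alg)
    qed
  qed
qed

lemma conv_asymptotics:
  fixes \<psi> :: "int ^ 'n \<Rightarrow> complex"
  assumes h: "finite {x. h x \<noteq> 0}"
    and shift: "\<And>y. ((\<lambda>x. of_real (lattice_norm x powr p) * \<psi> (x - y)
           - wave (K (dir x)) (- x) * wave (K (dir x)) y * a (dir x)) \<longlongrightarrow> 0) at_lattice_infinity"
  shows "((\<lambda>x. of_real (lattice_norm x powr p) * conv h \<psi> x
           - wave (K (dir x)) (- x) * (ft h (K (dir x)) * a (dir x))) \<longlongrightarrow> 0) at_lattice_infinity"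
proof -
  have "((\<lambda>x. \<Sum>y | h y \<noteq> 0. h y * (of_real (lattice_norm x powr p) * \<psi> (x - y)
           - wave (K (dir x)) (- x) * wave (K (dir x)) y * a (dir x))) \<longlongrightarrow> (\<Sum>y | h y \<noteq> 0. h y * 0)) at_lattice_infinity"
    by (intro tendsto_intros shift)
  also have "(\<lambda>x. \<Sum>y | h y \<noteq> 0. h y * (of_real (lattice_norm x powr p) * \<psi> (x - y)
           - wave (K (dir x)) (- x) * wave (K (dir x)) y * a (dir x)))
      = (\<lambda>x. of_real (lattice_norm x powr p) * conv h \<psi> x
           - wave (K (dir x)) (- x) * (ft h (K (dir x)) * a (dir x)))"
    unfolding conv_def ft_def sum_distrib_left sum_distrib_right sum_subtractf[symmetric]
    by (intro ext sum.cong refl) (simp add: right_diff_distrib mult_ac)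
  finally show ?thesis by simp
qed

section \<open>Comparison of amplitudes\<close>

text \<open>The properties of a continuous lift of \<open>kappa\<close> on which the asymptotics depend.\<close>

definition phase_function :: "real \<Rightarrow> (real ^ 'n \<Rightarrow> real ^ 'n) \<Rightarrow> bool" where
  "phase_function lam K \<longleftrightarrow> continuous_on (sphere 0 1) K \<and>
     (\<exists>\<sigma>. \<bar>\<sigma>\<bar> = 1 \<and> (\<forall>\<omega> \<omega>'. norm \<omega> = 1 \<longrightarrow> norm \<omega>' = 1 \<longrightarrow> 0 \<le> \<sigma> * ((K \<omega>' - K \<omega>) \<bullet> \<omega>))) \<and>
     (\<forall>\<omega> x. norm \<omega> = 1 \<longrightarrow> wave (kappa \<omega> lam) x = wave (K \<omega>) x)"

abbreviation decay_exponent :: "'n::finite itself \<Rightarrow> real" where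
  "decay_exponent _ \<equiv> (real CARD('n) - 1) / 2"

abbreviation far_field :: "(real ^ 'n \<Rightarrow> real ^ 'n) \<Rightarrow> (real ^ 'n \<Rightarrow> complex) \<Rightarrow> (int ^ 'n \<Rightarrow> complex) \<Rightarrow> bool" where
  "far_field K a \<psi> \<equiv> ((\<lambda>x. of_real (lattice_norm x powr decay_exponent TYPE('n)) * \<psi> x
     - wave (K (dir x)) (- x) * a (dir x)) \<longlongrightarrow> 0) at_lattice_infinity"

lemma far_field_expansion:
  fixes F :: "int ^ 'n \<Rightarrow> complex"
  assumes amp: "is_far_field_amplitude F a" and lam: "lam \<in> Lambda CARD('n)" and F: "finite {x. F x \<noteq> 0}"
    and K: "phase_function lam K"
  obtains \<psi> where "outgoing F lam \<psi>"
    "\<And>h. finite {x. h x \<noteq> 0} \<Longrightarrow>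
      far_field K (\<lambda>\<omega>. ft h (K \<omega>) * a \<omega> lam) (conv h \<psi>)"
proof -
  let ?p = "decay_exponent TYPE('n)"
  let ?N = "\<lambda>x :: int ^ 'n. lattice_norm x"
  define near where "near \<psi> C R \<longleftrightarrow> (\<forall>x. x \<noteq> 0 \<longrightarrow> R \<le> ?N x \<longrightarrow>
      cmod (\<psi> x - exp (- \<i> * of_real (mu (dir x) lam * ?N x)) / of_real (?N x powr ?p) * a (dir x) lam)
        \<le> C * ?N x powr (- (real CARD('n) + 1) / 2))" for \<psi> C R
  have far: "continuous_on (sphere 0 1) (\<lambda>\<omega>. a \<omega> lam) \<and> (\<exists>\<psi>. is_psi_minus F lam \<psi> \<and> (\<exists>C R. near \<psi> C R))"
    using bspec[OF amp[unfolded is_far_field_amplitude_def Let_def] lam] unfolding near_def dir_def .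
  then obtain \<psi> C R where psi: "is_psi_minus F lam \<psi>" and near: "near \<psi> C R" by blast
  have a: "continuous_on (sphere 0 1) (\<lambda>\<omega>. a \<omega> lam)" using far by blast
  have bound: "cmod (\<psi> x - exp (- \<i> * of_real (mu (dir x) lam * ?N x)) / of_real (?N x powr ?p) * a (dir x) lam)
        \<le> C * ?N x powr (- (real CARD('n) + 1) / 2)" if "x \<noteq> 0" "R \<le> ?N x" for x
    using near[unfolded near_def, rule_format, OF that] .
  obtain \<sigma> where cK: "continuous_on (sphere 0 1) K" and \<sigma>: "\<bar>\<sigma>\<bar> = 1"
    and supp: "\<And>\<omega> \<omega>'. norm \<omega> = 1 \<Longrightarrow> norm \<omega>' = 1 \<Longrightarrow> 0 \<le> \<sigma> * ((K \<omega>' - K \<omega>) \<bullet> \<omega>)"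
    and wK: "\<And>\<omega> x. norm \<omega> = 1 \<Longrightarrow> wave (kappa \<omega> lam) x = wave (K \<omega>) x"
    using K unfolding phase_function_def by blast
  have lim: "((\<lambda>x. of_real (?N x powr ?p) * \<psi> x - wave (K (dir x)) (- x) * a (dir x) lam) \<longlongrightarrow> 0) at_lattice_infinity"
  proof (rule Lim_null_comparison[OF _ inverse_norm_tendsto_0[of C]])
    have "eventually (\<lambda>x. R \<le> ?N x) at_lattice_infinity"
      using norm_at_lattice_infinity unfolding filterlim_at_top by blast
    then show "eventually (\<lambda>x. norm (of_real (?N x powr ?p) * \<psi> x - wave (K (dir x)) (- x) * a (dir x) lam) \<le> C / ?N x) at_lattice_infinity"
      using eventually_lattice_nonzero
    proof eventually_elim
      case (elim x)
      have pos: "?N x > 0" using elim by simp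
      have "exp (- \<i> * of_real (mu (dir x) lam * ?N x)) = wave (kappa (dir x) lam) (- x)"
      proof -
        have "kappa (dir x) lam \<bullet> lattice_point x = mu (dir x) lam * ?N x"
          unfolding mu_def by (subst scale_dir[symmetric]) (simp only: inner_scaleR_right mult.commute)
        then show ?thesis
          by (simp add: wave_def lattice_point_minus cis_conv_exp)
      qed
      also have "\<dots> = wave (K (dir x)) (- x)" using elim by (intro wK norm_dir)
      finally have E: "exp (- \<i> * of_real (mu (dir x) lam * ?N x)) = wave (K (dir x)) (- x)" .
      have "of_real (?N x powr ?p) * \<psi> x - wave (K (dir x)) (- x) * a (dir x) lam
          = of_real (?N x powr ?p) * (\<psi> x - wave (K (dir x)) (- x) / of_real (?N x powr ?p) * a (dir x) lam)"
        using pos by (simp add: right_diff_distrib)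
      then have "norm (of_real (?N x powr ?p) * \<psi> x - wave (K (dir x)) (- x) * a (dir x) lam)
          = ?N x powr ?p * cmod (\<psi> x - wave (K (dir x)) (- x) / of_real (?N x powr ?p) * a (dir x) lam)"
        by (simp only: norm_mult norm_of_real) simp
      also have "\<dots> \<le> ?N x powr ?p * (C * ?N x powr (- (real CARD('n) + 1) / 2))"
        using bound[OF elim(2) elim(1)] unfolding E by (intro mult_left_mono) auto
      also have "\<dots> = C * (?N x powr ?p * ?N x powr (- (real CARD('n) + 1) / 2))" by simp
      also have "?N x powr ?p * ?N x powr (- (real CARD('n) + 1) / 2) = ?N x powr (- 1)"
      proof -
        have "?p + (- (real CARD('n) + 1) / 2) = - 1" by (simp add: field_simps)
        then show ?thesis unfolding powr_add[symmetric] by simp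
      qed
      also have "\<dots> = 1 / ?N x" using pos by (simp add: powr_minus_divide)
      finally show ?case by simp
    qed
  qed
  show ?thesis
  proof (rule that)
    show "outgoing F lam \<psi>" by (rule is_psi_minus_outgoing[OF F psi])
    show "far_field K (\<lambda>\<omega>. ft h (K \<omega>) * a \<omega> lam) (conv h \<psi>)"
      if "finite {x. h x \<noteq> 0}" for h
      by (rule conv_asymptotics[OF that shifted_asymptotics[OF cK a \<sigma> supp lim]])
  qed
qed

lemma phase_function_exists:
  assumes lam: "lam \<in> Lambda CARD('n)"
  obtains K :: "real ^ 'n \<Rightarrow> real ^ 'n" where "phase_function lam K"
proof -
  obtain K :: "real ^ 'n \<Rightarrow> real ^ 'n" and \<sigma> :: real where
    "continuous_on (sphere 0 1) K" "\<bar>\<sigma>\<bar> = 1"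
    "\<And>\<omega> \<omega>'. norm \<omega> = 1 \<Longrightarrow> norm \<omega>' = 1 \<Longrightarrow> 0 \<le> \<sigma> * ((K \<omega>' - K \<omega>) \<bullet> \<omega>)"
    "\<And>\<omega> x. norm \<omega> = 1 \<Longrightarrow> wave (kappa \<omega> lam) x = wave (K \<omega>) x"
    using kappa_properties[OF lam] by metis
  then have "phase_function lam K" unfolding phase_function_def by blast
  then show ?thesis by (rule that)
qed

lemma ft_phase_function:
  "phase_function lam K \<Longrightarrow> norm \<omega> = 1 \<Longrightarrow> ft F (K \<omega>) = ft F (kappa \<omega> lam)"
  by (simp add: phase_function_def ft_def)

lemma directions_dense:
  fixes \<omega> :: "real ^ 'n"
  assumes \<omega>: "norm \<omega> = 1"
  obtains X :: "nat \<Rightarrow> int ^ 'n" where "filterlim X at_lattice_infinity sequentially" "(\<lambda>n. dir (X n)) \<longlonglongrightarrow> \<omega>"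
proof -
  define X :: "nat \<Rightarrow> int ^ 'n" where "X n = (\<chi> i. \<lfloor>real n * \<omega> $ i\<rfloor>)" for n
  have close: "norm (lattice_point (X n) - real n *\<^sub>R \<omega>) \<le> real CARD('n)" for n
  proof -
    have "norm (lattice_point (X n) - real n *\<^sub>R \<omega>) \<le> (\<Sum>i\<in>UNIV. \<bar>(lattice_point (X n) - real n *\<^sub>R \<omega>) $ i\<bar>)"
      by (rule norm_le_l1_cart)
    also have "\<dots> \<le> (\<Sum>i\<in>(UNIV :: 'n set). 1)"
    proof (rule sum_mono)
      fix i
      show "\<bar>(lattice_point (X n) - real n *\<^sub>R \<omega>) $ i\<bar> \<le> 1"
        unfolding X_def lattice_point_def vector_minus_component vector_scaleR_component vec_lambda_beta real_scaleR_def
        by linarith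
    qed
    finally show ?thesis by simp
  qed
  have conv: "(\<lambda>n. lattice_point (X n) /\<^sub>R real n) \<longlonglongrightarrow> \<omega>"
  proof (rule LIM_zero_cancel, rule Lim_null_comparison)
    show "(\<lambda>n. real CARD('n) / real n) \<longlonglongrightarrow> 0" by (rule lim_const_over_n)
    show "eventually (\<lambda>n. norm (lattice_point (X n) /\<^sub>R real n - \<omega>) \<le> real CARD('n) / real n) sequentially"
      using eventually_gt_at_top[of 0]
    proof eventually_elim
      case (elim n)
      then have "lattice_point (X n) /\<^sub>R real n - \<omega> = (lattice_point (X n) - real n *\<^sub>R \<omega>) /\<^sub>R real n"
        by (simp add: scaleR_diff_right)
      then have "norm (lattice_point (X n) /\<^sub>R real n - \<omega>) = norm (lattice_point (X n) - real n *\<^sub>R \<omega>) / real n"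
        by (simp add: divide_inverse mult.commute)
      also have "\<dots> \<le> real CARD('n) / real n" using close by (intro divide_right_mono) auto
      finally show ?case .
    qed
  qed
  have "(\<lambda>n. norm (lattice_point (X n) /\<^sub>R real n)) \<longlonglongrightarrow> 1" using tendsto_norm[OF conv] \<omega> by simp
  from tendsto_divide[OF tendsto_const[of 1] this]
  have "(\<lambda>n. inverse (norm (lattice_point (X n) /\<^sub>R real n))) \<longlonglongrightarrow> 1" by (simp add: inverse_eq_divide)
  from tendsto_scaleR[OF this conv]
  have "(\<lambda>n. inverse (norm (lattice_point (X n) /\<^sub>R real n)) *\<^sub>R (lattice_point (X n) /\<^sub>R real n)) \<longlonglongrightarrow> \<omega>" by simp
  then have dirlim: "(\<lambda>n. dir (X n)) \<longlonglongrightarrow> \<omega>"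
  proof (rule Lim_transform_eventually)
    show "eventually (\<lambda>n. inverse (norm (lattice_point (X n) /\<^sub>R real n)) *\<^sub>R (lattice_point (X n) /\<^sub>R real n) = dir (X n)) sequentially"
      using eventually_gt_at_top[of 0] by eventually_elim (simp add: dir_def)
  qed
  have "filterlim (\<lambda>n. - real CARD('n) + real n) at_top sequentially"
    by (intro filterlim_tendsto_add_at_top[OF tendsto_const] filterlim_real_sequentially)
  then have "filterlim (\<lambda>n. lattice_norm (X n)) at_top sequentially"
  proof (rule filterlim_at_top_mono, intro always_eventually allI)
    fix n
    have "norm (real n *\<^sub>R \<omega>) \<le> lattice_norm (X n) + norm (lattice_point (X n) - real n *\<^sub>R \<omega>)"
      using norm_triangle_ineq4[of "lattice_point (X n)" "lattice_point (X n) - real n *\<^sub>R \<omega>"] by simp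
    then show "- real CARD('n) + real n \<le> lattice_norm (X n)" using close[of n] \<omega> by simp
  qed
  then have "filterlim X at_lattice_infinity sequentially"
    unfolding at_lattice_infinity_def by (simp add: filterlim_filtercomap_iff o_def)
  then show ?thesis using dirlim by (rule that)
qed

text \<open>Both sides are, up to the common phase, the amplitude of the outgoing solution with source \<open>F1 * F2\<close>. The
asymptotics determine it in the directions of lattice points only; density of these and continuity do
the rest.\<close>

lemma amplitude_ratio:
  fixes F1 F2 :: "int ^ 'n \<Rightarrow> complex"
  assumes a1: "is_far_field_amplitude F1 a1" and a2: "is_far_field_amplitude F2 a2"
    and lam: "lam \<in> Lambda CARD('n)" and F1: "finite {x. F1 x \<noteq> 0}" and F2: "finite {x. F2 x \<noteq> 0}"
    and \<omega>: "norm \<omega> = 1"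
  shows "ft F2 (kappa \<omega> lam) * a1 \<omega> lam = ft F1 (kappa \<omega> lam) * a2 \<omega> lam"
proof -
  obtain K :: "real ^ 'n \<Rightarrow> real ^ 'n" where K: "phase_function lam K"
    using phase_function_exists[OF lam] .
  obtain \<psi>1 where out1: "outgoing F1 lam \<psi>1" and as1: "\<And>h. finite {x. h x \<noteq> 0} \<Longrightarrow>
      far_field K (\<lambda>\<omega>. ft h (K \<omega>) * a1 \<omega> lam) (conv h \<psi>1)"
    using far_field_expansion[OF a1 lam F1 K] by blast
  obtain \<psi>2 where out2: "outgoing F2 lam \<psi>2" and as2: "\<And>h. finite {x. h x \<noteq> 0} \<Longrightarrow>
      far_field K (\<lambda>\<omega>. ft h (K \<omega>) * a2 \<omega> lam) (conv h \<psi>2)"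
    using far_field_expansion[OF a2 lam F2 K] by blast
  have same: "conv F1 \<psi>2 = conv F2 \<psi>1"
    using outgoing_conv[OF F2 F1 out1] outgoing_conv[OF F1 F2 out2] conv_commute[OF F1 F2]
    by (intro outgoing_unique[where F = "conv F1 F2" and lam = lam]) simp_all
  define E where "E \<omega> = ft F2 (K \<omega>) * a1 \<omega> lam - ft F1 (K \<omega>) * a2 \<omega> lam" for \<omega>
  have cont: "continuous_on (sphere 0 1) E"
    using K a1 a2 lam unfolding E_def phase_function_def is_far_field_amplitude_def
    by (intro continuous_intros) auto
  have "((\<lambda>x. wave (K (dir x)) (- x) * E (dir x)) \<longlongrightarrow> 0) at_lattice_infinity"
  proof -
    have "(\<lambda>x. wave (K (dir x)) (- x) * E (dir x)) = (\<lambda>x.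
        (of_real (lattice_norm x powr decay_exponent TYPE('n)) * conv F1 \<psi>2 x
           - wave (K (dir x)) (- x) * (ft F1 (K (dir x)) * a2 (dir x) lam))
      - (of_real (lattice_norm x powr decay_exponent TYPE('n)) * conv F2 \<psi>1 x
           - wave (K (dir x)) (- x) * (ft F2 (K (dir x)) * a1 (dir x) lam)))"
      unfolding same E_def by (simp add: right_diff_distrib)
    then show ?thesis using tendsto_diff[OF as2[OF F1] as1[OF F2]] by (simp only: diff_0_right)
  qed
  from tendsto_norm[OF this] have E0: "((\<lambda>x. norm (E (dir x))) \<longlongrightarrow> 0) at_lattice_infinity"
    by (simp add: norm_mult)
  obtain X :: "nat \<Rightarrow> int ^ 'n" where X: "filterlim X at_lattice_infinity sequentially" "(\<lambda>n. dir (X n)) \<longlonglongrightarrow> \<omega>"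
    using directions_dense[OF \<omega>] .
  have "eventually (\<lambda>n. X n \<noteq> 0) sequentially"
    using eventually_lattice_nonzero X(1) by (rule eventually_compose_filterlim)
  then have "eventually (\<lambda>n. dir (X n) \<in> sphere 0 1) sequentially"
    by eventually_elim (simp add: norm_dir)
  then have "(\<lambda>n. E (dir (X n))) \<longlonglongrightarrow> E \<omega>"
    using \<omega> by (intro continuous_on_tendsto_compose[OF cont X(2)]) auto
  moreover have "(\<lambda>n. E (dir (X n))) \<longlonglongrightarrow> 0"
    using filterlim_compose[OF E0 X(1)] by (simp add: tendsto_norm_zero_iff)
  ultimately have "E \<omega> = 0" by (rule LIMSEQ_unique)
  then show ?thesis by (simp add: E_def ft_phase_function[OF K \<omega>])
qed

section \<open>Amplitudes do not vanish on open sets\<close>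

definition trig_poly :: "(real ^ 'n \<Rightarrow> complex) \<Rightarrow> bool" where
  "trig_poly g \<longleftrightarrow> (\<exists>h. finite {x. h x \<noteq> 0} \<and> (\<forall>k. ft h k = g k))"

lemma trig_poly_monomial: "trig_poly (\<lambda>k. c * wave k y)"
proof -
  let ?h = "\<lambda>x. if x = y then c else 0"
  have "finite {x. ?h x \<noteq> 0}" by (rule finite_subset[of _ "{y}"]) auto
  moreover have "ft ?h k = c * wave k y" for k
    by (subst ft_superset[of "{y}"]) (auto split: if_splits)
  ultimately show ?thesis unfolding trig_poly_def by (intro exI[of _ ?h] conjI allI)
qed

lemma ft_add:
  assumes "finite {x. h x \<noteq> 0}" "finite {x. g x \<noteq> 0}"
  shows "ft (\<lambda>x. h x + c * g x) k = ft h k + c * ft g k" "finite {x. h x + c * g x \<noteq> 0}"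
proof -
  let ?A = "{x. h x \<noteq> 0} \<union> {x. g x \<noteq> 0}"
  have A: "finite ?A" using assms by simp
  show "finite {x. h x + c * g x \<noteq> 0}" by (rule finite_subset[OF _ A]) auto
  have "ft (\<lambda>x. h x + c * g x) k = (\<Sum>x\<in>?A. (h x + c * g x) * wave k x)"
    by (rule ft_superset[OF A]) auto
  also have "\<dots> = (\<Sum>x\<in>?A. h x * wave k x) + c * (\<Sum>x\<in>?A. g x * wave k x)"
    by (simp add: sum.distrib sum_distrib_left distrib_right mult.assoc)
  also have "(\<Sum>x\<in>?A. h x * wave k x) = ft h k" by (rule ft_superset[OF A, symmetric]) auto
  also have "(\<Sum>x\<in>?A. g x * wave k x) = ft g k" by (rule ft_superset[OF A, symmetric]) auto
  finally show "ft (\<lambda>x. h x + c * g x) k = ft h k + c * ft g k" .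
qed

lemma trig_poly_add:
  assumes "trig_poly g1" "trig_poly g2"
  shows "trig_poly (\<lambda>k. g1 k + g2 k)"
proof -
  obtain h1 h2 where h: "finite {x. h1 x \<noteq> 0}" "\<And>k. ft h1 k = g1 k" "finite {x. h2 x \<noteq> 0}" "\<And>k. ft h2 k = g2 k"
    using assms unfolding trig_poly_def by blast
  have "ft (\<lambda>x. h1 x + 1 * h2 x) k = g1 k + g2 k" for k
    using ft_add(1)[OF h(1,3), of 1 k] h(2,4) by simp
  then show ?thesis unfolding trig_poly_def using ft_add(2)[OF h(1,3), of 1]
    by (intro exI[of _ "\<lambda>x. h1 x + 1 * h2 x"] conjI allI)
qed

lemma trig_poly_mult:
  assumes "trig_poly g1" "trig_poly g2"
  shows "trig_poly (\<lambda>k. g1 k * g2 k)"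
proof -
  obtain h1 h2 where h: "finite {x. h1 x \<noteq> 0}" "\<And>k. ft h1 k = g1 k" "finite {x. h2 x \<noteq> 0}" "\<And>k. ft h2 k = g2 k"
    using assms unfolding trig_poly_def by blast
  have "ft (conv h1 h2) k = g1 k * g2 k" for k
    using ft_conv[OF h(1,3), of k] h(2,4) by simp
  then show ?thesis unfolding trig_poly_def using finite_conv[OF h(1,3)]
    by (intro exI[of _ "conv h1 h2"] conjI allI)
qed

lemma trig_poly_one: "trig_poly (\<lambda>k. 1)"
  using trig_poly_monomial[of 1 0] by simp

lemma trig_poly_prod:
  assumes "finite I" "\<And>i. i \<in> I \<Longrightarrow> trig_poly (g i)"
  shows "trig_poly (\<lambda>k. \<Prod>i\<in>I. g i k)"
  using assms
proof (induction I rule: finite_induct)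
  case (insert i I)
  have "trig_poly (\<lambda>k. g i k * (\<Prod>i\<in>I. g i k))"
    using insert by (intro trig_poly_mult) auto
  then show ?case using insert.hyps by simp
qed (simp add: trig_poly_one)

lemma trig_poly_power: "trig_poly g \<Longrightarrow> trig_poly (\<lambda>k. g k ^ M)"
  using trig_poly_prod[of "{..<M}" "\<lambda>_. g"] by simp

text \<open>A trigonometric polynomial with its only maximum over a period at \<open>k0\<close>. Its powers concentrate there
and are Fourier transforms of finitely supported functions.\<close>

definition bump :: "real ^ 'n \<Rightarrow> real ^ 'n \<Rightarrow> real" where
  "bump k0 k = (\<Prod>i\<in>UNIV. (1 + cos (k $ i - k0 $ i)) / 2)"

lemma bump_factor: "0 \<le> (1 + cos t) / 2" "(1 + cos t) / 2 \<le> 1" for t :: real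
proof -
  have cos: "- 1 \<le> cos t" "cos t \<le> 1" by simp_all
  have "0 \<le> 1 + cos t" using cos(1) by linarith
  then show "0 \<le> (1 + cos t) / 2" by simp
  have "1 + cos t \<le> 2" using cos(2) by linarith
  then show "(1 + cos t) / 2 \<le> 1" by simp
qed

lemma bump_self: "bump k0 k0 = 1"
  by (simp add: bump_def)

lemma bump_nonneg: "0 \<le> bump k0 k"
  unfolding bump_def by (intro prod_nonneg ballI bump_factor)

lemma continuous_on_bump: "continuous_on S (bump k0)"
  unfolding bump_def by (intro continuous_intros continuous_on_component) auto

lemma bump_less_1:
  fixes k k0 :: "real ^ 'n"
  assumes "k \<noteq> k0" "\<And>i. \<bar>k $ i\<bar> \<le> pi" "\<And>i. \<bar>k0 $ i\<bar> < pi"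
  shows "bump k0 k < 1"
proof -
  obtain i where i: "k $ i \<noteq> k0 $ i" using assms(1) by (auto simp: vec_eq_iff)
  have "cos (k $ i - k0 $ i) < 1"
  proof (rule ccontr)
    assume "\<not> ?thesis"
    then have "cos (k $ i - k0 $ i) = 1" using cos_le_one[of "k $ i - k0 $ i"] by linarith
    then have "(sin ((k $ i - k0 $ i) / 2))\<^sup>2 = 0"
    proof -
      have "2 * ((k $ i - k0 $ i) / 2) = k $ i - k0 $ i" by simp
      from cos_double_sin[of "(k $ i - k0 $ i) / 2", unfolded this]
      show ?thesis using \<open>cos (k $ i - k0 $ i) = 1\<close> by simp
    qed
    then have "sin ((k $ i - k0 $ i) / 2) = 0" by simp
    moreover have "- (2 * pi) < k $ i - k0 $ i" using assms(2)[of i] assms(3)[of i] by linarith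
    then have "- pi < (k $ i - k0 $ i) / 2" by simp
    moreover have "k $ i - k0 $ i < 2 * pi" using assms(2)[of i] assms(3)[of i] by linarith
    then have "(k $ i - k0 $ i) / 2 < pi" by simp
    ultimately have "(k $ i - k0 $ i) / 2 = 0" using sin_eq_0_pi by blast
    then show False using i by simp
  qed
  have "bump k0 k = (1 + cos (k $ i - k0 $ i)) / 2 * (\<Prod>j\<in>UNIV - {i}. (1 + cos (k $ j - k0 $ j)) / 2)"
    unfolding bump_def by (subst prod.remove[of UNIV i]) auto
  also have "\<dots> \<le> (1 + cos (k $ i - k0 $ i)) / 2 * 1"
    by (intro mult_left_mono prod_le_1 bump_factor conjI)
  also have "\<dots> < 1" using \<open>cos (k $ i - k0 $ i) < 1\<close> by simp
  finally show ?thesis .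
qed

lemma bump_power_ft:
  fixes k0 :: "real ^ 'n"
  obtains h where "finite {x. h x \<noteq> 0}" "\<And>k. ft h k = of_real (bump k0 k ^ M)"
proof -
  have factor: "trig_poly (\<lambda>k :: real ^ 'n. of_real ((1 + cos (k $ i - k0 $ i)) / 2))" for i
  proof -
    have lp: "lattice_point (axis i 1 :: int ^ 'n) = axis i 1"
      by (simp add: lattice_point_def axis_def vec_eq_iff)
    have "trig_poly (\<lambda>k :: real ^ 'n. (1/2) * wave k 0 + (cis (- (k0 $ i)) / 4) * wave k (axis i 1)
        + (cis (k0 $ i) / 4) * wave k (- axis i 1))"
      by (intro trig_poly_add trig_poly_monomial)
    also have "(\<lambda>k :: real ^ 'n. (1/2) * wave k 0 + (cis (- (k0 $ i)) / 4) * wave k (axis i 1)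
        + (cis (k0 $ i) / 4) * wave k (- axis i 1)) = (\<lambda>k. of_real ((1 + cos (k $ i - k0 $ i)) / 2))"
    proof
      fix k :: "real ^ 'n"
      have "wave k (axis i 1) = cis (k $ i)" "wave k (- axis i 1) = cis (- (k $ i))"
        by (simp_all add: wave_def lattice_point_minus lp inner_axis)
      then show "(1/2) * wave k 0 + (cis (- (k0 $ i)) / 4) * wave k (axis i 1)
        + (cis (k0 $ i) / 4) * wave k (- axis i 1) = of_real ((1 + cos (k $ i - k0 $ i)) / 2)"
        by (simp add: complex_eq_iff cos_diff field_simps)
    qed
    finally show ?thesis .
  qed
  have "trig_poly (\<lambda>k :: real ^ 'n. (\<Prod>i\<in>UNIV. of_real ((1 + cos (k $ i - k0 $ i)) / 2)) ^ M)"
    by (intro trig_poly_power trig_poly_prod factor) simp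
  then obtain h where "finite {x. h x \<noteq> 0}"
    "\<And>k. ft h k = (\<Prod>i\<in>UNIV. of_real ((1 + cos (k $ i - k0 $ i)) / 2)) ^ M"
    unfolding trig_poly_def by blast
  then show ?thesis by (intro that[of h]) (simp_all only: bump_def of_real_power of_real_prod)
qed

text \<open>Suppose \<open>ft F k0 \<noteq> 0\<close> and convolve with a function whose transform is \<open>bump k0 ^ M\<close>. The new amplitude
vanishes where \<open>kappa\<close> lies in \<open>V\<close>, and elsewhere the bump is at most some \<open>q < 1\<close>; so the flux is
\<open>O(q^(2M))\<close>. On a small cube around \<open>k0\<close> the bump exceeds some \<open>q' > q\<close>, so the flux is at least a
constant times \<open>q'^(2M)\<close>. For large \<open>M\<close> this is a contradiction.\<close>

lemma amplitude_vanishing_local: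
  fixes F :: "int ^ 'n \<Rightarrow> complex"
  assumes amp: "is_far_field_amplitude F a" and lam: "lam \<in> Lambda CARD('n)" and F: "finite {x. F x \<noteq> 0}"
    and V: "open V" "\<And>k i. k \<in> V \<Longrightarrow> \<bar>k $ i\<bar> < pi"
    and k0: "k0 \<in> V" "phi k0 = lam" "gradphi k0 \<noteq> 0"
    and vanish: "\<And>\<omega>. norm \<omega> = 1 \<Longrightarrow> kappa \<omega> lam \<in> V \<Longrightarrow> a \<omega> lam = 0"
  shows "ft F k0 = 0"
proof (rule ccontr)
  assume "ft F k0 \<noteq> 0"
  define m0 where "m0 = cmod (ft F k0) / 2"
  have m0: "m0 > 0" "m0 < cmod (ft F k0)" using \<open>ft F k0 \<noteq> 0\<close> by (auto simp: m0_def)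
  \<comment> \<open>The positive lower bound makes \<open>q' / q\<close> meaningful in case the bump vanishes outside \<open>V\<close>.\<close>
  obtain q where q: "1/2 \<le> q" "q < 1" "\<And>k. k \<in> brillouin \<Longrightarrow> k \<notin> V \<Longrightarrow> bump k0 k \<le> q"
  proof (cases "brillouin - V = {}")
    case True
    then show ?thesis by (intro that[of "1/2"]) auto
  next
    case False
    have "compact (brillouin - V)"
      unfolding brillouin_def by (intro compact_diff compact_cbox V)
    then obtain k1 where k1: "k1 \<in> brillouin - V" "\<And>k. k \<in> brillouin - V \<Longrightarrow> bump k0 k \<le> bump k0 k1"
      using continuous_attains_sup[OF _ False continuous_on_bump[of _ k0]] by blast
    have "k1 \<noteq> k0" using k1(1) k0(1) by auto
    then have "bump k0 k1 < 1"
      using k1(1) V(2)[OF k0(1)] by (intro bump_less_1) (auto simp: mem_brillouin)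
    then show ?thesis
      using k1(2) by (intro that[of "max (1/2) (bump k0 k1)"]) (auto simp: le_max_iff_disj)
  qed
  define q' where "q' = (1 + q) / 2"
  have q': "q < q'" "q' < 1" "0 < q" using q by (auto simp: q'_def)
  define U where "U = V \<inter> {k. q' < bump k0 k} \<inter> {k. m0 < cmod (ft F k)}"
  have "open U" unfolding U_def
    by (intro open_Int V open_Collect_less continuous_intros continuous_on_bump)
  moreover have "k0 \<in> U" using k0 q' m0 by (simp add: U_def bump_self)
  ultimately obtain e where e: "e > 0" "ball k0 e \<subseteq> U" by (auto simp: open_contains_ball)
  define \<rho> where "\<rho> = e / (2 * real CARD('n))"
  have \<rho>: "\<rho> > 0" "real CARD('n) * \<rho> < e" using e by (auto simp: \<rho>_def)
  have cube_U: "cube k0 \<rho> \<subseteq> U"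
  proof
    fix k assume k: "k \<in> cube k0 \<rho>"
    have "norm (k - k0) \<le> (\<Sum>i\<in>UNIV. \<bar>(k - k0) $ i\<bar>)" by (rule norm_le_l1_cart)
    also have "\<dots> \<le> (\<Sum>i\<in>(UNIV :: 'n set). \<rho>)" using k by (intro sum_mono) (simp add: mem_cube)
    also have "\<dots> < e" using \<rho> by simp
    finally have "k \<in> ball k0 e" by (simp add: dist_norm norm_minus_commute)
    then show "k \<in> U" using e by blast
  qed
  have cube_b: "cube k0 \<rho> \<subseteq> brillouin"
    using cube_U V(2) unfolding U_def mem_brillouin subset_iff by (blast intro: less_imp_le)
  obtain i where i: "sin (k0 $ i) \<noteq> 0"
  proof -
    have "\<exists>i. gradphi k0 $ i \<noteq> 0" using k0(3) by (simp add: vec_eq_iff)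
    then show ?thesis using that by (auto simp: gradphi_def)
  qed
  obtain c where c: "c > 0"
    "\<And>\<epsilon>. 0 < \<epsilon> \<Longrightarrow> \<epsilon> \<le> \<rho> \<Longrightarrow> c * \<epsilon> \<le> measure lebesgue {k \<in> cube k0 \<rho>. \<bar>phi k - lam\<bar> \<le> \<epsilon>}"
    using measure_shell_lower[OF k0(2) i \<rho>(1)] by blast
  obtain A where A: "A \<ge> 0" "\<And>\<omega>. norm \<omega> = 1 \<Longrightarrow> cmod (a \<omega> lam) \<le> A"
  proof -
    have "continuous_on (sphere 0 1) (\<lambda>\<omega>. a \<omega> lam)"
      using amp lam unfolding is_far_field_amplitude_def by blast
    then have "bounded ((\<lambda>\<omega>. a \<omega> lam) ` sphere 0 1)"
      by (intro compact_imp_bounded compact_continuous_image compact_sphere)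
    then obtain A where "\<And>z. z \<in> (\<lambda>\<omega>. a \<omega> lam) ` sphere 0 1 \<Longrightarrow> cmod z \<le> A"
      by (auto simp: bounded_iff)
    then have "cmod (a \<omega> lam) \<le> \<bar>A\<bar>" if "norm \<omega> = 1" for \<omega>
      using that by (intro order_trans[OF _ abs_ge_self]) simp
    then show ?thesis by (intro that[of "\<bar>A\<bar>"]) auto
  qed
  obtain K :: "real ^ 'n \<Rightarrow> real ^ 'n" where K: "phase_function lam K"
    using phase_function_exists[OF lam] .
  have kb: "kappa \<omega> lam \<in> brillouin" if "norm \<omega> = 1" for \<omega> :: "real ^ 'n"
    using kappa_properties[OF lam] that by metis
  obtain \<psi> where out: "outgoing F lam \<psi>" and as: "\<And>h. finite {x. h x \<noteq> 0} \<Longrightarrow>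
      far_field K (\<lambda>\<omega>. ft h (K \<omega>) * a \<omega> lam) (conv h \<psi>)"
    using far_field_expansion[OF amp lam F K] by blast
  define D where "D = zone_volume TYPE('n) * (flux_constant TYPE('n)) * (A + 1)\<^sup>2"
  have bound: "c * m0\<^sup>2 / 2 * (q'\<^sup>2) ^ M \<le> D * (q\<^sup>2) ^ M" for M
  proof -
    obtain h where h: "finite {x. h x \<noteq> 0}" "\<And>k. ft h k = of_real (bump k0 k ^ M)"
      using bump_power_ft[of k0 M] by blast
    let ?G = "conv h F" and ?\<Psi> = "conv h \<psi>"
    have G: "finite {x. ?G x \<noteq> 0}" by (rule finite_conv[OF h(1) F])
    have outG: "outgoing ?G lam ?\<Psi>" by (rule outgoing_conv[OF h(1) F out])
    let ?J = "Im (\<Sum>x | ?G x \<noteq> 0. cnj (?\<Psi> x) * ?G x)"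
    have lower: "c * (m0 * q' ^ M)\<^sup>2 / 2 \<le> zone_volume TYPE('n) * ?J"
    proof (rule outgoing_flux_lower[OF G outG cube_b \<rho>(1) _ _ c(2)])
      fix k assume "k \<in> cube k0 \<rho>"
      then have k: "q' < bump k0 k" "m0 < cmod (ft F k)" using cube_U by (auto simp: U_def)
      have "m0 * q' ^ M \<le> cmod (ft F k) * bump k0 k ^ M"
        using k q' m0 by (intro mult_mono power_mono) auto
      also have "\<dots> = cmod (ft ?G k)"
        unfolding ft_conv[OF h(1) F] h(2) norm_mult norm_of_real
        using bump_nonneg[of k0 k] by simp
      finally show "m0 * q' ^ M \<le> cmod (ft ?G k)" .
    qed (use m0 q' in auto)
    have "eventually (\<lambda>x. norm (of_real (lattice_norm x powr decay_exponent TYPE('n)) * ?\<Psi> x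
           - wave (K (dir x)) (- x) * (ft h (K (dir x)) * a (dir x) lam)) < q ^ M) at_lattice_infinity"
      using order_tendstoD(2)[OF tendsto_norm_zero[OF as[OF h(1)]], of "q ^ M"] q' by simp
    with eventually_lattice_nonzero
    have "eventually (\<lambda>x. cmod (?\<Psi> x) * lattice_norm x powr decay_exponent TYPE('n) \<le> (A + 1) * q ^ M) at_lattice_infinity"
    proof eventually_elim
      case (elim x)
      have d: "norm (dir x) = 1" by (rule norm_dir[OF elim(1)])
      let ?main = "wave (K (dir x)) (- x) * (ft h (K (dir x)) * a (dir x) lam)"
      let ?lhs = "of_real (lattice_norm x powr decay_exponent TYPE('n)) * ?\<Psi> x"
      have "norm ?main = bump k0 (kappa (dir x) lam) ^ M * cmod (a (dir x) lam)"
        using bump_nonneg[of k0 "kappa (dir x) lam"]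
        by (simp add: norm_mult ft_phase_function[OF K d] h(2) norm_power)
      also have "\<dots> \<le> q ^ M * A"
      proof (cases "kappa (dir x) lam \<in> V")
        case True
        then show ?thesis using vanish[OF d] q' A(1) by simp
      next
        case False
        then show ?thesis
          using q(3)[OF kb[OF d]] A(2)[OF d] bump_nonneg q' by (intro mult_mono power_mono) auto
      qed
      finally have "norm ?main \<le> q ^ M * A" .
      moreover have "norm ?lhs \<le> norm (?lhs - ?main) + norm ?main"
        using norm_triangle_ineq[of "?lhs - ?main" ?main] by simp
      ultimately have "norm ?lhs \<le> (A + 1) * q ^ M" using elim(2) by (simp add: algebra_simps)
      then show ?case by (simp add: norm_mult mult.commute)
    qed
    then obtain R0 where R0: "\<And>x. R0 \<le> lattice_norm x \<Longrightarrow>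
        cmod (?\<Psi> x) * lattice_norm x powr decay_exponent TYPE('n) \<le> (A + 1) * q ^ M"
      unfolding at_lattice_infinity_def eventually_filtercomap_at_top_linorder by blast
    have "\<bar>?J\<bar>
        \<le> flux_constant TYPE('n) * ((A + 1) * q ^ M)\<^sup>2"
      by (rule flux_upper_bound[OF G outgoing_equation[OF G outG] R0])
    then have "zone_volume TYPE('n) * ?J
        \<le> zone_volume TYPE('n) * (flux_constant TYPE('n) * ((A + 1) * q ^ M)\<^sup>2)"
      by (intro mult_left_mono) (auto simp: zone_volume_def)
    with lower have "c * (m0 * q' ^ M)\<^sup>2 / 2
        \<le> zone_volume TYPE('n) * (flux_constant TYPE('n) * ((A + 1) * q ^ M)\<^sup>2)"
      by linarith
    moreover have "(m0 * q' ^ M)\<^sup>2 = m0\<^sup>2 * (q'\<^sup>2) ^ M" "((A + 1) * q ^ M)\<^sup>2 = (A + 1)\<^sup>2 * (q\<^sup>2) ^ M"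
      by (simp_all add: power_mult_distrib power_mult[symmetric] mult.commute)
    ultimately show ?thesis unfolding D_def by (simp only: mult.assoc times_divide_eq_left)
  qed
  have "1 < q'\<^sup>2 / q\<^sup>2"
    using q' by (simp add: power_strict_mono)
  then obtain M where M: "D * 2 / (c * m0\<^sup>2) < (q'\<^sup>2 / q\<^sup>2) ^ M"
    using real_arch_pow by blast
  have "D * 2 / (c * m0\<^sup>2) * (q\<^sup>2) ^ M < (q'\<^sup>2 / q\<^sup>2) ^ M * (q\<^sup>2) ^ M"
    using M q' by (intro mult_strict_right_mono) auto
  also have "\<dots> = (q'\<^sup>2) ^ M" using q' by (simp add: power_divide)
  finally have "D * (q\<^sup>2) ^ M < c * m0\<^sup>2 / 2 * (q'\<^sup>2) ^ M"
    using c(1) m0(1) by (simp add: field_simps)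
  then show False using bound[of M] by simp
qed

section \<open>Recovery of the source\<close>

lemma finite_lattice_support:
  fixes f :: "int ^ 'n \<Rightarrow> complex"
  assumes "bounded D" "lattice_point ` {x. f x \<noteq> 0} \<subseteq> D"
  shows "finite {x. f x \<noteq> 0}"
proof -
  obtain B where B: "B > 0" "\<And>y. y \<in> D \<Longrightarrow> norm y \<le> B"
    using assms(1) by (auto simp: bounded_pos)
  have "{x. f x \<noteq> 0} \<subseteq> {x. lattice_norm x \<le> B}" using assms(2) B(2) by blast
  moreover have "finite {x :: int ^ 'n. lattice_norm x \<le> B}"
    using B(1) by (intro finite_lattice_ball) simp
  ultimately show ?thesis by (rule finite_subset)
qed

definition reflect :: "(int ^ 'n \<Rightarrow> complex) \<Rightarrow> int ^ 'n \<Rightarrow> complex" where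
  "reflect G x = cnj (G (- x))"

lemma reflect_support: "{x. reflect G x \<noteq> 0} = uminus ` {x. G x \<noteq> 0}"
  by (auto simp: reflect_def intro: image_eqI[of _ _ "- x" for x])

lemma ft_reflect: "ft (reflect G) k = cnj (ft G k)"
proof -
  have "ft (reflect G) k = (\<Sum>x\<in>uminus ` {x. G x \<noteq> 0}. reflect G x * wave k x)"
    by (simp add: ft_def reflect_support)
  also have "\<dots> = (\<Sum>x | G x \<noteq> 0. cnj (G x) * cnj (wave k x))"
    by (subst sum.reindex) (auto simp: reflect_def wave_minus)
  finally show ?thesis by (simp add: ft_def)
qed

lemma autocorrelation:
  assumes "finite A" "\<And>x. F x \<noteq> 0 \<Longrightarrow> x \<in> A"
  shows "conv F (reflect G) z = (\<Sum>y\<in>A. F y * cnj (G (y - z)))"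
  unfolding conv_def reflect_def using assms by (intro sum.mono_neutral_cong_left) auto

text \<open>The squared modulus of \<open>ft F\<close> is the Fourier transform of the autocorrelation of \<open>F\<close>, and a trigonometric
polynomial is determined by its values on an open set.\<close>

lemma autocorrelation_determined:
  fixes F1 F2 :: "int ^ 'n \<Rightarrow> complex"
  assumes F1: "finite {x. F1 x \<noteq> 0}" and F2: "finite {x. F2 x \<noteq> 0}"
    and W: "open W" "W \<noteq> {}" and eq: "\<And>k. k \<in> W \<Longrightarrow> cmod (ft F1 k) = cmod (ft F2 k)"
  shows "conv F1 (reflect F1) = conv F2 (reflect F2)"
proof -
  have r: "finite {x. reflect F1 x \<noteq> 0}" "finite {x. reflect F2 x \<noteq> 0}"
    using F1 F2 by (simp_all add: reflect_support)
  let ?C1 = "conv F1 (reflect F1)" and ?C2 = "conv F2 (reflect F2)"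
  have fin: "finite {x. ?C1 x \<noteq> 0}" "finite {x. ?C2 x \<noteq> 0}"
    by (rule finite_conv[OF F1 r(1)], rule finite_conv[OF F2 r(2)])
  have "?C1 x + (- 1) * ?C2 x = 0" for x
  proof (rule ft_zero_imp_zero[OF ft_add(2)[OF fin] W])
    fix k assume "k \<in> W"
    have "ft F k * cnj (ft F k) = of_real ((cmod (ft F k))\<^sup>2)" for F :: "int ^ 'n \<Rightarrow> complex"
      by (simp only: complex_norm_square)
    then show "ft (\<lambda>x. ?C1 x + (- 1) * ?C2 x) k = 0"
      unfolding ft_add(1)[OF fin] ft_conv[OF F1 r(1)] ft_conv[OF F2 r(2)] ft_reflect
      by (simp add: eq[OF \<open>k \<in> W\<close>])
  qed
  then show ?thesis by (simp add: fun_eq_iff)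
qed

text \<open>Let \<open>z\<close> be a displacement from a point of \<open>D0\<close> to a point of \<open>D\<close>. It is longer than the diameter of \<open>D\<close>, so
neither \<open>f\<close> nor \<open>g\<close> correlates with itself at \<open>z\<close>. It is not a displacement from \<open>D\<close> to \<open>D0\<close> either: if
\<open>z = p - q = q' - p'\<close> with \<open>p\<close>, \<open>p'\<close> in \<open>D\<close> and \<open>q\<close>, \<open>q'\<close> in \<open>D0\<close>, then the midpoint of \<open>p\<close> and \<open>p'\<close> is
also that of \<open>q\<close> and \<open>q'\<close>, and convexity puts it in both sets. The known autocorrelation of \<open>f0\<close> cancels, which leaves the cross-correlation of \<open>f - g\<close>
with \<open>f0\<close>.\<close>

lemma source_from_autocorrelation:
  fixes D0 D :: "(real ^ 'n) set" and f0 f g :: "int ^ 'n \<Rightarrow> complex"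
  assumes conv: "convex D0" "convex D" and bdd: "bounded D0" "bounded D"
    and far: "setdist D D0 > diameter D"
    and f0: "lattice_point ` {x. f0 x \<noteq> 0} \<subseteq> D0" "\<exists>x. f0 x \<noteq> 0"
    and f: "lattice_point ` {x. f x \<noteq> 0} \<subseteq> D" and g: "lattice_point ` {x. g x \<noteq> 0} \<subseteq> D"
    and eq: "conv (\<lambda>x. f x + f0 x) (reflect (\<lambda>x. f x + f0 x)) = conv (\<lambda>x. g x + f0 x) (reflect (\<lambda>x. g x + f0 x))"
  shows "f = g"
proof -
  have fin0: "finite {x. f0 x \<noteq> 0}" and finf: "finite {x. f x \<noteq> 0}" and fing: "finite {x. g x \<noteq> 0}"
    by (rule finite_lattice_support[OF bdd(1) f0(1)], rule finite_lattice_support[OF bdd(2) f],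
        rule finite_lattice_support[OF bdd(2) g])
  let ?A = "{x. f x \<noteq> 0} \<union> {x. g x \<noteq> 0} \<union> {x. f0 x \<noteq> 0}"
  have finA: "finite ?A" using fin0 finf fing by simp
  have disj: "D \<inter> D0 = {}"
  proof (rule ccontr)
    assume "D \<inter> D0 \<noteq> {}"
    then have "setdist D D0 = 0" by (auto intro: setdist_eq_0I)
    then show False using far diameter_ge_0[OF bdd(2)] by simp
  qed
  have same: "u y * cnj (v (y - z)) = 0"
    if "lattice_point ` {x. u x \<noteq> 0} \<subseteq> D" "lattice_point ` {x. v x \<noteq> 0} \<subseteq> D"
      and pq: "p \<in> D" "q \<in> D0" "lattice_point z = p - q"
    for u v :: "int ^ 'n \<Rightarrow> complex" and y z p q
  proof (rule ccontr)
    assume "u y * cnj (v (y - z)) \<noteq> 0"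
    then have "lattice_point y \<in> D" "lattice_point (y - z) \<in> D" using that(1,2) by auto
    then have "dist (lattice_point y) (lattice_point (y - z)) \<le> diameter D"
      by (rule diameter_bounded_bound[OF bdd(2)])
    then have "dist p q \<le> diameter D" using pq by (simp add: dist_norm lattice_point_diff)
    then show False using setdist_le_dist[OF pq(1,2)] far by linarith
  qed
  have opposite: "f0 y * cnj (v (y - z)) = 0"
    if v: "lattice_point ` {x. v x \<noteq> 0} \<subseteq> D" and pq: "p \<in> D" "q \<in> D0" "lattice_point z = p - q"
    for v :: "int ^ 'n \<Rightarrow> complex" and y z p q
  proof (rule ccontr)
    assume "f0 y * cnj (v (y - z)) \<noteq> 0"
    then have y: "lattice_point y \<in> D0" "lattice_point (y - z) \<in> D" using v f0(1) by auto
    have "(1/2) *\<^sub>R p + (1/2) *\<^sub>R lattice_point (y - z) \<in> D"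
      using pq y conv(2) by (intro convexD) auto
    moreover have "(1/2) *\<^sub>R q + (1/2) *\<^sub>R lattice_point y \<in> D0"
      using pq y conv(1) by (intro convexD) auto
    moreover have "(1/2) *\<^sub>R p + (1/2) *\<^sub>R lattice_point (y - z) = (1/2) *\<^sub>R q + (1/2) *\<^sub>R lattice_point y"
      unfolding lattice_point_diff pq(3) by (simp add: scaleR_diff_right[symmetric] scaleR_add_right[symmetric])
    ultimately show False using disj by auto
  qed
  define w where "w x = f x + (- 1) * g x" for x
  have finw: "finite {x. w x \<noteq> 0}" unfolding w_def by (rule ft_add(2)[OF finf fing])
  have corr: "conv w (reflect f0) z = 0" for z
  proof -
    have c1: "conv w (reflect f0) z = (\<Sum>y\<in>?A. w y * cnj (f0 (y - z)))"
      by (rule autocorrelation[OF finA]) (auto simp: w_def)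
    show ?thesis
    proof (cases "\<exists>y\<in>?A. w y * cnj (f0 (y - z)) \<noteq> 0")
      case True
      then obtain y where y: "w y \<noteq> 0" "f0 (y - z) \<noteq> 0" by auto
      then have "f y \<noteq> 0 \<or> g y \<noteq> 0" by (auto simp: w_def)
      then have p: "lattice_point y \<in> D" using f g by auto
      have q: "lattice_point (y - z) \<in> D0" using y(2) f0(1) by auto
      have z: "lattice_point z = lattice_point y - lattice_point (y - z)" by (simp add: lattice_point_diff)
      have expand: "conv (\<lambda>x. v x + f0 x) (reflect (\<lambda>x. v x + f0 x)) z
          = (\<Sum>y\<in>?A. v y * cnj (f0 (y - z))) + (\<Sum>y\<in>?A. f0 y * cnj (f0 (y - z)))"
        if v: "lattice_point ` {x. v x \<noteq> 0} \<subseteq> D" "{x. v x \<noteq> 0} \<subseteq> ?A" for v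
      proof -
        have "conv (\<lambda>x. v x + f0 x) (reflect (\<lambda>x. v x + f0 x)) z
            = (\<Sum>y\<in>?A. (v y + f0 y) * cnj (v (y - z) + f0 (y - z)))"
          using v(2) by (intro autocorrelation[OF finA]) auto
        also have "\<dots> = (\<Sum>y\<in>?A. v y * cnj (f0 (y - z)) + f0 y * cnj (f0 (y - z)))"
        proof (rule sum.cong[OF refl])
          fix y' assume "y' \<in> ?A"
          have "v y' * cnj (v (y' - z)) = 0" by (rule same[OF v(1) v(1) p q z])
          moreover have "f0 y' * cnj (v (y' - z)) = 0" by (rule opposite[OF v(1) p q z])
          ultimately show "(v y' + f0 y') * cnj (v (y' - z) + f0 (y' - z)) = v y' * cnj (f0 (y' - z)) + f0 y' * cnj (f0 (y' - z))"
            by (simp only: complex_cnj_add distrib_left distrib_right) simp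
        qed
        finally show ?thesis by (simp only: sum.distrib)
      qed
      have "(\<Sum>y\<in>?A. f y * cnj (f0 (y - z))) = (\<Sum>y\<in>?A. g y * cnj (f0 (y - z)))"
      proof -
        have "{x. f x \<noteq> 0} \<subseteq> ?A" "{x. g x \<noteq> 0} \<subseteq> ?A" by blast+
        from expand[OF f this(1)] expand[OF g this(2)] fun_cong[OF eq, of z]
        show ?thesis by (simp only: add_right_cancel)
      qed
      then show ?thesis unfolding c1 w_def by (simp add: left_diff_distrib sum_subtractf)
    next
      case False
      then show ?thesis unfolding c1 by (intro sum.neutral) blast
    qed
  qed
  have prod0: "ft w k * cnj (ft f0 k) = 0" for k
  proof -
    have "finite {x. reflect f0 x \<noteq> 0}" using fin0 by (simp add: reflect_support)
    from ft_conv[OF finw this, of k] have "ft w k * cnj (ft f0 k) = ft (conv w (reflect f0)) k"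
      by (simp add: ft_reflect)
    then show ?thesis by (simp add: ft_def[of "conv w (reflect f0)"] corr)
  qed
  have "w x = 0" for x
  proof (rule ft_zero_imp_zero[OF finw])
    show "open {k. ft f0 k \<noteq> 0}"
      by (intro open_Collect_neq continuous_intros)
    show "{k. ft f0 k \<noteq> 0} \<noteq> {}"
    proof
      assume "{k. ft f0 k \<noteq> 0} = {}"
      then have "f0 x = 0" for x using ft_zero_imp_zero[OF fin0 open_UNIV] by auto
      then show False using f0(2) by blast
    qed
    show "ft w k = 0" if "k \<in> {k. ft f0 k \<noteq> 0}" for k using prod0[of k] that by simp
  qed
  then show ?thesis by (simp add: w_def fun_eq_iff)
qed

theorem theorem2p11:
  fixes D0 D :: "(real ^ 'n) set"
    and f0 f g :: "int ^ 'n \<Rightarrow> complex"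
    and a1 a2 :: "real ^ 'n \<Rightarrow> real \<Rightarrow> complex"
    and N :: "((real ^ 'n) \<times> real) set"
    and om0 :: "real ^ 'n" and lam0 :: real
  assumes "open D0" and "convex D0" and "bounded D0"
    and "open D" and "convex D" and "bounded D"
    and "D0 \<inter> range lattice_point \<noteq> {}"
    and "D \<inter> range lattice_point \<noteq> {}"
    and "setdist D D0 > diameter D"
    and "lattice_point ` {x. f0 x \<noteq> 0} \<subseteq> D0"
    and "\<exists>x. f0 x \<noteq> 0"
    and "lattice_point ` {x. f x \<noteq> 0} \<subseteq> D"
    and "lattice_point ` {x. g x \<noteq> 0} \<subseteq> D"
    and "is_far_field_amplitude (\<lambda>x. f x + f0 x) a1"
    and "is_far_field_amplitude (\<lambda>x. g x + f0 x) a2"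
    and "openin (top_of_set (sphere 0 1 \<times> Lambda CARD('n))) N"
    and "(om0, lam0) \<in> N"
    and "\<forall>(\<omega>, lam)\<in>N. (cmod (a1 \<omega> lam))\<^sup>2 = (cmod (a2 \<omega> lam))\<^sup>2"
  shows "f = g"
proof -
  define F1 where "F1 x = f x + f0 x" for x
  define F2 where "F2 x = g x + f0 x" for x
  have fin0: "finite {x. f0 x \<noteq> 0}" and finf: "finite {x. f x \<noteq> 0}" and fing: "finite {x. g x \<noteq> 0}"
    by (rule finite_lattice_support[OF assms(3,10)], rule finite_lattice_support[OF assms(6,12)],
        rule finite_lattice_support[OF assms(6,13)])
  have F1: "finite {x. F1 x \<noteq> 0}" and F2: "finite {x. F2 x \<noteq> 0}"
    unfolding F1_def F2_def using ft_add(2)[OF finf fin0, of 1] ft_add(2)[OF fing fin0, of 1] by simp_all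
  have amp1: "is_far_field_amplitude F1 a1" and amp2: "is_far_field_amplitude F2 a2"
    using assms(14,15) by (simp_all add: F1_def[abs_def] F2_def[abs_def])
  have N_sub: "\<omega> \<in> sphere 0 1" "lam \<in> Lambda CARD('n)" if "(\<omega>, lam) \<in> N" for \<omega> :: "real ^ 'n" and lam
    using openin_subset[OF assms(16)] that by auto
  obtain T where T: "open T" "N = (sphere 0 1 \<times> Lambda CARD('n)) \<inter> T"
    using assms(16) by (auto simp: openin_open)
  have openL: "open (Lambda CARD('n))"
    unfolding Lambda_def by (intro open_Collect_conj open_Collect_less continuous_intros)
  \<comment> \<open>The points of momentum space that \<open>N\<close> sees; \<open>W\<close> is their part inside the cell.\<close>
  define S :: "(real ^ 'n) set" where
    "S = {k. gradphi k \<noteq> 0} \<inter> (\<lambda>k. (unit_normal k, phi k)) -` (T \<inter> (UNIV \<times> Lambda CARD('n)))"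
  have "open S" unfolding S_def
  proof (rule continuous_open_preimage)
    show "open {k :: real ^ 'n. gradphi k \<noteq> 0}"
      by (intro open_Collect_neq continuous_intros)
    show "continuous_on {k :: real ^ 'n. gradphi k \<noteq> 0} (\<lambda>k. (unit_normal k, phi k))"
      unfolding unit_normal_def by (intro continuous_intros) auto
    show "open (T \<inter> (UNIV \<times> Lambda CARD('n)))"
      by (intro open_Int T open_Times open_UNIV openL)
  qed
  have S_N: "(unit_normal k, phi k) \<in> N" if "k \<in> S" for k
    using that norm_unit_normal[of k] by (auto simp: S_def T)
  define Q :: "(real ^ 'n) set" where "Q = box (\<chi> i. - pi) (\<chi> i. pi)"
  have mem_Q: "k \<in> Q \<longleftrightarrow> (\<forall>i. \<bar>k $ i\<bar> < pi)" for k :: "real ^ 'n"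
    by (simp add: Q_def mem_box_cart abs_less_iff minus_less_iff conj_commute)
  define W where "W = S \<inter> Q"
  have openW: "open W" unfolding W_def Q_def by (intro open_Int \<open>open S\<close> open_box)
  have lam0: "lam0 \<in> Lambda CARD('n)" and om0: "norm om0 = 1" using N_sub[OF assms(17)] by auto
  define k1 where "k1 = kappa om0 lam0"
  have k1: "k1 \<in> brillouin" "phi k1 = lam0" "unit_normal k1 = om0"
    unfolding k1_def using kappa_properties[OF lam0] om0 by metis+
  have "gradphi k1 \<noteq> 0"
  proof
    assume "gradphi k1 = 0"
    then have "unit_normal k1 = 0" by (simp add: unit_normal_def)
    then show False using k1(3) om0 by simp
  qed
  then have "k1 \<in> S" using assms(17) lam0 unfolding S_def T(2) by (simp add: k1(2,3))
  have "W \<noteq> {}"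
  proof -
    have "0 \<in> Q" by (simp add: mem_Q)
    then have "closure Q = (brillouin :: (real ^ 'n) set)"
      unfolding Q_def brillouin_def by (intro closure_box) auto
    then have "S \<inter> closure Q \<noteq> {}" using \<open>k1 \<in> S\<close> k1(1) by auto
    then show ?thesis unfolding W_def using open_Int_closure_eq_empty[OF \<open>open S\<close>, of Q] by blast
  qed
  define V where "V = W \<inter> {k. cmod (ft F1 k) \<noteq> cmod (ft F2 k)}"
  have "open V" unfolding V_def
    by (intro open_Int openW open_Collect_neq continuous_intros)
  have "V = {}"
  proof (rule ccontr)
    assume "V \<noteq> {}"
    then obtain k0 where k0: "k0 \<in> V" by blast
    define lam where "lam = phi k0"
    have k0S: "k0 \<in> S" using k0 by (simp add: V_def W_def)
    have g0: "gradphi k0 \<noteq> 0" using k0S by (simp add: S_def)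
    have lam: "lam \<in> Lambda CARD('n)" using N_sub(2)[OF S_N[OF k0S]] by (simp add: lam_def)
    have V_small: "\<bar>k $ i\<bar> < pi" if "k \<in> V" for k i using that by (simp add: V_def W_def mem_Q)
    have kap: "unit_normal (kappa \<omega> lam) = \<omega>" "phi (kappa \<omega> lam) = lam" if "norm \<omega> = 1" for \<omega> :: "real ^ 'n"
      using kappa_properties[OF lam] that by metis+
    \<comment> \<open>Equal moduli and unequal factors in the ratio formula leave only zero.\<close>
    have zero: "a1 \<omega> lam = 0 \<and> a2 \<omega> lam = 0" if \<omega>: "norm \<omega> = 1" and kV: "kappa \<omega> lam \<in> V" for \<omega>
    proof -
      have "kappa \<omega> lam \<in> S" using kV by (simp add: V_def W_def)
      from S_N[OF this] have "(\<omega>, lam) \<in> N" by (simp only: kap[OF \<omega>])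
      then have "(cmod (a1 \<omega> lam))\<^sup>2 = (cmod (a2 \<omega> lam))\<^sup>2" using assms(18) by blast
      then have eq: "cmod (a1 \<omega> lam) = cmod (a2 \<omega> lam)" by (simp add: power2_eq_iff_nonneg)
      have "cmod (ft F2 (kappa \<omega> lam)) * cmod (a1 \<omega> lam) = cmod (ft F1 (kappa \<omega> lam)) * cmod (a2 \<omega> lam)"
        using amplitude_ratio[OF amp1 amp2 lam F1 F2 \<omega>] by (metis norm_mult)
      moreover have "cmod (ft F1 (kappa \<omega> lam)) \<noteq> cmod (ft F2 (kappa \<omega> lam))" using kV by (simp add: V_def)
      ultimately have "cmod (a1 \<omega> lam) = 0" using eq by auto
      then show ?thesis using eq by simp
    qed
    have "ft F1 k0 = 0"
      by (rule amplitude_vanishing_local[OF amp1 lam F1 \<open>open V\<close> V_small k0 lam_def[symmetric] g0])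
        (use zero in blast)+
    moreover have "ft F2 k0 = 0"
      by (rule amplitude_vanishing_local[OF amp2 lam F2 \<open>open V\<close> V_small k0 lam_def[symmetric] g0])
        (use zero in blast)+
    ultimately show False using k0 by (simp add: V_def)
  qed
  then have "conv F1 (reflect F1) = conv F2 (reflect F2)"
    by (intro autocorrelation_determined[OF F1 F2 openW \<open>W \<noteq> {}\<close>]) (auto simp: V_def)
  then show "f = g"
    unfolding F1_def[abs_def] F2_def[abs_def]
    by (rule source_from_autocorrelation[OF assms(2,5,3,6,9,10,11,12,13)])
qed

end
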